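(* Let $d\ge 1$ and $m\ge 1$ be integers and let $A_1,\dots,A_m$ be self-adjoint elements of $M_d(\mathbb C)$. For $i=1,\dots,m$ and $n\in\mathbb N$ define \[ H_{i,n}:=\frac{1}{2n+1}\sum_{j=-n}^{n}\gamma_j(A_i)\in\mathcal A_n . \] Then there exist self-adjoint elements $Y_{i,n}\in\mathcal A_n$ ($i=1,\dots,m$, $n\in\mathbb N$) such that \[ \lim_{n\to\infty}\|H_{i,n}-Y_{i,n}\|=0\quad\text{for all } i=1,\dots,m, \] and $[Y_{i,n},Y_{j,n}]=0$ for all $i,j=1,\dots,m$ and all $n\in\mathbb N$.
   Context: $\mathcal A_{\mathbb Z}=\overline{\bigotimes_{\mathbb Z}M_d(\mathbb C)}^{C^*}$ is the UHF $C^*$-algebra obtained as the $C^*$-inductive limit of the local algebras $\mathcal A_\Lambda=\bigotimes_{\Lambda}M_d(\mathbb C)$, $\Lambda\subset\mathbb Z$ finite. We write $\mathcal A_n:=\mathcal A_{[-n,n]}$. Elements of $M_d(\mathbb C)$ are identified with elements of $\mathcal A_{\{0\}}$ (the copy at site $0$), and $\gamma_j$, $j\in\mathbb Z$, denotes the lattice translation automorphism by $j$ sites of $\mathcal A_{\mathbb Z}$. *)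

theory Defs
  imports "HOL-Analysis.Analysis"
begin

text \<open>Concrete model of the local algebras of the quantum spin chain.
  A configuration assigns to every lattice site k an index in {0..<d};
  the local algebra A_n = tensor product over [-n,n] of M_d(C) is realised as the
  algebra of matrices indexed by configurations supported in [-n,n]
  (the Hilbert space is C^(configs d n), of dimension d^(2n+1)).\<close>

type_synonym config = "int \<Rightarrow> nat"
type_synonym op = "config \<Rightarrow> config \<Rightarrow> complex"

definition configs :: "nat \<Rightarrow> nat \<Rightarrow> config set" where
  "configs d n = {\<sigma>. (\<forall>k. \<bar>k\<bar> \<le> int n \<longrightarrow> \<sigma> k < d) \<and> (\<forall>k. int n < \<bar>k\<bar> \<longrightarrow> \<sigma> k = 0)}"

definition in_local_alg :: "nat \<Rightarrow> nat \<Rightarrow> op \<Rightarrow> bool" where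
  "in_local_alg d n X \<longleftrightarrow>
     (\<forall>\<sigma> \<tau>. \<sigma> \<notin> configs d n \<or> \<tau> \<notin> configs d n \<longrightarrow> X \<sigma> \<tau> = 0)"

definition op_mult :: "nat \<Rightarrow> nat \<Rightarrow> op \<Rightarrow> op \<Rightarrow> op" where
  "op_mult d n X Y = (\<lambda>\<sigma> \<tau>. \<Sum>\<rho>\<in>configs d n. X \<sigma> \<rho> * Y \<rho> \<tau>)"

definition op_adjoint :: "op \<Rightarrow> op" where
  "op_adjoint X = (\<lambda>\<sigma> \<tau>. cnj (X \<tau> \<sigma>))"

definition op_selfadjoint :: "op \<Rightarrow> bool" where
  "op_selfadjoint X \<longleftrightarrow> op_adjoint X = X"

definition op_apply :: "nat \<Rightarrow> nat \<Rightarrow> op \<Rightarrow> (config \<Rightarrow> complex) \<Rightarrow> (config \<Rightarrow> complex)" where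
  "op_apply d n X v = (\<lambda>\<sigma>. \<Sum>\<tau>\<in>configs d n. X \<sigma> \<tau> * v \<tau>)"

definition vec_norm :: "nat \<Rightarrow> nat \<Rightarrow> (config \<Rightarrow> complex) \<Rightarrow> real" where
  "vec_norm d n v = sqrt (\<Sum>\<sigma>\<in>configs d n. (cmod (v \<sigma>))\<^sup>2)"

definition op_norm :: "nat \<Rightarrow> nat \<Rightarrow> op \<Rightarrow> real" where
  "op_norm d n X = Sup {vec_norm d n (op_apply d n X v) | v. vec_norm d n v \<le> 1}"

definition mat_selfadjoint :: "nat \<Rightarrow> (nat \<Rightarrow> nat \<Rightarrow> complex) \<Rightarrow> bool" where
  "mat_selfadjoint d A \<longleftrightarrow> (\<forall>a<d. \<forall>b<d. A a b = cnj (A b a))"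

text \<open>gamma_j(A) for A in M_d(C) (a copy at site 0), viewed in A_n (for |j| <= n):
  A acting at site j, identity at all other sites of [-n,n].\<close>
definition site_op :: "nat \<Rightarrow> nat \<Rightarrow> int \<Rightarrow> (nat \<Rightarrow> nat \<Rightarrow> complex) \<Rightarrow> op" where
  "site_op d n j A = (\<lambda>\<sigma> \<tau>.
     if \<sigma> \<in> configs d n \<and> \<tau> \<in> configs d n \<and> (\<forall>k. k \<noteq> j \<longrightarrow> \<sigma> k = \<tau> k)
     then A (\<sigma> j) (\<tau> j) else 0)"

definition mean_op :: "nat \<Rightarrow> nat \<Rightarrow> (nat \<Rightarrow> nat \<Rightarrow> complex) \<Rightarrow> op" where
  "mean_op d n A = (\<lambda>\<sigma> \<tau>.
     (1 / of_nat (2 * n + 1)) * (\<Sum>j\<in>{- int n..int n}. site_op d n j A \<sigma> \<tau>))"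

end

theory Submission
  imports Defs "HOL-Computational_Algebra.Fundamental_Theorem_Algebra"
begin

text \<open>Leave out a bounded number of sites at one end. This changes the means by \<open>O(1/n)\<close> and
  provides a bounded but large number of copies of the remaining chain. The means on the remaining
  chain commute up to \<open>O(1/n)\<close>, so a product of cosine partitions of unity, one factor for each
  mean, splits every vector into finitely many pieces, each of them a joint approximate eigenvector
  for some grid point. Pieces at points away from the origin (the matrices being normalised to
  trace zero) are cut down to genuine joint approximate eigenspaces, and the rest is assigned to
  the origin.

  Let \<open>t\<^sub>j = 1 - j/Q\<close>. The dimension of the joint approximate eigenspace at a point \<open>x\<close> is
  supermultiplicative in the length of the chain, and by a Chernoff bound it is exponentially
  smaller than \<open>d^N\<close> unless \<open>x\<close> is close to the origin. Filling a fraction \<open>j/Q\<close> of the chain with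
  vectors near the origin therefore yields room near \<open>t\<^sub>j x\<close> for arbitrarily many times the
  dimension available at \<open>x\<close>. Hence the part \<open>Y\<close> of the space left over by these eigenspaces embeds
  isometrically at every level \<open>j\<close>, on pairwise orthogonal images, with the means acting on the
  image like \<open>t\<^sub>j\<close> times their compression to \<open>Y\<close>. Cyclically shifting \<open>Y\<close> along these levels
  changes the means by \<open>O(1/\<surd>Q)\<close> only and brings the last level, where they are close to zero,
  onto \<open>Y\<close>; on the complement of \<open>Y\<close> they are almost diagonal by construction.\<close>

section \<open>Finitely supported complex vectors\<close>

text \<open>Small commutators alone are not enough: for three or more self-adjoint matrices they do
  not force nearby commuting ones. The cosine partition dilates the tuple to a diagonal one, but on
  a larger space; the obstacle is to fit this larger space, isometrically and orthogonally, into the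
  one that is given. At a grid point \<open>x\<close> itself no dimension is to spare, whereas every
  contracted point \<open>t * x\<close> with \<open>t < 1\<close> has exponentially more room. This
  forces a ladder of levels from 1 down to 0: a step of length \<open>1 / Q\<close> is cheap, the
  errors of the \<open>Q\<close> mutually orthogonal levels accumulate only with the factor
  \<open>sqrt Q\<close> by Cauchy-Schwarz, and at level 0 the value zero is already a good diagonal
  entry, so nothing remains to be diagonalised. The left-out sites serve as a label space: a
  separate label for each pair of a level and an outcome of the partition makes the images exactly
  orthogonal. The number of left-out sites is bounded before the length of the chain is chosen, so
  the gain in dimension needed to compress all labelled copies into one is a constant, while the
  available gain grows with the length.\<close>

typedef 'a fvec = "{f :: 'a \<Rightarrow> complex. finite {a. f a \<noteq> 0}}"
  morphisms coord FVec
  by (rule exI[of _ "\<lambda>_. 0"]) auto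

definition csupp :: "'a fvec \<Rightarrow> 'a set" where
  "csupp v = {a. coord v a \<noteq> 0}"

lemma finite_csupp [simp]: "finite (csupp v)"
  using coord[of v] by (simp add: csupp_def)

lemma finite_supp_coord [simp]: "finite {a. coord v a \<noteq> 0}"
  using coord[of v] by simp

lemma coord_FVec: "finite {a. f a \<noteq> 0} \<Longrightarrow> coord (FVec f) = f"
  by (rule FVec_inverse) auto

lemma fvec_eqI: "(\<And>a. coord u a = coord v a) \<Longrightarrow> u = v"
  by (metis coord_inject ext)

text \<open>Conjugate linear in the first argument. Summing over the support instead of a fixed
  index set lets words of all lengths, and later pairs of a word and a label, live in one vector
  type; finite dimension enters only through finite orthonormal sets.\<close>

definition cip :: "'a fvec \<Rightarrow> 'a fvec \<Rightarrow> complex" where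
  "cip u v = (\<Sum>a\<in>csupp u. cnj (coord u a) * coord v a)"

definition csc :: "complex \<Rightarrow> 'a fvec \<Rightarrow> 'a fvec" where
  "csc c v = FVec (\<lambda>a. c * coord v a)"

lemma coord_csc [simp]: "coord (csc c v) a = c * coord v a"
proof -
  have "finite {a. c * coord v a \<noteq> 0}"
    by (rule finite_subset[of _ "csupp v"]) (auto simp: csupp_def)
  then show ?thesis by (simp add: csc_def coord_FVec)
qed

lemma cip_superset: "finite A \<Longrightarrow> csupp u \<subseteq> A \<Longrightarrow> cip u v = (\<Sum>a\<in>A. cnj (coord u a) * coord v a)"
  unfolding cip_def by (rule sum.mono_neutral_left) (auto simp: csupp_def)

instantiation fvec :: (type) ab_group_add
begin

definition "0 = FVec (\<lambda>_. 0)"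
definition "u + v = FVec (\<lambda>a. coord u a + coord v a)"
definition "u - v = FVec (\<lambda>a. coord u a - coord v a)"
definition "- v = FVec (\<lambda>a. - coord v a)"

lemma coord_zero [simp]: "coord 0 a = 0"
  by (simp add: zero_fvec_def coord_FVec)

lemma coord_add [simp]: "coord (u + v) a = coord u a + coord v a"
proof -
  have "finite {a. coord u a + coord v a \<noteq> 0}"
    by (rule finite_subset[of _ "csupp u \<union> csupp v"]) (auto simp: csupp_def)
  then show ?thesis by (simp add: plus_fvec_def coord_FVec)
qed

lemma coord_diff [simp]: "coord (u - v) a = coord u a - coord v a"
proof -
  have "finite {a. coord u a - coord v a \<noteq> 0}"
    by (rule finite_subset[of _ "csupp u \<union> csupp v"]) (auto simp: csupp_def)
  then show ?thesis by (simp add: minus_fvec_def coord_FVec)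
qed

lemma coord_minus [simp]: "coord (- v) a = - coord v a"
proof -
  have "finite {a. - coord v a \<noteq> 0}"
    by (rule finite_subset[of _ "csupp v"]) (auto simp: csupp_def)
  then show ?thesis by (simp add: uminus_fvec_def coord_FVec)
qed

instance
  by standard (auto intro!: fvec_eqI)

end

lemma coord_sum [simp]: "coord (sum f A) a = (\<Sum>x\<in>A. coord (f x) a)"
  by (induction A rule: infinite_finite_induct) auto

instantiation fvec :: (type) real_vector
begin

definition scaleR_fvec :: "real \<Rightarrow> 'a fvec \<Rightarrow> 'a fvec"
  where "scaleR_fvec r v = csc (of_real r) v"

lemma coord_scaleR [simp]: "coord (r *\<^sub>R v) a = of_real r * coord v a"
  by (simp add: scaleR_fvec_def)

instance
  by standard (auto intro!: fvec_eqI simp: algebra_simps)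

end

text \<open>The real part of \<open>cip\<close> is a real inner product with the same norm, so
  general facts on norms become available; complex scalars act through \<open>csc\<close>.\<close>

instantiation fvec :: (type) real_inner
begin

definition inner_fvec :: "'a fvec \<Rightarrow> 'a fvec \<Rightarrow> real"
  where "inner u v = Re (cip u v)"
definition norm_fvec :: "'a fvec \<Rightarrow> real"
  where "norm v = sqrt (Re (cip v v))"
definition dist_fvec :: "'a fvec \<Rightarrow> 'a fvec \<Rightarrow> real"
  where "dist_fvec u v = norm (u - v)"
definition sgn_fvec :: "'a fvec \<Rightarrow> 'a fvec"
  where "sgn_fvec v = scaleR (inverse (norm v)) v"
definition uniformity_fvec :: "('a fvec \<times> 'a fvec) filter"
  where "uniformity_fvec = (INF e\<in>{0 <..}. principal {(x, y). dist x y < e})"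
definition open_fvec :: "'a fvec set \<Rightarrow> bool"
  where "open_fvec S = (\<forall>x\<in>S. \<forall>\<^sub>F (x', y) in uniformity. x' = x \<longrightarrow> y \<in> S)"

lemma Re_cip_self: "Re (cip v v) = (\<Sum>a\<in>csupp v. (cmod (coord v a))\<^sup>2)"
proof -
  have "Re (cnj z * z) = (cmod z)\<^sup>2" for z
    by (simp add: cmod_def power2_eq_square)
  then show ?thesis by (simp add: cip_def)
qed

instance
proof
  fix u v w :: "'a fvec" and r :: real
  show "dist u v = norm (u - v)" by (simp add: dist_fvec_def)
  show "sgn v = v /\<^sub>R norm v" by (simp add: sgn_fvec_def)
  show "(uniformity :: ('a fvec \<times> 'a fvec) filter) = (INF e\<in>{0 <..}. principal {(x, y). dist x y < e})"
    by (simp add: uniformity_fvec_def)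
  show "open S = (\<forall>x\<in>S. \<forall>\<^sub>F (x', y) in uniformity. x' = x \<longrightarrow> y \<in> S)" for S :: "'a fvec set"
    by (simp add: open_fvec_def)
  have c: "cip u v = (\<Sum>a\<in>csupp u \<union> csupp v. cnj (coord u a) * coord v a)" for u v :: "'a fvec"
    by (rule cip_superset) auto
  show "inner u v = inner v u"
    by (simp add: inner_fvec_def c[of u v] c[of v u] Un_commute mult.commute)
  have "csupp (u + v) \<subseteq> csupp u \<union> csupp v"
    by (auto simp: csupp_def)
  then show "inner (u + v) w = inner u w + inner v w"
    by (simp add: inner_fvec_def cip_superset[of "csupp u \<union> csupp v"] sum.distrib algebra_simps)
  have "csupp (r *\<^sub>R u) \<subseteq> csupp u"
    by (auto simp: csupp_def)
  then show "inner (r *\<^sub>R u) v = r * inner u v"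
    by (simp add: inner_fvec_def cip_superset[of "csupp u"] sum_distrib_left algebra_simps)
  show "0 \<le> inner v v"
    by (simp add: inner_fvec_def Re_cip_self sum_nonneg)
  show "(inner v v = 0) = (v = 0)"
  proof
    assume "inner v v = 0"
    then have "\<forall>a\<in>csupp v. (cmod (coord v a))\<^sup>2 = 0"
      unfolding inner_fvec_def Re_cip_self by (subst (asm) sum_nonneg_eq_0_iff) auto
    then show "v = 0" by (auto intro!: fvec_eqI simp: csupp_def)
  qed (simp add: inner_fvec_def cip_def)
  show "norm v = sqrt (inner v v)" by (simp add: norm_fvec_def inner_fvec_def)
qed

end

lemma cip_cnj: "cip u v = cnj (cip v u)"
proof -
  have c: "cip u v = (\<Sum>a\<in>csupp u \<union> csupp v. cnj (coord u a) * coord v a)" for u v :: "'a fvec"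
    by (rule cip_superset) auto
  show ?thesis by (simp add: c[of u v] c[of v u] Un_commute mult.commute)
qed

lemma cip_add_right [simp]: "cip u (v + w) = cip u v + cip u w"
  by (simp add: cip_def sum.distrib algebra_simps)

lemma cip_csc_right [simp]: "cip u (csc c v) = c * cip u v"
  by (simp add: cip_def sum_distrib_left algebra_simps)

lemma cip_zero_right [simp]: "cip u 0 = 0"
  by (simp add: cip_def)

lemma cip_diff_right [simp]: "cip u (v - w) = cip u v - cip u w"
  by (simp add: cip_def sum_subtractf algebra_simps)

lemma cip_add_left [simp]: "cip (v + w) u = cip v u + cip w u"
  by (subst (1 2 3) cip_cnj) simp

lemma cip_csc_left [simp]: "cip (csc c v) u = cnj c * cip v u"
  by (subst (1 2) cip_cnj) simp

lemma cip_zero_left [simp]: "cip 0 u = 0"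
  by (subst cip_cnj) simp

lemma cip_diff_left [simp]: "cip (v - w) u = cip v u - cip w u"
  by (subst (1 2 3) cip_cnj) simp

lemma cip_sum_right: "cip u (sum f A) = (\<Sum>x\<in>A. cip u (f x))"
  by (induction A rule: infinite_finite_induct) auto

lemma cip_sum_left: "cip (sum f A) u = (\<Sum>x\<in>A. cip (f x) u)"
  by (induction A rule: infinite_finite_induct) auto

lemma cip_self: "cip v v = of_real ((norm v)\<^sup>2)"
proof -
  have "Im (cip v v) = 0"
    using cip_cnj[of v v] by (simp add: complex_eq_iff)
  moreover have "Re (cip v v) = (norm v)\<^sup>2"
    by (simp add: norm_fvec_def Re_cip_self sum_nonneg)
  ultimately show ?thesis by (simp add: complex_eq_iff)
qed

lemma norm_sq_cip: "(norm v)\<^sup>2 = Re (cip v v)"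
  by (simp add: cip_self)

lemma csc_0 [simp]: "csc 0 v = 0" "csc c 0 = 0" by (auto intro: fvec_eqI)
lemma csc_1 [simp]: "csc 1 v = v" by (auto intro: fvec_eqI)
lemma csc_csc [simp]: "csc c (csc e v) = csc (c * e) v" by (rule fvec_eqI) simp
lemma csc_add_right: "csc c (u + v) = csc c u + csc c v" by (rule fvec_eqI) (simp add: algebra_simps)
lemma csc_diff_right: "csc c (u - v) = csc c u - csc c v" by (rule fvec_eqI) (simp add: algebra_simps)
lemma csc_add_left: "csc (c + e) v = csc c v + csc e v" by (rule fvec_eqI) (simp add: algebra_simps)
lemma csc_diff_left: "csc (c - e) v = csc c v - csc e v" by (rule fvec_eqI) (simp add: algebra_simps)
lemma csc_sum_right: "csc c (sum f A) = (\<Sum>x\<in>A. csc c (f x))"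
  by (rule fvec_eqI) (simp add: sum_distrib_left)
lemma csc_sum_left: "csc (sum f A) v = (\<Sum>x\<in>A. csc (f x) v)"
  by (rule fvec_eqI) (simp add: sum_distrib_right)
lemma csc_minus_1: "csc (- 1) v = - v" by (rule fvec_eqI) simp

lemma norm_csc [simp]: "norm (csc c v) = cmod c * norm v"
proof -
  have "cnj c * c = of_real ((cmod c)\<^sup>2)"
    by (simp only: complex_norm_square mult.commute)
  moreover have "cip (csc c v) (csc c v) = (cnj c * c) * cip v v" by simp
  ultimately have "cip (csc c v) (csc c v) = of_real ((cmod c)\<^sup>2) * cip v v"
    by simp
  then have "complex_of_real ((norm (csc c v))\<^sup>2) = of_real ((cmod c * norm v)\<^sup>2)"
    by (simp only: cip_self power_mult_distrib of_real_mult)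
  then have "(norm (csc c v))\<^sup>2 = (cmod c * norm v)\<^sup>2"
    by (simp only: of_real_eq_iff)
  then show ?thesis by (rule power2_eq_imp_eq) auto
qed

text \<open>The real inner product only controls the real part of \<open>cip u v\<close>;
  multiplying \<open>u\<close> by the phase of \<open>cip u v\<close> makes that value real and
  nonnegative.\<close>

lemma cmod_cip_le: "cmod (cip u v) \<le> norm u * norm v"
proof (cases "cip u v = 0")
  case False
  let ?z = "cip u v"
  have "cnj (sgn ?z) * ?z = of_real (cmod ?z)"
    using False by (simp add: sgn_eq complex_norm_square[symmetric] mult.commute[of "cnj _"]
      power2_eq_square)
  then have "Re (cip (csc (sgn ?z) u) v) = cmod ?z" by simp
  moreover have "Re (cip (csc (sgn ?z) u) v) \<le> norm (csc (sgn ?z) u) * norm v"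
    using norm_cauchy_schwarz[of "csc (sgn ?z) u" v] by (simp add: inner_fvec_def)
  moreover have "cmod (sgn ?z) = 1" using False by (simp add: norm_sgn)
  ultimately show ?thesis by simp
qed simp

lemma norm_add_sq: "(norm (u + v))\<^sup>2 = (norm u)\<^sup>2 + (norm v)\<^sup>2 + 2 * Re (cip u v)"
  using cip_cnj[of v u] by (simp add: norm_sq_cip)

lemma norm_add_orth: "cip u v = 0 \<Longrightarrow> (norm (u + v))\<^sup>2 = (norm u)\<^sup>2 + (norm v)\<^sup>2"
  by (simp add: norm_add_sq)

lemma norm_sum_orth:
  assumes "finite A" "\<And>x y. x \<in> A \<Longrightarrow> y \<in> A \<Longrightarrow> x \<noteq> y \<Longrightarrow> cip (f x) (f y) = 0"
  shows "(norm (sum f A))\<^sup>2 = (\<Sum>x\<in>A. (norm (f x))\<^sup>2)"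
  using assms
proof (induction A)
  case (insert x A)
  have "cip (f x) (sum f A) = 0"
    unfolding cip_sum_right using insert by (intro sum.neutral) auto
  then show ?case using insert by (simp add: norm_add_orth)
qed simp

definition clin :: "('a fvec \<Rightarrow> 'b fvec) \<Rightarrow> bool" where
  "clin T \<longleftrightarrow> (\<forall>u v. T (u + v) = T u + T v) \<and> (\<forall>c v. T (csc c v) = csc c (T v))"

lemma clinI: "(\<And>u v. T (u + v) = T u + T v) \<Longrightarrow> (\<And>c v. T (csc c v) = csc c (T v)) \<Longrightarrow> clin T"
  by (simp add: clin_def)

lemma clin_add: "clin T \<Longrightarrow> T (u + v) = T u + T v" by (simp add: clin_def)
lemma clin_csc: "clin T \<Longrightarrow> T (csc c v) = csc c (T v)" by (simp add: clin_def)
lemma clin_0: "clin T \<Longrightarrow> T 0 = 0" using clin_csc[of T 0 0] by simp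
lemma clin_diff: "clin T \<Longrightarrow> T (u - v) = T u - T v"
  using clin_add[of T u "csc (-1) v"] clin_csc[of T "-1" v] by (simp add: csc_minus_1)
lemma clin_sum: "clin T \<Longrightarrow> T (sum f A) = (\<Sum>x\<in>A. T (f x))"
  by (induction A rule: infinite_finite_induct) (auto simp: clin_0 clin_add)

section \<open>Orthonormal sets and projections\<close>

definition ons :: "'a fvec set \<Rightarrow> bool" where
  "ons B \<longleftrightarrow> finite B \<and> (\<forall>b\<in>B. \<forall>c\<in>B. cip b c = (if b = c then 1 else 0))"

definition proj :: "'a fvec set \<Rightarrow> 'a fvec \<Rightarrow> 'a fvec" where
  "proj B v = (\<Sum>b\<in>B. csc (cip b v) b)"

text \<open>For orthonormal \<open>B\<close> this is the linear span. For an arbitrary finite set it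
  is only contained in the span, which is all that the dimension bounds such as
  \<open>ons_card_le\<close> require.\<close>

definition spn :: "'a fvec set \<Rightarrow> 'a fvec set" where
  "spn B = {v. proj B v = v}"

definition csub :: "'a fvec set \<Rightarrow> bool" where
  "csub W \<longleftrightarrow> 0 \<in> W \<and> (\<forall>u\<in>W. \<forall>v\<in>W. u + v \<in> W) \<and> (\<forall>c. \<forall>v\<in>W. csc c v \<in> W)"

lemma onsD: "ons B \<Longrightarrow> b \<in> B \<Longrightarrow> c \<in> B \<Longrightarrow> cip b c = (if b = c then 1 else 0)"
  by (simp add: ons_def)
lemma ons_finite: "ons B \<Longrightarrow> finite B" by (simp add: ons_def)
lemma ons_empty [simp]: "ons {}" by (simp add: ons_def)
lemma ons_subset: "ons B \<Longrightarrow> C \<subseteq> B \<Longrightarrow> ons C"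
  by (metis (no_types, lifting) finite_subset ons_def subsetD)
lemma ons_norm:
  assumes "ons B" "b \<in> B" shows "norm b = 1"
proof -
  have "complex_of_real ((norm b)\<^sup>2) = 1"
    using cip_self[of b] onsD[OF assms assms(2)] by simp
  then have "(norm b)\<^sup>2 = 1" by (simp only: of_real_eq_1_iff)
  then show ?thesis using real_sqrt_unique[of "norm b" 1] by simp
qed

lemma ons_insert:
  assumes "ons B" "norm u = 1" "\<And>b. b \<in> B \<Longrightarrow> cip b u = 0"
  shows "ons (insert u B)" "u \<notin> B"
proof -
  show "u \<notin> B" using assms(2) assms(3)[of u] cip_self[of u] by auto
  have "cip u b = 0" if "b \<in> B" for b using assms(3)[OF that] cip_cnj[of u b] by simp
  then show "ons (insert u B)"
    using assms cip_self[of u] by (auto simp: ons_def)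
qed

lemma ons_Un:
  assumes "ons B" "ons C" "\<And>b c. b \<in> B \<Longrightarrow> c \<in> C \<Longrightarrow> cip b c = 0"
  shows "ons (B \<union> C)" "B \<inter> C = {}"
proof -
  show *: "B \<inter> C = {}" using assms onsD by fastforce
  have "cip c b = 0" if "b \<in> B" "c \<in> C" for b c using assms(3)[OF that] cip_cnj[of c b] by simp
  then show "ons (B \<union> C)" using assms * by (auto simp: ons_def)
qed

lemma clin_proj: "clin (proj B)"
  by (rule clinI)
    (simp_all add: proj_def csc_add_left sum.distrib csc_sum_right)

lemmas proj_lin = clin_add[OF clin_proj] clin_diff[OF clin_proj] clin_csc[OF clin_proj]
  clin_0[OF clin_proj] clin_sum[OF clin_proj]

lemma cip_proj: "cip (proj B u) v = cip u (proj B v)"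
proof -
  have "cip (proj B u) v = (\<Sum>b\<in>B. cip u b * cip b v)"
    by (simp add: proj_def cip_sum_left) (metis cip_cnj)
  then show ?thesis by (simp add: proj_def cip_sum_right mult.commute)
qed

lemma proj_in: "ons B \<Longrightarrow> b \<in> B \<Longrightarrow> proj B b = b"
proof -
  assume "ons B" "b \<in> B"
  then have "proj B b = (\<Sum>c\<in>B. if c = b then b else 0)"
    unfolding proj_def by (intro sum.cong) (auto simp: onsD)
  then show ?thesis using \<open>b \<in> B\<close> ons_finite[OF \<open>ons B\<close>] by simp
qed

lemma cip_proj_in: "ons B \<Longrightarrow> b \<in> B \<Longrightarrow> cip b (proj B v) = cip b v"
  by (metis cip_proj proj_in)

lemma proj_proj: "ons B \<Longrightarrow> proj B (proj B v) = proj B v"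
  by (subst (1 3) proj_def) (simp add: cip_proj_in)

lemma proj_spn: "ons B \<Longrightarrow> proj B v \<in> spn B" by (simp add: spn_def proj_proj)
lemma spnD: "v \<in> spn B \<Longrightarrow> proj B v = v" by (simp add: spn_def)
lemma in_spn: "ons B \<Longrightarrow> b \<in> B \<Longrightarrow> b \<in> spn B" by (simp add: spn_def proj_in)

lemma csub_spn [simp]: "csub (spn B)"
  by (auto simp: csub_def spn_def proj_lin)

lemma csub_0: "csub W \<Longrightarrow> 0 \<in> W" by (simp add: csub_def)
lemma csub_add: "csub W \<Longrightarrow> u \<in> W \<Longrightarrow> v \<in> W \<Longrightarrow> u + v \<in> W" by (simp add: csub_def)
lemma csub_csc: "csub W \<Longrightarrow> v \<in> W \<Longrightarrow> csc c v \<in> W" by (simp add: csub_def)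
lemma csub_diff: "csub W \<Longrightarrow> u \<in> W \<Longrightarrow> v \<in> W \<Longrightarrow> u - v \<in> W"
  using csub_add[of W u "csc (-1) v"] csub_csc[of W v "-1"] by (simp add: csc_minus_1)
lemma csub_sum: "csub W \<Longrightarrow> (\<And>x. x \<in> A \<Longrightarrow> f x \<in> W) \<Longrightarrow> sum f A \<in> W"
  by (induction A rule: infinite_finite_induct) (auto simp: csub_0 csub_add)
lemma csub_proj: "csub W \<Longrightarrow> B \<subseteq> W \<Longrightarrow> proj B v \<in> W"
  unfolding proj_def by (intro csub_sum csub_csc) auto
lemma spn_subset: "csub W \<Longrightarrow> B \<subseteq> W \<Longrightarrow> spn B \<subseteq> W"
  by (metis csub_proj spnD subsetI)
lemma csub_Int: "csub V \<Longrightarrow> csub W \<Longrightarrow> csub (V \<inter> W)" by (auto simp: csub_def)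
lemma csub_perp: "csub {w. \<forall>q\<in>Q. cip q w = 0}" by (auto simp: csub_def)

lemma norm_comb:
  assumes "ons B" shows "(norm (\<Sum>b\<in>B. csc (c b) b))\<^sup>2 = (\<Sum>b\<in>B. (cmod (c b))\<^sup>2)"
proof -
  have "(norm (\<Sum>b\<in>B. csc (c b) b))\<^sup>2 = (\<Sum>b\<in>B. (norm (csc (c b) b))\<^sup>2)"
    using assms by (intro norm_sum_orth) (auto simp: onsD ons_finite)
  then show ?thesis using assms by (simp add: ons_norm)
qed

lemma norm_proj_sq: "ons B \<Longrightarrow> (norm (proj B v))\<^sup>2 = (\<Sum>b\<in>B. (cmod (cip b v))\<^sup>2)"
  by (simp add: proj_def norm_comb)

lemma perp_proj: "ons B \<Longrightarrow> u \<in> spn B \<Longrightarrow> cip u (v - proj B v) = 0"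
  by (metis cip_diff_right cip_proj eq_iff_diff_eq_0 spnD)

lemma norm_split:
  assumes "ons B" shows "(norm v)\<^sup>2 = (norm (proj B v))\<^sup>2 + (norm (v - proj B v))\<^sup>2"
  using norm_add_orth[OF perp_proj[OF assms proj_spn[OF assms]], of v v] by simp

lemma norm_proj_le: "ons B \<Longrightarrow> norm (proj B v) \<le> norm v"
  by (rule power2_le_imp_le[OF _ norm_ge_zero]) (metis norm_split le_add_same_cancel1 zero_le_power2)

lemma proj_perp0: "(\<And>b. b \<in> B \<Longrightarrow> cip b v = 0) \<Longrightarrow> proj B v = 0"
  by (simp add: proj_def)

lemma spn_perp: "v \<in> spn B \<Longrightarrow> (\<And>b. b \<in> B \<Longrightarrow> cip b w = 0) \<Longrightarrow> cip v w = 0"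
  by (metis cip_proj cip_zero_right proj_perp0 spnD)

text \<open>Gaussian elimination. If some vector \<open>v l\<close> violates the equation of
  \<open>i\<close>, it serves as pivot: subtracting multiples of it makes all other vectors satisfy
  that equation, and the remaining equations are solved without \<open>l\<close>.\<close>

lemma homogeneous_system:
  fixes q :: "'q \<Rightarrow> 'a fvec" and v :: "'k \<Rightarrow> 'a fvec"
  assumes "finite Q" "finite K" "card Q < card K"
  shows "\<exists>c. (\<exists>k\<in>K. c k \<noteq> 0) \<and> (\<forall>i\<in>Q. cip (q i) (\<Sum>k\<in>K. csc (c k) (v k)) = 0)"
  using assms
proof (induction Q arbitrary: K v rule: finite_induct)
  case empty
  then obtain k where "k \<in> K" by fastforce
  then show ?case by (intro exI[of _ "\<lambda>_. 1"]) auto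
next
  case (insert i Q)
  show ?case
  proof (cases "\<forall>k\<in>K. cip (q i) (v k) = 0")
    case True
    obtain c where c: "\<exists>k\<in>K. c k \<noteq> 0" "\<forall>i\<in>Q. cip (q i) (\<Sum>k\<in>K. csc (c k) (v k)) = 0"
      using insert.IH[of K v] insert.prems insert.hyps by auto
    moreover have "cip (q i) (\<Sum>k\<in>K. csc (c k) (v k)) = 0"
      using True by (simp add: cip_sum_right)
    ultimately show ?thesis by auto
  next
    case False
    then obtain l where l: "l \<in> K" "cip (q i) (v l) \<noteq> 0" by auto
    define r where "r k = cip (q i) (v k) / cip (q i) (v l)" for k
    define v' where "v' k = v k - csc (r k) (v l)" for k
    have "card Q < card (K - {l})" using insert.prems insert.hyps l(1) by simp
    then obtain c where c: "\<exists>k\<in>K - {l}. c k \<noteq> 0"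
        "\<forall>i\<in>Q. cip (q i) (\<Sum>k\<in>K - {l}. csc (c k) (v' k)) = 0"
      using insert.IH[of "K - {l}" v'] insert.prems by blast
    define c' where "c' k = (if k = l then - (\<Sum>k\<in>K - {l}. c k * r k) else c k)" for k
    have "(\<Sum>k\<in>K. csc (c' k) (v k)) = csc (c' l) (v l) + (\<Sum>k\<in>K - {l}. csc (c' k) (v k))"
      using l insert.prems by (intro sum.remove) auto
    also have "(\<Sum>k\<in>K - {l}. csc (c' k) (v k)) = (\<Sum>k\<in>K - {l}. csc (c k) (v k))"
      by (intro sum.cong) (auto simp: c'_def)
    also have "csc (c' l) (v l) = csc (-1) (csc (\<Sum>k\<in>K - {l}. c k * r k) (v l))"
      by (simp add: c'_def)
    also have "\<dots> = - (\<Sum>k\<in>K - {l}. csc (c k * r k) (v l))"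
      by (simp only: csc_minus_1 csc_sum_left)
    finally have eq: "(\<Sum>k\<in>K. csc (c' k) (v k)) = (\<Sum>k\<in>K - {l}. csc (c k) (v' k))"
      by (simp add: v'_def csc_diff_right sum_subtractf)
    have "cip (q i) (v' k) = 0" for k using l by (simp add: v'_def r_def)
    then have "cip (q i) (\<Sum>k\<in>K. csc (c' k) (v k)) = 0"
      unfolding eq by (simp add: cip_sum_right)
    moreover have "\<exists>k\<in>K. c' k \<noteq> 0" using c(1) by (auto simp: c'_def)
    ultimately show ?thesis using c(2) eq by (intro exI[of _ c']) auto
  qed
qed

lemma ons_comb_eq_0:
  assumes "ons B" "(\<Sum>b\<in>B. csc (c b) b) = 0" "b \<in> B"
  shows "c b = 0"
proof -
  have "(\<Sum>b\<in>B. (cmod (c b))\<^sup>2) = 0" using norm_comb[OF assms(1), of c] assms(2) by simp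
  then show ?thesis using assms by (subst (asm) sum_nonneg_eq_0_iff) (auto simp: ons_finite)
qed

lemma comb_in_spn: "ons B \<Longrightarrow> (\<Sum>b\<in>B. csc (c b) b) \<in> spn B"
  by (intro csub_sum csub_csc in_spn) auto

text \<open>This replaces a dimension function: later comparisons of dimensions are contradictions
  with a vector obtained here.\<close>

lemma ons_exists_perp:
  assumes "ons B" "finite Q" "card Q < card B"
  shows "\<exists>w\<in>spn B. w \<noteq> 0 \<and> (\<forall>q\<in>Q. cip q w = 0)"
proof -
  obtain c where c: "\<exists>k\<in>B. c k \<noteq> 0" "\<forall>i\<in>Q. cip i (\<Sum>k\<in>B. csc (c k) k) = 0"
    using homogeneous_system[of Q B "\<lambda>x. x" "\<lambda>x. x"] assms ons_finite by auto
  then show ?thesis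
    using comb_in_spn[OF assms(1), of c] ons_comb_eq_0[OF assms(1), of c] by blast
qed

lemma ons_card_le:
  assumes "ons B" "finite E" "B \<subseteq> spn E"
  shows "card B \<le> card E"
proof (rule ccontr)
  assume "\<not> card B \<le> card E"
  then obtain w where w: "w \<in> spn B" "w \<noteq> 0" "\<forall>q\<in>E. cip q w = 0"
    using ons_exists_perp[OF assms(1,2)] by auto
  have "w \<in> spn E" using spn_subset[OF csub_spn assms(3)] w(1) by auto
  then have "w = 0" using w(3) proj_perp0[of E w] spnD by metis
  then show False using w(2) by simp
qed

text \<open>An orthonormal set of largest size exists because sizes are bounded by
  \<open>card E\<close>. A vector \<open>w\<close> of \<open>W\<close> outside its span would allow
  the normalised \<open>w - proj B w\<close> to be added.\<close>

lemma onb_extend: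
  assumes "csub W" "finite E" "W \<subseteq> spn E" "ons B0" "B0 \<subseteq> W"
  shows "\<exists>B. ons B \<and> B0 \<subseteq> B \<and> spn B = W"
proof -
  let ?P = "\<lambda>B. ons B \<and> B0 \<subseteq> B \<and> B \<subseteq> W"
  have "card C < Suc (card E)" if "?P C" for C
    using ons_card_le[of C E] assms that by (auto simp: less_Suc_eq_le)
  then obtain B where B: "?P B" and max: "\<And>C. ?P C \<Longrightarrow> card C \<le> card B"
    using ex_has_greatest_nat[of ?P B0 card "Suc (card E)"] assms by blast
  have "w \<in> spn B" if "w \<in> W" for w
  proof (rule ccontr)
    assume "w \<notin> spn B"
    define u where "u = w - proj B w"
    have u: "u \<noteq> 0" "u \<in> W" using \<open>w \<notin> spn B\<close> that csub_proj[OF assms(1)] B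
      by (auto simp: u_def spn_def intro: csub_diff[OF assms(1)])
    let ?e = "csc (of_real (1 / norm u)) u"
    have e: "norm ?e = 1" using u by (simp add: norm_divide)
    have e2: "cip b ?e = 0" if "b \<in> B" for b
      using that B by (simp add: u_def cip_proj_in)
    have "ons B" using B by blast
    note ins = ons_insert[OF this e e2]
    have "?P (insert ?e B)" using ins(1) B csub_csc[OF assms(1) u(2)] by blast
    then have "card (insert ?e B) \<le> card B" by (rule max)
    then show False using ins(2) ons_finite[OF \<open>ons B\<close>] by simp
  qed
  moreover have "spn B \<subseteq> W" using B spn_subset assms(1) by auto
  ultimately show ?thesis using B by blast
qed

lemma onb_exists:
  assumes "csub W" "finite E" "W \<subseteq> spn E"
  shows "\<exists>B. ons B \<and> spn B = W"
  using onb_extend[OF assms ons_empty] by auto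

section \<open>The spectral theorem\<close>

definition csym :: "('a fvec \<Rightarrow> 'a fvec) \<Rightarrow> bool" where
  "csym T \<longleftrightarrow> (\<forall>u v. cip (T u) v = cip u (T v))"

lemma csymD: "csym T \<Longrightarrow> cip (T u) v = cip u (T v)"
  by (simp add: csym_def)

text \<open>Split off a root, \<open>p = (x - z) q\<close>. Either \<open>q(T) v\<close> is nonzero
  and an eigenvector for \<open>z\<close>, or \<open>q\<close> annihilates \<open>v\<close> with a
  smaller degree bound.\<close>

lemma eigenvector_if_annihilated:
  fixes T :: "'a fvec \<Rightarrow> 'a fvec"
  assumes T: "clin T" and W: "csub W" "\<And>v. v \<in> W \<Longrightarrow> T v \<in> W" and v: "v \<in> W" "v \<noteq> 0"
  shows "p \<noteq> 0 \<Longrightarrow> degree p \<le> n \<Longrightarrow> (\<Sum>i\<le>n. csc (coeff p i) ((T ^^ i) v)) = 0 \<Longrightarrow>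
    \<exists>z w. w \<in> W \<and> w \<noteq> 0 \<and> T w = csc z w"
proof (induction n arbitrary: p)
  case 0
  then obtain c where "p = [:c:]" using degree_eq_zeroE by auto
  then have "c \<noteq> 0" "csc c v = 0" using 0 by auto
  then have "cmod c * norm v = 0" by (metis norm_csc norm_zero)
  then show ?case using \<open>c \<noteq> 0\<close> v by simp
next
  case (Suc n)
  have iter: "(T ^^ i) v \<in> W" for i by (induction i) (auto simp: v W)
  show ?case
  proof (cases "degree p = 0")
    case True
    then have "(\<Sum>i\<le>n. csc (coeff p i) ((T ^^ i) v)) = 0"
      using Suc.prems by (simp add: coeff_eq_0)
    then show ?thesis using Suc.IH[of p] Suc.prems True by auto
  next
    case False
    then have "\<not> constant (poly p)" by (simp add: constant_degree)
    then obtain z where "poly p z = 0" using fundamental_theorem_of_algebra by blast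
    then obtain q where q: "p = [:- z, 1:] * q" by (auto simp: poly_eq_0_iff_dvd dvd_def)
    then have q0: "q \<noteq> 0" using Suc.prems by auto
    have dq: "degree q \<le> n" using Suc.prems q q0 degree_mult_eq[of "[:- z, 1:]" q] by simp
    define w where "w = (\<Sum>i\<le>n. csc (coeff q i) ((T ^^ i) v))"
    have cp: "coeff p i = coeff (pCons 0 q) i - z * coeff q i" for i
      unfolding q by simp
    have "(\<Sum>i\<le>Suc n. csc (coeff (pCons 0 q) i) ((T ^^ i) v)) = T w"
      unfolding w_def sum.atMost_Suc_shift
      by (simp add: clin_sum[OF T] clin_csc[OF T])
    moreover have "(\<Sum>i\<le>Suc n. csc (coeff q i) ((T ^^ i) v)) = w"
      using dq by (simp add: w_def coeff_eq_0)
    then have "(\<Sum>i\<le>Suc n. csc (z * coeff q i) ((T ^^ i) v)) = csc z w"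
      by (simp only: csc_sum_right[symmetric] csc_csc[symmetric])
    ultimately have "T w - csc z w = (\<Sum>i\<le>Suc n. csc (coeff p i) ((T ^^ i) v))"
      unfolding cp csc_diff_left sum_subtractf by simp
    then have Tw: "T w = csc z w" using Suc.prems by simp
    have "w \<in> W" unfolding w_def using W(1) iter by (intro csub_sum csub_csc)
    show ?thesis
    proof (cases "w = 0")
      case True
      then show ?thesis using Suc.IH[OF q0 dq] by (simp only: w_def)
    qed (use Tw \<open>w \<in> W\<close> in blast)
  qed
qed

text \<open>The \<open>card E + 1\<close> vectors \<open>v\<close>, \<open>T v\<close>,
  \<open>T (T v)\<close>, ... satisfy a linear relation in a space of dimension at most
  \<open>card E\<close>; its coefficients form an annihilating polynomial.\<close>

lemma eigenvector_exists:
  fixes T :: "'a fvec \<Rightarrow> 'a fvec"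
  assumes T: "clin T" and W: "csub W" "\<And>v. v \<in> W \<Longrightarrow> T v \<in> W" and v: "v \<in> W" "v \<noteq> 0"
    and E: "finite E" "W \<subseteq> spn E"
  shows "\<exists>z w. w \<in> W \<and> w \<noteq> 0 \<and> T w = csc z w"
proof -
  have iter: "(T ^^ i) v \<in> W" for i by (induction i) (auto simp: v W)
  obtain c where c: "\<exists>k\<in>{..card E}. c k \<noteq> 0"
    "\<forall>q\<in>E. cip q (\<Sum>k\<in>{..card E}. csc (c k) ((T ^^ k) v)) = 0"
    using homogeneous_system[of E "{..card E}" "\<lambda>x. x" "\<lambda>k. (T ^^ k) v"] E by auto
  let ?u = "\<Sum>k\<le>card E. csc (c k) ((T ^^ k) v)"
  have "?u \<in> W" using W(1) iter by (intro csub_sum csub_csc)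
  then have "?u \<in> spn E" using E by blast
  moreover have "proj E ?u = 0" using c(2) by (intro proj_perp0) blast
  ultimately have "?u = 0" by (simp add: spn_def)
  define p where "p = (\<Sum>k\<le>card E. monom (c k) k)"
  have cp: "coeff p i = (if i \<le> card E then c i else 0)" for i
    by (simp add: p_def coeff_sum)
  have "degree p \<le> card E" by (rule degree_le) (simp add: cp)
  moreover obtain k where "k \<le> card E" "c k \<noteq> 0" using c(1) by auto
  then have "coeff p k \<noteq> 0" by (simp add: cp)
  then have "p \<noteq> 0" by auto
  moreover have "(\<Sum>i\<le>card E. csc (coeff p i) ((T ^^ i) v)) = 0"
    using \<open>?u = 0\<close> by (simp add: cp)
  ultimately show ?thesis using eigenvector_if_annihilated[OF T W v] by blast
qed

text \<open>Take a largest orthonormal set of eigenvectors with real eigenvalues. By symmetry its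
  complement in \<open>W\<close> is invariant, so a nonzero complement would contain a further
  eigenvector.\<close>

lemma spectral_theorem:
  fixes T :: "'a fvec \<Rightarrow> 'a fvec"
  assumes T: "clin T" "csym T" and W: "csub W" "\<And>v. v \<in> W \<Longrightarrow> T v \<in> W"
    and E: "finite E" "W \<subseteq> spn E"
  shows "\<exists>B ev. ons B \<and> spn B = W \<and> (\<forall>b\<in>B. T b = csc (complex_of_real (ev b)) b)"
proof -
  let ?P = "\<lambda>B. ons B \<and> B \<subseteq> W \<and> (\<forall>b\<in>B. \<exists>r::real. T b = csc (of_real r) b)"
  have "card C < Suc (card E)" if "?P C" for C
    using ons_card_le[of C E] E that by (auto simp: less_Suc_eq_le)
  then obtain B where B: "?P B" and max: "\<And>C. ?P C \<Longrightarrow> card C \<le> card B"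
    using ex_has_greatest_nat[of ?P "{}" card "Suc (card E)"] by auto
  have oB: "ons B" using B by blast
  have "w \<in> spn B" if "w \<in> W" for w
  proof (rule ccontr)
    assume "w \<notin> spn B"
    define W' where "W' = W \<inter> {w. \<forall>b\<in>B. cip b w = 0}"
    have W': "csub W'" unfolding W'_def using W(1) csub_perp by (rule csub_Int)
    have "T u \<in> W'" if "u \<in> W'" for u
    proof -
      have "cip b (T u) = 0" if "b \<in> B" for b
        using that B \<open>u \<in> W'\<close> csymD[OF T(2), of b u] by (force simp: W'_def)
      then show ?thesis using W(2) that by (auto simp: W'_def)
    qed
    moreover have "w - proj B w \<in> W'"
      using \<open>w \<in> W\<close> B csub_diff[OF W(1)] csub_proj[OF W(1)] by (auto simp: W'_def cip_proj_in)
    moreover have "w - proj B w \<noteq> 0" using \<open>w \<notin> spn B\<close> by (auto simp: spn_def)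
    moreover have "W' \<subseteq> spn E" using E by (auto simp: W'_def)
    ultimately obtain z u where u: "u \<in> W'" "u \<noteq> 0" "T u = csc z u"
      using eigenvector_exists[OF T(1) W' _ _ _ E(1)] by blast
    have "cip u u \<noteq> 0" using u by (simp add: cip_self)
    then have "cnj z = z" using csymD[OF T(2), of u u] u by simp
    then have z: "z = of_real (Re z)" by (simp add: complex_eq_iff)
    let ?e = "csc (of_real (1 / norm u)) u"
    have e: "norm ?e = 1" using u by (simp add: norm_divide)
    have e2: "cip b ?e = 0" if "b \<in> B" for b using that u by (simp add: W'_def)
    note ins = ons_insert[OF oB e e2]
    have "T ?e = csc (of_real (Re z)) ?e"
      using u z by (simp add: clin_csc[OF T(1)] mult.commute)
    moreover have "?e \<in> W" using csub_csc[OF W(1)] u by (simp add: W'_def)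
    ultimately have "?P (insert ?e B)" using ins(1) B by blast
    then have "card (insert ?e B) \<le> card B" by (rule max)
    then show False using ins(2) ons_finite[OF oB] by simp
  qed
  then have "spn B = W" using spn_subset[OF W(1)] B by blast
  moreover obtain ev where "\<forall>b\<in>B. T b = csc (complex_of_real (ev b)) b"
    using B by metis
  ultimately show ?thesis using oB by blast
qed

lemma proj_expand: "spn B = W \<Longrightarrow> w \<in> W \<Longrightarrow> (\<Sum>b\<in>B. csc (cip b w) b) = w"
  using spnD[of w B] by (simp add: proj_def)

lemma cip_spn_expand: "ons B \<Longrightarrow> w \<in> spn B \<Longrightarrow> cip v w = (\<Sum>b\<in>B. cnj (cip b v) * cip b w)"
  by (subst spnD[of w B, symmetric]) (simp_all add: proj_def cip_sum_right mult.commute,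
      metis cip_cnj)

text \<open>Splitting off the joint approximate eigenspace of a tuple at a point, as a spectral
  subspace of the sum of the squared deviations.\<close>

definition dev :: "('a fvec \<Rightarrow> 'a fvec) \<Rightarrow> real \<Rightarrow> 'a fvec \<Rightarrow> 'a fvec" where
  "dev X x v = X v - csc (of_real x) v"

lemma clin_dev: "clin X \<Longrightarrow> clin (dev X x)"
  by (rule clinI) (simp_all add: dev_def clin_add clin_csc csc_add_right csc_diff_right mult.commute)

lemma csym_dev: "csym X \<Longrightarrow> csym (dev X x)"
  by (simp add: csym_def dev_def)

lemma spectral_subspace:
  fixes X :: "nat \<Rightarrow> 'a fvec \<Rightarrow> 'a fvec" and x :: "nat \<Rightarrow> real"
  assumes X: "\<And>i. i < m \<Longrightarrow> clin (X i)" "\<And>i. i < m \<Longrightarrow> csym (X i)"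
    and E: "ons E" "\<And>i v. i < m \<Longrightarrow> v \<in> spn E \<Longrightarrow> X i v \<in> spn E"
    and r: "0 \<le> r"
  shows "\<exists>R. ons R \<and> R \<subseteq> spn E \<and>
    (\<forall>v\<in>spn R. (\<Sum>i<m. (norm (dev (X i) (x i) v))\<^sup>2) \<le> r\<^sup>2 * (norm v)\<^sup>2) \<and>
    (\<forall>w\<in>spn E. r\<^sup>2 * (norm (w - proj R w))\<^sup>2 \<le> (\<Sum>i<m. (norm (dev (X i) (x i) w))\<^sup>2))"
proof -
  define D where "D v = (\<Sum>i<m. dev (X i) (x i) (dev (X i) (x i) v))" for v
  have lin: "clin (dev (X i) (x i))" if "i < m" for i using X that by (simp add: clin_dev)
  have sym: "csym (dev (X i) (x i))" if "i < m" for i using X that by (simp add: csym_dev)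
  have cipD: "cip u (D v) = (\<Sum>i<m. cip (dev (X i) (x i) u) (dev (X i) (x i) v))" for u v
    using csymD[OF sym] by (simp add: D_def cip_sum_right)
  have devE: "dev (X i) (x i) v \<in> spn E" if "v \<in> spn E" "i < m" for i v
    unfolding dev_def using that E by (intro csub_diff csub_csc) auto
  have Dlin: "clin D"
    by (rule clinI) (simp_all add: D_def clin_add[OF lin] clin_csc[OF lin] sum.distrib csc_sum_right)
  have "csym D"
  proof -
    have "cip (D u) v = cip u (D v)" for u v
    proof -
      have "cip (D u) v = cnj (cip v (D u))" by (rule cip_cnj)
      also have "\<dots> = (\<Sum>i<m. cip (dev (X i) (x i) u) (dev (X i) (x i) v))"
        unfolding cipD cnj_sum by (intro sum.cong refl cip_cnj[symmetric])
      finally show ?thesis by (simp add: cipD)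
    qed
    then show ?thesis by (simp add: csym_def)
  qed
  moreover have "D v \<in> spn E" if "v \<in> spn E" for v
    unfolding D_def using that devE by (intro csub_sum) auto
  ultimately obtain B ev where B: "ons B" "spn B = spn E"
      "\<And>b. b \<in> B \<Longrightarrow> D b = csc (complex_of_real (ev b)) b"
    using spectral_theorem[OF Dlin _ csub_spn _ ons_finite[OF E(1)], of E] by blast
  have normD: "(\<Sum>i<m. (norm (dev (X i) (x i) v))\<^sup>2) = (\<Sum>b\<in>B. ev b * (cmod (cip b v))\<^sup>2)"
    if "v \<in> spn E" for v
  proof -
    have "D v = (\<Sum>b\<in>B. csc (cip b v) (D b))"
      using clin_sum[OF Dlin, of "\<lambda>b. csc (cip b v) b" B] proj_expand[OF B(2) that]
      by (simp add: clin_csc[OF Dlin])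
    then have "cip v (D v) = (\<Sum>b\<in>B. cip b v * of_real (ev b) * cip v b)"
      using B(3) by (simp add: cip_sum_right)
    also have "\<dots> = (\<Sum>b\<in>B. of_real (ev b * (cmod (cip b v))\<^sup>2))"
    proof (rule sum.cong[OF refl])
      fix b
      have "cip b v * cip v b = of_real ((cmod (cip b v))\<^sup>2)"
        by (subst cip_cnj[of v b]) (simp only: complex_norm_square)
      then show "cip b v * of_real (ev b) * cip v b = of_real (ev b * (cmod (cip b v))\<^sup>2)"
        by (metis (no_types, lifting) mult.assoc mult.left_commute of_real_mult)
    qed
    finally have "Re (cip v (D v)) = (\<Sum>b\<in>B. ev b * (cmod (cip b v))\<^sup>2)"
      by (simp flip: of_real_sum)
    moreover have "Re (cip v (D v)) = (\<Sum>i<m. (norm (dev (X i) (x i) v))\<^sup>2)"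
      by (simp add: cipD norm_sq_cip)
    ultimately show ?thesis by simp
  qed
  have ev0: "0 \<le> ev b" if "b \<in> B" for b
  proof -
    have "b \<in> spn E" using that B in_spn by blast
    then have "(\<Sum>i<m. (norm (dev (X i) (x i) b))\<^sup>2) = (\<Sum>c\<in>B. if c = b then ev b else 0)"
      unfolding normD[OF \<open>b \<in> spn E\<close>] using that onsD[OF B(1)] by (intro sum.cong) auto
    then have "(\<Sum>i<m. (norm (dev (X i) (x i) b))\<^sup>2) = ev b"
      using that ons_finite[OF B(1)] by simp
    moreover have "0 \<le> (\<Sum>i<m. (norm (dev (X i) (x i) b))\<^sup>2)" by (rule sum_nonneg) simp
    ultimately show ?thesis by simp
  qed
  \<comment> \<open>Below the threshold the quadratic form of \<open>D\<close> is at most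
    \<open>r\<^sup>2\<close>; above it the form exceeds \<open>r\<^sup>2\<close>, so the second
    bound is a Chebyshev inequality.\<close>
  define R where "R = {b\<in>B. ev b \<le> r\<^sup>2}"
  have RB: "R \<subseteq> B" by (auto simp: R_def)
  have fB: "finite B" using B(1) by (rule ons_finite)
  have oR: "ons R" using ons_subset[OF B(1) RB] .
  have RE: "R \<subseteq> spn E" using RB B in_spn by blast
  have "(\<Sum>i<m. (norm (dev (X i) (x i) v))\<^sup>2) \<le> r\<^sup>2 * (norm v)\<^sup>2" if v: "v \<in> spn R" for v
  proof -
    have vE: "v \<in> spn E" using v spn_subset[OF csub_spn RE] by auto
    have zero: "cip b v = 0" if "b \<in> B - R" for b
      using cip_spn_expand[OF oR v, of b] that RB onsD[OF B(1)] by (auto simp: cip_cnj[of _ b] intro!: sum.neutral)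
    have "(\<Sum>b\<in>B. ev b * (cmod (cip b v))\<^sup>2) = (\<Sum>b\<in>R. ev b * (cmod (cip b v))\<^sup>2)"
      using zero RB fB by (intro sum.mono_neutral_right) auto
    also have "\<dots> \<le> (\<Sum>b\<in>R. r\<^sup>2 * (cmod (cip b v))\<^sup>2)"
      by (intro sum_mono mult_right_mono) (auto simp: R_def)
    also have "\<dots> = r\<^sup>2 * (norm v)\<^sup>2"
      using norm_proj_sq[OF oR, of v] spnD[OF v] by (simp add: sum_distrib_left)
    finally show ?thesis using normD[OF vE] by simp
  qed
  moreover have "r\<^sup>2 * (norm (w - proj R w))\<^sup>2 \<le> (\<Sum>i<m. (norm (dev (X i) (x i) w))\<^sup>2)"
    if w: "w \<in> spn E" for w
  proof -
    have "w = (\<Sum>b\<in>B. csc (cip b w) b)" using proj_expand[OF B(2) w] by simp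
    also have "\<dots> = (\<Sum>b\<in>B - R. csc (cip b w) b) + (\<Sum>b\<in>R. csc (cip b w) b)"
      using sum.subset_diff[OF RB fB] .
    finally have "w - proj R w = (\<Sum>b\<in>B - R. csc (cip b w) b)"
      unfolding proj_def by (simp only: diff_eq_eq)
    moreover have "ons (B - R)" using ons_subset[OF B(1)] by blast
    ultimately have "r\<^sup>2 * (norm (w - proj R w))\<^sup>2 = (\<Sum>b\<in>B - R. r\<^sup>2 * (cmod (cip b w))\<^sup>2)"
      by (simp add: norm_comb sum_distrib_left)
    also have "\<dots> \<le> (\<Sum>b\<in>B - R. ev b * (cmod (cip b w))\<^sup>2)"
      by (intro sum_mono mult_right_mono) (auto simp: R_def)
    also have "\<dots> \<le> (\<Sum>b\<in>B. ev b * (cmod (cip b w))\<^sup>2)"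
      using fB ev0 by (intro sum_mono2) auto
    finally show ?thesis using normD[OF w] by simp
  qed
  ultimately show ?thesis using oR RE by blast
qed

section \<open>The swindle\<close>

lemma sum_le_sqrt_card:
  fixes f :: "nat \<Rightarrow> real"
  assumes "(\<Sum>j<n. (f j)\<^sup>2) \<le> c\<^sup>2" "0 \<le> c"
  shows "(\<Sum>j<n. f j) \<le> sqrt n * c"
proof -
  have "(\<Sum>j<n. f j)\<^sup>2 \<le> real n * (\<Sum>j<n. (f j)\<^sup>2)"
    using sum_squared_le_sum_of_squares[of f "{..<n}"] by (simp add: mult.commute)
  also have "\<dots> \<le> real n * c\<^sup>2" using assms(1) by (rule mult_left_mono) simp
  also have "\<dots> = (sqrt n * c)\<^sup>2" by (simp add: power_mult_distrib)
  finally show ?thesis by (rule power2_le_imp_le) (use assms(2) in simp)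
qed

definition diagop :: "'a fvec set \<Rightarrow> ('a fvec \<Rightarrow> real) \<Rightarrow> 'a fvec \<Rightarrow> 'a fvec" where
  "diagop D p w = (\<Sum>b\<in>D. csc (of_real (p b) * cip b w) b)"

lemma clin_diagop: "clin (diagop D p)"
  by (rule clinI) (simp_all add: diagop_def sum.distrib csc_sum_right csc_add_left algebra_simps)

text \<open>The cyclic shift of the images \<open>V 0, V 1, \<dots>\<close> changes the operators little because they shrink
  gradually along the chain, and it brings the last image, where they nearly vanish, onto \<open>V 0\<close>, the
  space \<open>Y\<close> itself.\<close>

lemma swindle:
  fixes X :: "nat \<Rightarrow> 'a fvec \<Rightarrow> 'a fvec" and V :: "nat \<Rightarrow> 'a fvec \<Rightarrow> 'a fvec"
  assumes X: "\<And>i. i < m \<Longrightarrow> clin (X i)" "\<And>i. i < m \<Longrightarrow> csym (X i)"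
      "\<And>i v. i < m \<Longrightarrow> norm (X i v) \<le> norm v"
    and Y: "ons (Y \<union> D)" "Y \<inter> D = {}"
      "\<And>i v. i < m \<Longrightarrow> v \<in> spn (Y \<union> D) \<Longrightarrow> X i v \<in> spn (Y \<union> D)"
    and J: "0 < J"
    and V0: "\<And>y. y \<in> Y \<Longrightarrow> V 0 y = y"
    and Vin: "\<And>j y. j < J \<Longrightarrow> y \<in> Y \<Longrightarrow> V j y \<in> spn (Y \<union> D)"
    and Vcip: "\<And>j k y z. j < J \<Longrightarrow> k < J \<Longrightarrow> y \<in> Y \<Longrightarrow> z \<in> Y \<Longrightarrow>
      cip (V j y) (V k z) = (if j = k then cip y z else 0)"
    and t: "\<And>j. j < J \<Longrightarrow> \<bar>t j - t (Suc j)\<bar> \<le> \<delta>" "t J = 0" "0 \<le> \<delta>"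
    and e: "0 \<le> e"
    and XV: "\<And>i j w. i < m \<Longrightarrow> j < J \<Longrightarrow> w \<in> spn Y \<Longrightarrow>
      norm (X i (\<Sum>y\<in>Y. csc (cip y w) (V j y)) - csc (of_real (t j)) (\<Sum>y\<in>Y. csc (cip y (X i w)) (V j y)))
        \<le> e * norm w"
    and XD: "\<And>i w. i < m \<Longrightarrow> w \<in> spn D \<Longrightarrow> norm (X i w - diagop D (p i) w) \<le> e * norm w"
  shows "\<exists>F q. ons F \<and> F \<subseteq> spn (Y \<union> D) \<and> (\<forall>i<m. \<forall>v\<in>spn (Y \<union> D).
    norm (X i v - diagop F (q i) v) \<le> ((3 * e + \<delta>) * sqrt J + (2 * real J + 1) * e) * norm v)"
proof -
  define K where "K = spn (Y \<union> D)"
  have oY: "ons Y" and oD: "ons D" using Y ons_subset by blast+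
  have K: "csub K" by (simp add: K_def)
  have DK: "y \<in> K" if "y \<in> D" for y using that in_spn[OF Y(1)] by (auto simp: K_def)
  have cYD: "cip y b = 0" "cip b y = 0" if "y \<in> Y" "b \<in> D" for y b
    using that Y onsD[OF Y(1)] by auto
  \<comment> \<open>\<open>Vo j\<close> is the isometry \<open>V j\<close> extended by zero to the
    complement of \<open>Y\<close>, and \<open>Va j\<close> is its adjoint.\<close>
  define Vo where "Vo j w = (\<Sum>y\<in>Y. csc (cip y w) (V j y))" for j w
  define Va where "Va j z = (\<Sum>y\<in>Y. csc (cip (V j y) z) y)" for j z
  \<comment> \<open>The cyclic shift of the levels; the last one returns to 0.\<close>
  define s where "s j = (if Suc j = J then 0 else Suc j)" for j
  have sJ: "s j < J" if "j < J" for j using that J by (auto simp: s_def)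
  have sinj: "s j = s k \<longleftrightarrow> j = k" if "j < J" "k < J" for j k using that by (auto simp: s_def)
  have sbij: "bij_betw s {..<J} {..<J}"
  proof -
    have "inj_on s {..<J}" using sinj by (auto simp: inj_on_def)
    moreover have "s ` {..<J} \<subseteq> {..<J}" using sJ by auto
    ultimately show ?thesis
      by (simp add: bij_betw_def endo_inj_surj)
  qed
  have Volin: "clin (Vo j)" for j
    by (rule clinI) (simp_all add: Vo_def csc_add_left sum.distrib csc_sum_right)
  have Valin: "clin (Va j)" for j
    by (rule clinI) (simp_all add: Va_def csc_add_left sum.distrib csc_sum_right)
  have VaY: "Va j z \<in> spn Y" for j z unfolding Va_def by (rule comb_in_spn[OF oY])
  have projVa: "proj Y (Va j z) = Va j z" for j z using VaY spnD by blast
  have VoK: "Vo j w \<in> K" if "j < J" for j w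
    unfolding Vo_def using Vin[OF that] by (intro csub_sum csub_csc) (auto simp: K_def)
  have adj: "cip (Vo j u) w = cip u (Va j w)" for j u w
  proof -
    have "cip (Vo j u) w = (\<Sum>y\<in>Y. cip u y * cip (V j y) w)"
      unfolding Vo_def cip_sum_left by (intro sum.cong refl) (simp, metis cip_cnj)
    then show ?thesis by (simp add: Va_def cip_sum_right mult.commute)
  qed
  have adj': "cip w (Vo j u) = cip (Va j w) u" for j u w
    using adj[of j u w] by (metis cip_cnj)
  have VaVo: "Va j (Vo k a) = (if j = k then proj Y a else 0)" if "j < J" "k < J" for j k a
  proof -
    have "cip (V j y) (Vo k a) = (if j = k then cip y a else 0)" if "y \<in> Y" for y
    proof -
      have "cip (V j y) (Vo k a) = (\<Sum>z\<in>Y. if j = k then cip z a * cip y z else 0)"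
        unfolding Vo_def cip_sum_right
        using Vcip[OF \<open>j < J\<close> \<open>k < J\<close> that] by (intro sum.cong refl) auto
      also have "\<dots> = (if j = k then cip y (proj Y a) else 0)"
        by (simp add: proj_def cip_sum_right)
      finally show ?thesis using cip_proj_in[OF oY that] by simp
    qed
    then show ?thesis by (simp add: Va_def proj_def)
  qed
  have VaVoVa: "Va j (Vo k (Va l z)) = (if j = k then Va l z else 0)" if "j < J" "k < J" for j k l z
    using VaVo[OF that] projVa by simp
  have Vo0: "Vo 0 w = proj Y w" for w
    unfolding Vo_def proj_def using V0 by simp
  have normVo: "norm (Vo j w) = norm (proj Y w)" if "j < J" for j w
  proof -
    have "cip (Vo j w) (Vo j w) = cip (proj Y w) (proj Y w)"
      using VaVo[OF that that, of w] by (simp add: adj) (metis cip_proj oY proj_proj)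
    then have "(norm (Vo j w))\<^sup>2 = (norm (proj Y w))\<^sup>2" by (simp add: norm_sq_cip)
    then show ?thesis by (rule power2_eq_imp_eq) auto
  qed
  have normVo_le: "norm (Vo j w) \<le> norm w" if "j < J" for j w
    using normVo[OF that] norm_proj_le[OF oY] by simp

  \<comment> \<open>\<open>U\<close> carries the image of \<open>V j\<close> onto that of
    \<open>V (s j)\<close> and fixes everything orthogonal to all images. \<open>U'\<close> will be
    its inverse and its adjoint.\<close>
  define U where "U z = z + (\<Sum>j<J. Vo (s j) (Va j z) - Vo j (Va j z))" for z
  define U' where "U' z = z + (\<Sum>j<J. Vo j (Va (s j) z) - Vo (s j) (Va (s j) z))" for z
  have Ulin: "clin U"
    by (rule clinI) (simp_all add: U_def clin_add[OF Valin] clin_add[OF Volin] clin_csc[OF Valin]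
        clin_csc[OF Volin] sum.distrib sum_subtractf csc_add_right csc_diff_right csc_sum_right)
  have U'lin: "clin U'"
    by (rule clinI) (simp_all add: U'_def clin_add[OF Valin] clin_add[OF Volin] clin_csc[OF Valin]
        clin_csc[OF Volin] sum.distrib sum_subtractf csc_add_right csc_diff_right csc_sum_right)
  have VaU: "Va (s k) (U z) = Va k z" if k: "k < J" for k z
  proof -
    have "Va (s k) (U z) = Va (s k) z + (\<Sum>j<J. Va (s k) (Vo (s j) (Va j z)) - Va (s k) (Vo j (Va j z)))"
      by (simp add: U_def clin_add[OF Valin] clin_diff[OF Valin] clin_sum[OF Valin])
    also have "\<dots> = Va (s k) z + (\<Sum>j<J. (if k = j then Va j z else 0) - (if s k = j then Va j z else 0))"
      using VaVoVa sJ sinj k by (intro arg_cong2[where f="(+)"] sum.cong refl) auto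
    also have "\<dots> = Va k z" using k sJ[OF k] by (simp add: sum_subtractf)
    finally show ?thesis .
  qed
  have VaU': "Va k (U' z) = Va (s k) z" if k: "k < J" for k z
  proof -
    have "k \<in> s ` {..<J}" using sbij k by (simp add: bij_betw_def)
    then obtain k' where k': "k' < J" "s k' = k" by auto
    have "Va k (U' z) = Va k z + (\<Sum>j<J. Va k (Vo j (Va (s j) z)) - Va k (Vo (s j) (Va (s j) z)))"
      by (simp add: U'_def clin_add[OF Valin] clin_diff[OF Valin] clin_sum[OF Valin])
    also have "\<dots> = Va k z + (\<Sum>j<J. (if k = j then Va (s j) z else 0) - (if k' = j then Va (s j) z else 0))"
      using VaVoVa sJ sinj k k' by (intro arg_cong2[where f="(+)"] sum.cong refl) auto
    also have "\<dots> = Va (s k) z" using k k' by (simp add: sum_subtractf)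
    finally show ?thesis .
  qed
  have U'U: "U' (U z) = z" for z
  proof -
    have "U' (U z) = U z + (\<Sum>j<J. Vo j (Va j z) - Vo (s j) (Va j z))"
      unfolding U'_def[of "U z"] using VaU by simp
    then show ?thesis by (simp add: U_def sum_subtractf)
  qed
  have UU': "U (U' z) = z" for z
  proof -
    have "U (U' z) = U' z + (\<Sum>j<J. Vo (s j) (Va (s j) z) - Vo j (Va (s j) z))"
      unfolding U_def[of "U' z"] using VaU' by simp
    then show ?thesis by (simp add: U'_def sum_subtractf)
  qed
  have cipU': "cip (U' w) v = cip w (U v)" for w v
  proof -
    have "cip (U' w) v = cip w v + (\<Sum>j<J. cip w (Vo (s j) (Va j v)) - cip w (Vo (s j) (Va (s j) v)))"
      by (simp add: U'_def cip_sum_left adj adj')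
    also have "\<dots> = cip w v + (\<Sum>j<J. cip w (Vo (s j) (Va j v)) - cip w (Vo j (Va j v)))"
      using sum.reindex_bij_betw[OF sbij, of "\<lambda>j. cip w (Vo j (Va j v))"] by (simp add: sum_subtractf)
    also have "\<dots> = cip w (U v)" by (simp add: U_def cip_sum_right)
    finally show ?thesis .
  qed
  have cipU'U': "cip (U' w) (U' v) = cip w v" for w v by (simp add: cipU' UU')
  have normU': "norm (U' w) = norm w" for w
    using cipU'U'[of w w] by (simp add: norm_sq_cip power2_eq_imp_eq)
  have normU: "norm (U w) = norm w" for w using normU'[of "U w"] U'U by simp
  have UVo: "U (Vo j w) = Vo (s j) w" if "j < J" "w \<in> spn Y" for j w
  proof -
    have "(\<Sum>k<J. Vo (s k) (Va k (Vo j w)) - Vo k (Va k (Vo j w))) =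
        (\<Sum>k<J. if k = j then Vo (s j) w - Vo j w else 0)"
      using VaVo[OF _ that(1), of _ w] spnD[OF that(2)] clin_0[OF Volin]
      by (intro sum.cong refl) auto
    then show ?thesis using that by (simp add: U_def)
  qed
  have U'K: "U' v \<in> K" if "v \<in> K" for v
    unfolding U'_def using that sJ VoK by (intro csub_add[OF K] csub_sum[OF K] csub_diff[OF K]) auto

  define C where "C i w = diagop D (p i) w" for i w
  have Clin: "clin (C i)" for i unfolding C_def by (rule clin_diagop)
  \<comment> \<open>The commuting operators are \<open>U' C U\<close>, where \<open>C\<close> is
    diagonal on \<open>D\<close> and zero on \<open>Y\<close>. Thus the kernel \<open>Y\<close>, on
    which zero would be a bad value, is traded for its preimage under \<open>U\<close>, the last
    image, on which zero is a good one.\<close>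
  define F where "F = U' ` D"
  have injU': "inj U'" using UU' by (metis injI)
  define q where "q i f = p i (U f)" for i f
  have oF: "ons F"
    unfolding ons_def F_def using ons_finite[OF oD] onsD[OF oD] injU' cipU'U'
    by (auto simp: inj_eq)
  have FK: "F \<subseteq> K" using U'K DK by (auto simp: F_def)
  have diagF: "diagop F (q i) v = U' (C i (U v))" for i v
  proof -
    have "diagop F (q i) v = (\<Sum>b\<in>D. csc (of_real (p i b) * cip b (U v)) (U' b))"
      unfolding diagop_def F_def q_def
      using injU' by (subst sum.reindex) (auto simp: inj_on_def UU' cipU' inj_def)
    then show ?thesis
      by (simp add: C_def diagop_def clin_sum[OF U'lin] clin_csc[OF U'lin])
  qed
  have CY: "C i w = 0" if "w \<in> spn Y" for i w
  proof -
    have "cip b w = 0" if "b \<in> D" for b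
      using spn_perp[OF \<open>w \<in> spn Y\<close>, of b] cYD that by (metis cip_cnj complex_cnj_zero)
    then show ?thesis by (simp add: C_def diagop_def)
  qed
  have in_D: "w \<in> spn D" if "w \<in> K" "\<And>y. y \<in> Y \<Longrightarrow> cip y w = 0" for w
  proof -
    have "w = proj (Y \<union> D) w" using that(1) spnD by (metis K_def)
    also have "\<dots> = proj Y w + proj D w"
      unfolding proj_def using Y ons_finite[OF oY] ons_finite[OF oD] by (intro sum.union_disjoint) auto
    also have "proj Y w = 0" using that(2) by (intro proj_perp0)
    finally show ?thesis by (simp add: spn_def)
  qed
  have "norm (X i v - diagop F (q i) v) \<le>
      ((3 * e + \<delta>) * sqrt J + (2 * real J + 1) * e) * norm v" if i: "i < m" and v: "v \<in> K" for i v
  proof -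
    define a where "a j = Va j v" for j
    define P where "P = (\<Sum>j<J. Vo j (a j))"
    define w where "w = v - P"
    \<comment> \<open>The intertwining defect of \<open>U\<close>. Since \<open>U'\<close> is
      isometric, the norm of \<open>G v\<close> is exactly the error to be bounded.\<close>
    define G where "G z = U (X i z) - C i (U z)" for z
    have Glin: "clin G"
      by (rule clinI) (simp_all add: G_def clin_add[OF Ulin] clin_csc[OF Ulin] clin_add[OF X(1)[OF i]]
          clin_csc[OF X(1)[OF i]] clin_add[OF Clin] clin_csc[OF Clin] csc_diff_right)
    have aY: "a j \<in> spn Y" for j by (simp add: a_def VaY)
    have Vaw: "Va j w = 0" if "j < J" for j
    proof -
      have "Va j P = (\<Sum>k<J. if j = k then a k else 0)"
        unfolding P_def clin_sum[OF Valin] a_def using VaVoVa that by (intro sum.cong refl) auto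
      also have "\<dots> = a j" using that by simp
      finally show ?thesis by (simp add: w_def clin_diff[OF Valin] a_def)
    qed
    have wK: "w \<in> K"
      unfolding w_def P_def using v VoK by (intro csub_diff[OF K] csub_sum[OF K]) auto
    have wD: "w \<in> spn D"
    proof (rule in_D[OF wK])
      fix y assume "y \<in> Y"
      have "proj Y w = 0"
        using Vaw[OF J] V0 unfolding Va_def proj_def by simp
      then show "cip y w = 0" using cip_proj_in[OF oY \<open>y \<in> Y\<close>, of w] by simp
    qed
    have Pw: "cip P w = 0"
      unfolding P_def cip_sum_left adj using Vaw by simp
    have nP: "(norm P)\<^sup>2 = (\<Sum>j<J. (norm (a j))\<^sup>2)"
    proof -
      have "(norm P)\<^sup>2 = (\<Sum>j<J. (norm (Vo j (a j)))\<^sup>2)"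
        unfolding P_def by (rule norm_sum_orth) (auto simp: adj VaVo)
      also have "\<dots> = (\<Sum>j<J. (norm (a j))\<^sup>2)"
        using normVo spnD[OF aY] by (intro sum.cong) auto
      finally show ?thesis .
    qed
    have split: "(norm v)\<^sup>2 = (norm P)\<^sup>2 + (norm w)\<^sup>2"
      using norm_add_orth[OF Pw] by (simp add: w_def)
    then have "(norm w)\<^sup>2 \<le> (norm v)\<^sup>2" by simp
    then have nw: "norm w \<le> norm v" by (rule power2_le_imp_le) simp
    \<comment> \<open>The images are orthogonal, so the squares of the \<open>norm (a j)\<close> add
      up to at most that of \<open>norm v\<close>; this is where \<open>sqrt J\<close> instead of
      \<open>J\<close> comes from.\<close>
    have sa: "(\<Sum>j<J. norm (a j)) \<le> sqrt J * norm v"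
      by (rule sum_le_sqrt_card) (use nP split in auto)
    have GV: "norm (G (Vo j b)) \<le> (3 * e + \<delta>) * norm b" if j: "j < J" and b: "b \<in> spn Y" for j b
    proof -
      have E1: "norm (U (X i (Vo j b)) - csc (of_real (t j)) (Vo (s j) (X i b))) \<le> e * norm b"
      proof -
        have Up: "U (Vo j (X i b)) = Vo (s j) (X i b)"
        proof -
          have "Vo k z = Vo k (proj Y z)" for k z
            unfolding Vo_def using cip_proj_in[OF oY] by simp
          then show ?thesis using UVo[OF j proj_spn[OF oY]] by metis
        qed
        have "U (X i (Vo j b)) - csc (of_real (t j)) (Vo (s j) (X i b))
            = U (X i (Vo j b) - csc (of_real (t j)) (Vo j (X i b)))"
          by (simp add: clin_diff[OF Ulin] clin_csc[OF Ulin] Up)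
        then show ?thesis using XV[OF i j b] by (simp add: normU Vo_def)
      qed
      \<comment> \<open>One \<open>e\<close> exchanges \<open>C\<close> for \<open>X i\<close> on
        the next image, which lies in \<open>spn D\<close>; the other compares \<open>X i\<close> on
        that image with \<open>t (Suc j)\<close>. After the last level both terms vanish, because
        \<open>C i\<close> is zero on \<open>Y\<close> and \<open>t J = 0\<close>.\<close>
      have E2: "norm (csc (of_real (t (Suc j))) (Vo (s j) (X i b)) - C i (Vo (s j) b)) \<le> 2 * e * norm b"
      proof (cases "Suc j = J")
        case True
        then have "C i (Vo (s j) b) = 0" using CY[OF proj_spn[OF oY]] by (simp add: s_def Vo0)
        then show ?thesis using True t e by simp
      next
        case False
        then have sj: "s j = Suc j" "Suc j < J" using j by (auto simp: s_def)
        have "Vo (Suc j) b \<in> spn D"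
        proof (rule in_D[OF VoK[OF sj(2)]])
          fix y assume y: "y \<in> Y"
          have "proj Y (Vo (Suc j) b) = Va 0 (Vo (Suc j) b)"
            using V0 by (simp add: Va_def proj_def)
          then have "proj Y (Vo (Suc j) b) = 0" using VaVo[OF J sj(2)] by simp
          then show "cip y (Vo (Suc j) b) = 0" using cip_proj_in[OF oY y, of "Vo (Suc j) b"] by simp
        qed
        from XD[OF i this] have "norm (X i (Vo (Suc j) b) - C i (Vo (Suc j) b)) \<le> e * norm b"
          using normVo[OF sj(2), of b] spnD[OF b] by (simp add: C_def)
        moreover have "norm (X i (Vo (Suc j) b) - csc (of_real (t (Suc j))) (Vo (Suc j) (X i b))) \<le> e * norm b"
          using XV[OF i sj(2) b] by (simp add: Vo_def)
        ultimately have "norm (X i (Vo (Suc j) b) - C i (Vo (Suc j) b) -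
            (X i (Vo (Suc j) b) - csc (of_real (t (Suc j))) (Vo (Suc j) (X i b)))) \<le> e * norm b + e * norm b"
          using norm_triangle_ineq4 order_trans add_mono by meson
        then show ?thesis by (simp add: sj algebra_simps)
      qed
      have E3: "norm (csc (of_real (t j - t (Suc j))) (Vo (s j) (X i b))) \<le> \<delta> * norm b"
      proof -
        have "norm (Vo (s j) (X i b)) \<le> norm b"
          using normVo_le[OF sJ[OF j]] X(3)[OF i] order_trans by blast
        then show ?thesis using t(1)[OF j] t(3)
          by (simp only: norm_csc norm_of_real) (intro mult_mono, auto)
      qed
      have "G (Vo j b) = (U (X i (Vo j b)) - csc (of_real (t j)) (Vo (s j) (X i b)))
        + (csc (of_real (t (Suc j))) (Vo (s j) (X i b)) - C i (Vo (s j) b))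
        + csc (of_real (t j - t (Suc j))) (Vo (s j) (X i b))"
        using UVo[OF j b] by (simp add: G_def csc_diff_left)
      also have "norm \<dots> \<le> e * norm b + 2 * e * norm b + \<delta> * norm b"
        using norm_triangle_mono[OF norm_triangle_mono[OF E1 E2] E3] .
      finally show ?thesis by (simp add: algebra_simps)
    qed
    have GP: "norm (G P) \<le> (3 * e + \<delta>) * sqrt J * norm v"
    proof -
      have "norm (G P) \<le> (\<Sum>j<J. norm (G (Vo j (a j))))"
        unfolding P_def clin_sum[OF Glin] by (rule norm_sum)
      also have "\<dots> \<le> (\<Sum>j<J. (3 * e + \<delta>) * norm (a j))"
        using GV aY by (intro sum_mono) auto
      also have "\<dots> \<le> (3 * e + \<delta>) * (sqrt J * norm v)"
        unfolding sum_distrib_left[symmetric] using sa e t(3) by (intro mult_left_mono) auto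
      finally show ?thesis by (simp add: mult.assoc)
    qed
    have Gw: "norm (G w) \<le> (2 * real J + 1) * e * norm v"
    proof -
      have Uw: "U w = w" using Vaw clin_0[OF Volin] by (simp add: U_def)
      \<comment> \<open>\<open>X i w\<close> has almost no component in the images: move
        \<open>X i\<close> onto the image vector by symmetry, where it nearly stays inside the image
        and is therefore nearly orthogonal to \<open>w\<close>.\<close>
      have VaX: "norm (Va j (X i w)) \<le> e * norm w" if j: "j < J" for j
      proof -
        let ?b = "Va j (X i w)"
        have "cip w (Vo j (X i ?b)) = 0" using Vaw[OF j] by (simp add: adj')
        then have "cip (X i (Vo j ?b)) w = cip (X i (Vo j ?b) - csc (of_real (t j)) (Vo j (X i ?b))) w"
          using cip_cnj[of "Vo j (X i ?b)" w] by simp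
        moreover have "cip (X i (Vo j ?b)) w = cip ?b ?b"
          using csymD[OF X(2)[OF i]] by (simp add: adj)
        ultimately have "cip (X i (Vo j ?b) - csc (of_real (t j)) (Vo j (X i ?b))) w
            = of_real ((norm ?b)\<^sup>2)"
          by (simp only: cip_self)
        then have "(norm ?b)\<^sup>2 = cmod (cip (X i (Vo j ?b) - csc (of_real (t j)) (Vo j (X i ?b))) w)"
          by (simp only: norm_of_real abs_of_nonneg zero_le_power2)
        also have "\<dots> \<le> norm (X i (Vo j ?b) - csc (of_real (t j)) (Vo j (X i ?b))) * norm w"
          by (rule cmod_cip_le)
        also have "\<dots> \<le> (e * norm ?b) * norm w"
          using XV[OF i j VaY] by (intro mult_right_mono) (auto simp: Vo_def)
        finally have "norm ?b * norm ?b \<le> (e * norm w) * norm ?b"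
          by (simp add: power2_eq_square algebra_simps)
        then show ?thesis
          by (cases "norm ?b = 0") (use e in \<open>auto simp: mult_le_cancel_right\<close>)
      qed
      have "norm (U (X i w) - X i w) \<le> (\<Sum>j<J. norm (Vo (s j) (Va j (X i w)) - Vo j (Va j (X i w))))"
        by (simp add: U_def norm_sum)
      also have "\<dots> \<le> (\<Sum>j<J. 2 * (e * norm w))"
      proof (rule sum_mono)
        fix j assume "j \<in> {..<J}"
        then have j: "j < J" by simp
        show "norm (Vo (s j) (Va j (X i w)) - Vo j (Va j (X i w))) \<le> 2 * (e * norm w)"
          using norm_triangle_ineq4[of "Vo (s j) (Va j (X i w))" "Vo j (Va j (X i w))"]
            normVo_le[OF j, of "Va j (X i w)"] normVo_le[OF sJ[OF j], of "Va j (X i w)"] VaX[OF j]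
          by linarith
      qed
      finally have "norm (U (X i w) - X i w) \<le> 2 * real J * e * norm w" by simp
      moreover have "norm (X i w - C i w) \<le> e * norm w" using XD[OF i wD] by (simp add: C_def)
      moreover have "G w = (U (X i w) - X i w) + (X i w - C i w)" by (simp add: G_def Uw)
      ultimately have "norm (G w) \<le> 2 * real J * e * norm w + e * norm w"
        using norm_triangle_mono by metis
      also have "\<dots> = (2 * real J + 1) * e * norm w" by (simp add: algebra_simps)
      also have "\<dots> \<le> (2 * real J + 1) * e * norm v" using nw e by (intro mult_left_mono) auto
      finally show ?thesis .
    qed
    have "X i v - diagop F (q i) v = U' (G v)"
      by (simp add: diagF G_def clin_diff[OF U'lin] U'U)
    then have "norm (X i v - diagop F (q i) v) = norm (G P + G w)"
      using clin_add[OF Glin, of P w] by (simp add: normU' w_def)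
    also have "\<dots> \<le> (3 * e + \<delta>) * sqrt J * norm v + (2 * real J + 1) * e * norm v"
      using norm_triangle_mono[OF GP Gw] .
    finally show ?thesis by (simp add: algebra_simps)
  qed
  then show ?thesis using oF FK unfolding K_def by blast
qed

section \<open>Multiple copies of a space\<close>

definition emb :: "'l \<Rightarrow> 'a fvec \<Rightarrow> ('a \<times> 'l) fvec" where
  "emb l v = FVec (\<lambda>(a, k). if k = l then coord v a else 0)"

definition slice :: "'l \<Rightarrow> ('a \<times> 'l) fvec \<Rightarrow> 'a fvec" where
  "slice l u = FVec (\<lambda>a. coord u (a, l))"

text \<open>The operator \<open>T\<close> tensored with the identity on the label space of
  \<open>L\<close>; components with labels outside \<open>L\<close> are discarded.\<close>

definition ampl :: "'l set \<Rightarrow> ('a fvec \<Rightarrow> 'b fvec) \<Rightarrow> ('a \<times> 'l) fvec \<Rightarrow> ('b \<times> 'l) fvec" where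
  "ampl L T u = (\<Sum>l\<in>L. emb l (T (slice l u)))"

definition copies :: "'l set \<Rightarrow> 'a fvec set \<Rightarrow> ('a \<times> 'l) fvec set" where
  "copies L B = (\<Union>l\<in>L. emb l ` B)"

lemma coord_emb [simp]: "coord (emb l v) x = (if snd x = l then coord v (fst x) else 0)"
proof -
  have "finite {x. (case x of (a, k) \<Rightarrow> if k = l then coord v a else 0) \<noteq> 0}"
    by (rule finite_subset[of _ "csupp v \<times> {l}"]) (auto simp: csupp_def split: if_splits)
  then show ?thesis by (simp add: emb_def coord_FVec split: prod.splits)
qed

lemma coord_slice [simp]: "coord (slice l u) a = coord u (a, l)"
proof -
  have "finite ((\<lambda>a. (a, l)) -` csupp u)"
    by (intro finite_vimageI) (auto simp: inj_on_def)
  moreover have "(\<lambda>a. (a, l)) -` csupp u = {a. coord u (a, l) \<noteq> 0}"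
    by (auto simp: csupp_def)
  ultimately have "finite {a. coord u (a, l) \<noteq> 0}" by simp
  then show ?thesis by (simp add: slice_def coord_FVec)
qed

lemma clin_emb: "clin (emb l)" by (rule clinI; rule fvec_eqI) auto
lemma clin_slice: "clin (slice l)" by (rule clinI; rule fvec_eqI) auto
lemma slice_emb: "slice l (emb k v) = (if l = k then v else 0)" by (rule fvec_eqI) auto

lemmas emb_lin = clin_add[OF clin_emb] clin_diff[OF clin_emb] clin_csc[OF clin_emb] clin_0[OF clin_emb]
  clin_sum[OF clin_emb]
lemmas slice_lin = clin_add[OF clin_slice] clin_diff[OF clin_slice] clin_csc[OF clin_slice]
  clin_0[OF clin_slice] clin_sum[OF clin_slice]

lemma cip_emb: "cip (emb l u) w = cip u (slice l w)"
proof -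
  have "csupp (emb l u) \<subseteq> (\<lambda>a. (a, l)) ` csupp u" by (auto simp: csupp_def split: if_splits)
  then have "cip (emb l u) w = (\<Sum>x\<in>(\<lambda>a. (a, l)) ` csupp u. cnj (coord (emb l u) x) * coord w x)"
    by (intro cip_superset) auto
  also have "\<dots> = cip u (slice l w)"
    by (subst sum.reindex) (auto simp: inj_on_def cip_def)
  finally show ?thesis .
qed

lemma cip_emb_right: "cip w (emb l u) = cip (slice l w) u"
  using cip_emb[of l u w] by (metis cip_cnj)

lemma cip_emb_emb: "cip (emb l u) (emb k v) = (if l = k then cip u v else 0)"
  by (simp add: cip_emb slice_emb)

lemma norm_emb: "norm (emb l v) = norm v"
  by (rule power2_eq_imp_eq) (simp_all add: norm_sq_cip cip_emb_emb)

lemma emb_inj: "emb l u = emb k v \<Longrightarrow> u \<noteq> 0 \<Longrightarrow> l = k \<and> u = v"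
  by (metis slice_emb)

lemma emb_same_iff [simp]: "emb l u = emb l v \<longleftrightarrow> u = v"
  by (metis slice_emb)

lemma norm_sum_emb:
  assumes "finite I" "inj_on h I"
  shows "(norm (\<Sum>x\<in>I. emb (h x) (f x)))\<^sup>2 = (\<Sum>x\<in>I. (norm (f x))\<^sup>2)"
proof -
  have "cip (emb (h x) (f x)) (emb (h y) (f y)) = 0" if "x \<in> I" "y \<in> I" "x \<noteq> y" for x y
    using inj_onD[OF assms(2) _ that(1,2)] that(3) by (auto simp: cip_emb_emb)
  then show ?thesis using norm_sum_orth[of I "\<lambda>x. emb (h x) (f x)"] assms(1) by (simp add: norm_emb)
qed

lemma ons_copies:
  assumes "ons B" "finite L" shows "ons (copies L B)"
  unfolding ons_def
proof (intro conjI ballI)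
  show "finite (copies L B)" using assms by (auto simp: copies_def ons_def)
  fix u v assume "u \<in> copies L B" "v \<in> copies L B"
  then obtain l k b c where *: "b \<in> B" "c \<in> B" "u = emb l b" "v = emb k c"
    by (auto simp: copies_def)
  have "b \<noteq> 0" using ons_norm[OF assms(1) *(1)] by auto
  then have "u = v \<longleftrightarrow> l = k \<and> b = c" using emb_inj[of l b k c] * by auto
  then show "cip u v = (if u = v then 1 else 0)"
    using onsD[OF assms(1) *(1,2)] by (auto simp: * cip_emb_emb)
qed

lemma card_copies_le: "finite B \<Longrightarrow> finite L \<Longrightarrow> card (copies L B) \<le> card L * card B"
proof -
  assume *: "finite B" "finite L"
  have "card (copies L B) \<le> (\<Sum>l\<in>L. card (emb l ` B))"
    unfolding copies_def using * by (intro card_UN_le)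
  also have "\<dots> \<le> (\<Sum>l\<in>L. card B)" using * by (intro sum_mono card_image_le) auto
  finally show ?thesis by simp
qed

lemma proj_copies:
  assumes "ons B" "finite L"
  shows "proj (copies L B) u = ampl L (proj B) u"
proof -
  have "(\<Sum>b\<in>copies L B. csc (cip b u) b) = (\<Sum>l\<in>L. \<Sum>b\<in>emb l ` B. csc (cip b u) b)"
    unfolding copies_def
  proof (rule sum.UNION_disjoint)
    show "\<forall>l\<in>L. finite (emb l ` B)" using ons_finite[OF assms(1)] by auto
    have nz: "b \<noteq> 0" if "b \<in> B" for b using ons_norm[OF assms(1) that] by auto
    show "\<forall>l\<in>L. \<forall>k\<in>L. l \<noteq> k \<longrightarrow> emb l ` B \<inter> emb k ` B = {}"
    proof (intro ballI impI equals0I)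
      fix l k x assume "l \<noteq> k" "x \<in> emb l ` B \<inter> emb k ` B"
      then obtain b c where "b \<in> B" "emb l b = emb k c" by auto
      then show False using emb_inj[of l b k c] nz[of b] \<open>l \<noteq> k\<close> by auto
    qed
  qed (use assms in auto)
  also have "\<dots> = (\<Sum>l\<in>L. \<Sum>b\<in>B. csc (cip b (slice l u)) (emb l b))"
    by (intro sum.cong refl, subst sum.reindex) (auto simp: inj_on_def cip_emb)
  finally show ?thesis by (simp add: proj_def ampl_def emb_lin)
qed

lemma slice_ampl: "finite L \<Longrightarrow> slice l (ampl L T u) = (if l \<in> L then T (slice l u) else 0)"
  by (simp add: ampl_def slice_lin slice_emb)

lemma spn_copies:
  assumes "ons B" "finite L"
  shows "u \<in> spn (copies L B) \<longleftrightarrow> (\<forall>l\<in>L. slice l u \<in> spn B) \<and> u = (\<Sum>l\<in>L. emb l (slice l u))"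
proof -
  have "ampl L (proj B) u = u \<longleftrightarrow> (\<forall>l\<in>L. proj B (slice l u) = slice l u) \<and> u = (\<Sum>l\<in>L. emb l (slice l u))"
  proof
    assume *: "ampl L (proj B) u = u"
    have "proj B (slice l u) = slice l u" if "l \<in> L" for l
      using slice_ampl[OF assms(2), of l "proj B" u] that * by simp
    then show "(\<forall>l\<in>L. proj B (slice l u) = slice l u) \<and> u = (\<Sum>l\<in>L. emb l (slice l u))"
      using * by (simp add: ampl_def)
  next
    assume *: "(\<forall>l\<in>L. proj B (slice l u) = slice l u) \<and> u = (\<Sum>l\<in>L. emb l (slice l u))"
    then have "ampl L (proj B) u = (\<Sum>l\<in>L. emb l (slice l u))" by (simp add: ampl_def)
    then show "ampl L (proj B) u = u" using * by metis
  qed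
  then show ?thesis by (simp add: spn_def proj_copies[OF assms])
qed

lemma cip_slices:
  assumes "ons B" "finite L" "w \<in> spn (copies L B)"
  shows "cip u w = (\<Sum>l\<in>L. cip (slice l u) (slice l w))"
proof -
  have "w = (\<Sum>l\<in>L. emb l (slice l w))" using assms spn_copies by blast
  then have "cip u w = cip u (\<Sum>l\<in>L. emb l (slice l w))" by metis
  then show ?thesis by (simp add: cip_sum_right cip_emb_right)
qed

lemma norm_slices:
  assumes "ons B" "finite L" "w \<in> spn (copies L B)"
  shows "(norm w)\<^sup>2 = (\<Sum>l\<in>L. (norm (slice l w))\<^sup>2)"
  using cip_slices[OF assms, of w] by (simp add: norm_sq_cip)

lemma norm_ampl: "finite L \<Longrightarrow> (norm (ampl L T u))\<^sup>2 = (\<Sum>l\<in>L. (norm (T (slice l u)))\<^sup>2)"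
  unfolding ampl_def by (rule norm_sum_emb) auto

lemma sum_norm_slice_le: "finite L \<Longrightarrow> (\<Sum>l\<in>L. (norm (slice l u))\<^sup>2) \<le> (norm u)\<^sup>2"
proof -
  assume L: "finite L"
  let ?w = "\<Sum>l\<in>L. emb l (slice l u)"
  have sw: "slice l ?w = (if l \<in> L then slice l u else 0)" for l
    using L by (simp add: slice_lin slice_emb)
  have n: "(norm ?w)\<^sup>2 = (\<Sum>l\<in>L. (norm (slice l u))\<^sup>2)" using L by (intro norm_sum_emb) auto
  have "cip ?w (u - ?w) = 0"
    by (simp add: cip_sum_left cip_emb slice_lin(2) sw)
  then have "(norm u)\<^sup>2 = (norm ?w)\<^sup>2 + (norm (u - ?w))\<^sup>2"
    using norm_add_orth[of ?w "u - ?w"] by simp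
  then show ?thesis using n by simp
qed

lemma clin_ampl: "clin T \<Longrightarrow> clin (ampl L T)"
  by (rule clinI) (simp_all add: ampl_def emb_lin slice_lin clin_add clin_csc sum.distrib csc_sum_right)

lemma csym_ampl: "csym T \<Longrightarrow> csym (ampl L T)"
  by (simp add: csym_def ampl_def cip_sum_left cip_sum_right cip_emb cip_emb_right)

lemma norm_ampl_le:
  assumes "finite L" "\<And>l. l \<in> L \<Longrightarrow> norm (T (slice l u)) \<le> c * norm (slice l u)" "0 \<le> c"
  shows "norm (ampl L T u) \<le> c * norm u"
proof -
  have "(norm (ampl L T u))\<^sup>2 \<le> (\<Sum>l\<in>L. (c * norm (slice l u))\<^sup>2)"
    unfolding norm_ampl[OF assms(1)] using assms by (intro sum_mono power_mono) auto
  also have "\<dots> = c\<^sup>2 * (\<Sum>l\<in>L. (norm (slice l u))\<^sup>2)"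
    by (simp add: power_mult_distrib sum_distrib_left)
  also have "\<dots> \<le> c\<^sup>2 * (norm u)\<^sup>2"
    using sum_norm_slice_le[OF assms(1)] by (intro mult_left_mono) auto
  finally have "(norm (ampl L T u))\<^sup>2 \<le> (c * norm u)\<^sup>2" by (simp add: power_mult_distrib)
  then show ?thesis by (rule power2_le_imp_le) (use assms in simp)
qed

lemma ampl_in_spn:
  assumes "ons B" "finite L" "\<And>l. l \<in> L \<Longrightarrow> T (slice l u) \<in> spn B"
  shows "ampl L T u \<in> spn (copies L B)"
  using assms(3) unfolding spn_copies[OF assms(1,2)] slice_ampl[OF assms(2)]
  by (auto simp: ampl_def)

section \<open>Assembling the chain from approximate eigenspaces\<close>

lemma csub_image: "clin T \<Longrightarrow> csub W \<Longrightarrow> csub (T ` W)"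
proof -
  assume T: "clin T" and W: "csub W"
  have "T u + T v \<in> T ` W" if "u \<in> W" "v \<in> W" for u v
    using clin_add[OF T, of u v] csub_add[OF W that] by (metis image_eqI)
  moreover have "csc c (T u) \<in> T ` W" if "u \<in> W" for c u
    using clin_csc[OF T, of c u] csub_csc[OF W that] by (metis image_eqI)
  moreover have "0 \<in> T ` W" using clin_0[OF T] csub_0[OF W] by (metis image_eqI)
  ultimately show ?thesis by (auto simp: csub_def)
qed

text \<open>Otherwise some nontrivial combination of preimages of \<open>B\<close> is orthogonal to
  \<open>Y\<close> while lying in its span, hence zero, and its image is a vanishing combination of
  \<open>B\<close>.\<close>

lemma card_ons_image_le:
  assumes T: "clin T" and Y: "ons Y" and B: "ons B" "B \<subseteq> T ` spn Y"
  shows "card B \<le> card Y"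
proof (rule ccontr)
  assume "\<not> card B \<le> card Y"
  have "\<exists>x. x \<in> spn Y \<and> T x = b" if "b \<in> B" for b using B(2) that by blast
  then obtain f where f: "\<And>b. b \<in> B \<Longrightarrow> f b \<in> spn Y \<and> T (f b) = b" by metis
  obtain c where c: "\<exists>k\<in>B. c k \<noteq> 0" "\<forall>q\<in>Y. cip q (\<Sum>k\<in>B. csc (c k) (f k)) = 0"
    using homogeneous_system[of Y B "\<lambda>x. x" f] ons_finite[OF Y] ons_finite[OF B(1)] \<open>\<not> card B \<le> card Y\<close>
    by auto
  let ?u = "\<Sum>k\<in>B. csc (c k) (f k)"
  have "?u \<in> spn Y" using f by (intro csub_sum csub_csc) auto
  moreover have "proj Y ?u = 0" using c(2) by (intro proj_perp0) blast
  ultimately have "?u = 0" by (simp add: spn_def)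
  have "(\<Sum>k\<in>B. csc (c k) k) = T ?u"
    unfolding clin_sum[OF T] clin_csc[OF T] using f by (intro sum.cong) auto
  then have "(\<Sum>k\<in>B. csc (c k) k) = 0" using \<open>?u = 0\<close> clin_0[OF T] by simp
  then show False using ons_comb_eq_0[OF B(1)] c(1) by blast
qed

text \<open>This supplies the hypotheses of \<open>swindle\<close>. The family \<open>G\<close>
  resolves the identity into outcomes \<open>c\<close> at which the tuple is nearly
  \<open>y c\<close>; \<open>P j c\<close> is the target for outcome \<open>c\<close> at level
  \<open>j\<close>; off the vectors \<open>Q\<close> the means are small. Each target sits under its
  own label, and it only has to hold the image of the leftover space \<open>Y\<close> under
  \<open>G c\<close>, which is small either because \<open>Y\<close> is or because the range of
  \<open>G c\<close> is.\<close>

lemma assembly: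
  fixes X :: "nat \<Rightarrow> 'a fvec \<Rightarrow> 'a fvec" and G :: "'c \<Rightarrow> 'a fvec \<Rightarrow> 'a fvec"
    and y :: "'c \<Rightarrow> nat \<Rightarrow> real" and P :: "nat \<Rightarrow> 'c \<Rightarrow> 'a fvec set" and L :: "'l set"
  assumes X: "\<And>i. i < m \<Longrightarrow> clin (X i)" "\<And>i. i < m \<Longrightarrow> csym (X i)"
      "\<And>i v. i < m \<Longrightarrow> norm (X i v) \<le> norm v"
    and E: "ons E" "\<And>i v. i < m \<Longrightarrow> v \<in> spn E \<Longrightarrow> X i v \<in> spn E"
    and L: "finite L" "(J - 1) * card A \<le> card L"
    and G: "finite A" "\<And>c. c \<in> A \<Longrightarrow> clin (G c)" "\<And>c v. c \<in> A \<Longrightarrow> v \<in> spn E \<Longrightarrow> G c v \<in> spn E"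
      "\<And>u v. u \<in> spn E \<Longrightarrow> v \<in> spn E \<Longrightarrow> (\<Sum>c\<in>A. cip (G c u) (G c v)) = cip u v"
      "\<And>i v. i < m \<Longrightarrow> v \<in> spn E \<Longrightarrow>
        (\<Sum>c\<in>A. (norm (csc (of_real (y c i)) (G c v) - G c (X i v)))\<^sup>2) \<le> e\<^sup>2 * (norm v)\<^sup>2"
    and Q: "finite Q" "\<And>i v. i < m \<Longrightarrow> v \<in> spn E \<Longrightarrow> (\<forall>q\<in>Q. cip q v = 0) \<Longrightarrow> norm (X i v) \<le> e * norm v"
    and P: "\<And>j c. 1 \<le> j \<Longrightarrow> j < J \<Longrightarrow> c \<in> A \<Longrightarrow> ons (P j c)"
      "\<And>j c. 1 \<le> j \<Longrightarrow> j < J \<Longrightarrow> c \<in> A \<Longrightarrow> P j c \<subseteq> spn E"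
      "\<And>j c i v. 1 \<le> j \<Longrightarrow> j < J \<Longrightarrow> c \<in> A \<Longrightarrow> i < m \<Longrightarrow> v \<in> spn (P j c) \<Longrightarrow>
        norm (dev (X i) (t j * y c i) v) \<le> e * norm v"
      "\<And>j c. 1 \<le> j \<Longrightarrow> j < J \<Longrightarrow> c \<in> A \<Longrightarrow> card L * card Q \<le> card (P j c) \<or>
        (\<exists>R. ons R \<and> (\<forall>v\<in>spn E. G c v \<in> spn R) \<and> card L * card R \<le> card (P j c))"
    and t: "0 < J" "\<And>j. j < J \<Longrightarrow> \<bar>t j - t (Suc j)\<bar> \<le> \<delta>" "t 0 = 1" "t J = 0" "0 \<le> \<delta>"
      "\<And>j. j < J \<Longrightarrow> \<bar>t j\<bar> \<le> 1"
    and e: "0 \<le> e"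
  shows "\<exists>F q. ons F \<and> F \<subseteq> spn (copies L E) \<and> (\<forall>i<m. \<forall>v\<in>spn (copies L E).
    norm (ampl L (X i) v - diagop F (q i) v) \<le> ((15 * e + \<delta>) * sqrt J + (2 * real J + 1) * (5 * e)) * norm v)"
proof -
  define K where "K = spn (copies L E)"
  \<comment> \<open>Level 0 is \<open>Y\<close> itself and needs no target, hence
    \<open>J - 1\<close> levels in the number of labels.\<close>
  define I where "I = {1..<J} \<times> A"
  have oE: "ons (copies L E)" by (rule ons_copies[OF E(1) L(1)])
  have K: "csub K" by (simp add: K_def)
  have fI: "finite I" using G(1) by (simp add: I_def)
  have "card I \<le> card L" using L(2) by (simp add: I_def card_cartesian_product)
  then obtain h where h: "h ` I \<subseteq> L" "inj_on h I" using card_le_inj[OF fI L(1)] by blast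
  have hinj: "h (j, c) = h (k, d) \<longleftrightarrow> j = k \<and> c = d"
    if "1 \<le> j" "j < J" "c \<in> A" "1 \<le> k" "k < J" "d \<in> A" for j c k d
    using h(2) that by (auto simp: I_def inj_on_def)
  define XX where "XX i = ampl L (X i)" for i
  define GG where "GG c = ampl L (G c)" for c
  have XXlin: "clin (XX i)" if "i < m" for i using X that by (simp add: XX_def clin_ampl)
  have XXsym: "csym (XX i)" if "i < m" for i using X that by (simp add: XX_def csym_ampl)
  have XXn: "norm (XX i v) \<le> norm v" if "i < m" for i v
    using norm_ampl_le[OF L(1), of "X i" v 1] X(3)[OF that] by (simp add: XX_def)
  have GGlin: "clin (GG c)" if "c \<in> A" for c using G that by (simp add: GG_def clin_ampl)
  have Kslice: "slice l v \<in> spn E" if "v \<in> K" "l \<in> L" for v l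
    using that spn_copies[OF E(1) L(1)] by (simp add: K_def)
  have XXK: "XX i v \<in> K" if "i < m" "v \<in> K" for i v
    unfolding XX_def K_def using that Kslice E by (intro ampl_in_spn L) auto
  have GGK: "GG c v \<in> K" if "c \<in> A" "v \<in> K" for c v
    unfolding GG_def K_def using that Kslice G by (intro ampl_in_spn L E(1)) auto
  have GGcip: "(\<Sum>c\<in>A. cip (GG c u) (GG c v)) = cip u v" if u: "u \<in> K" and v: "v \<in> K" for u v
  proof -
    have "(\<Sum>c\<in>A. cip (GG c u) (GG c v)) = (\<Sum>c\<in>A. \<Sum>l\<in>L. cip (G c (slice l u)) (G c (slice l v)))"
      using cip_slices[OF E(1) L(1)] GGK v L(1)
      by (intro sum.cong refl) (auto simp: GG_def slice_ampl K_def intro!: sum.cong)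
    also have "\<dots> = (\<Sum>l\<in>L. cip (slice l u) (slice l v))"
      unfolding sum.swap[of _ L A] using G(4) Kslice u v by (intro sum.cong) auto
    also have "\<dots> = cip u v" using cip_slices[OF E(1) L(1)] v by (simp add: K_def)
    finally show ?thesis .
  qed
  have GGsq: "(\<Sum>c\<in>A. (norm (GG c v))\<^sup>2) = (norm v)\<^sup>2" if "v \<in> K" for v
    using GGcip[OF that that] by (simp add: norm_sq_cip flip: Re_sum)
  have GGerr: "(\<Sum>c\<in>A. (norm (csc (of_real (y c i)) (GG c v) - GG c (XX i v)))\<^sup>2) \<le> e\<^sup>2 * (norm v)\<^sup>2"
    if i: "i < m" and v: "v \<in> K" for i v
  proof -
    have "csc (of_real (y c i)) (GG c v) - GG c (XX i v) =
        ampl L (\<lambda>w. csc (of_real (y c i)) (G c w) - G c (X i w)) v" for c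
      by (simp add: GG_def XX_def ampl_def[of L "G c"] slice_ampl[OF L(1)] ampl_def[of _ "\<lambda>w. _ w - _ w"]
          csc_sum_right emb_lin sum_subtractf)
    then have "(\<Sum>c\<in>A. (norm (csc (of_real (y c i)) (GG c v) - GG c (XX i v)))\<^sup>2) =
        (\<Sum>l\<in>L. \<Sum>c\<in>A. (norm (csc (of_real (y c i)) (G c (slice l v)) - G c (X i (slice l v))))\<^sup>2)"
      by (simp add: norm_ampl[OF L(1)] sum.swap[of _ L A])
    also have "\<dots> \<le> (\<Sum>l\<in>L. e\<^sup>2 * (norm (slice l v))\<^sup>2)"
      using G(5)[OF i] Kslice v by (intro sum_mono) auto
    also have "\<dots> = e\<^sup>2 * (norm v)\<^sup>2"
      using norm_slices[OF E(1) L(1)] v by (simp add: K_def sum_distrib_left)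
    finally show ?thesis .
  qed

  define PE where "PE x = emb (h x) ` P (fst x) (snd x)" for x
  define PP where "PP = (\<Union>x\<in>I. PE x)"
  have emb_K: "emb l v \<in> K" if "l \<in> L" "v \<in> spn E" for l v
    unfolding K_def spn_copies[OF E(1) L(1)] using that L(1) csub_0[OF csub_spn]
    by (auto simp: slice_emb if_distrib[of "emb _"] emb_lin cong: if_cong)
  have oPP: "ons PP"
    unfolding ons_def
  proof (intro conjI ballI)
    show "finite PP" using fI ons_finite[OF P(1)] by (auto simp: PP_def PE_def I_def)
    fix b c assume "b \<in> PP" "c \<in> PP"
    then obtain x x' b' c' where b: "x \<in> I" "b' \<in> P (fst x) (snd x)" "b = emb (h x) b'"
      and c: "x' \<in> I" "c' \<in> P (fst x') (snd x')" "c = emb (h x') c'"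
      by (auto simp: PP_def PE_def)
    have "b' \<noteq> 0" using b ons_norm[OF P(1), of "fst x" "snd x" b'] by (auto simp: I_def)
    show "cip b c = (if b = c then 1 else 0)"
    proof (cases "x = x'")
      case True
      then have "cip b c = (if b' = c' then 1 else 0)"
        using b c onsD[OF P(1), of "fst x" "snd x" b' c'] by (auto simp: cip_emb_emb I_def)
      then show ?thesis using emb_inj[of "h x" b' "h x'" c'] \<open>b' \<noteq> 0\<close> b c True by auto
    next
      case False
      then have "h x \<noteq> h x'" using h(2) b c by (auto simp: inj_on_def)
      then show ?thesis using emb_inj[of "h x" b' "h x'" c'] \<open>b' \<noteq> 0\<close> b c by (auto simp: cip_emb_emb)
    qed
  qed
  have PPK: "PP \<subseteq> K"
    using emb_K h(1) P(2) unfolding PP_def PE_def I_def by fastforce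
  define QQ where "QQ = copies L Q"
  have fQQ: "finite QQ" unfolding QQ_def copies_def using Q(1) L(1) by simp
  have cQQ: "card QQ \<le> card L * card Q"
    unfolding QQ_def using card_copies_le Q(1) L(1) by blast
  \<comment> \<open>Here the means have norm at most \<open>e\<close>, so 0 is an acceptable
    diagonal entry, and \<open>W\<close> joins the targets in the part that needs no
    treatment.\<close>
  define W where "W = K \<inter> {w. \<forall>q\<in>PP \<union> QQ. cip q w = 0}"
  have "csub W" unfolding W_def by (intro csub_Int K csub_perp)
  moreover have "W \<subseteq> spn (copies L E)" by (auto simp: W_def K_def)
  ultimately obtain Z where Z: "ons Z" "spn Z = W" using onb_exists ons_finite[OF oE] by blast
  have ZW: "Z \<subseteq> W" using in_spn[OF Z(1)] Z(2) by auto
  have PZ: "cip b c = 0" if "b \<in> PP" "c \<in> Z" for b c using ZW that by (auto simp: W_def)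
  define D where "D = PP \<union> Z"
  have oD: "ons D" "PP \<inter> Z = {}" unfolding D_def using ons_Un[OF oPP Z(1) PZ] by auto
  have "D \<subseteq> K" using PPK ZW by (auto simp: D_def W_def)
  then obtain B where B: "ons B" "D \<subseteq> B" "spn B = K"
    using onb_extend[OF K ons_finite[OF oE] _ oD(1)] by (auto simp: K_def)
  define Y where "Y = B - D"
  have YD: "Y \<union> D = B" "Y \<inter> D = {}" using B by (auto simp: Y_def)
  have oY: "ons Y" using ons_subset[OF B(1)] by (auto simp: Y_def)
  have YDc: "cip b c = 0" "cip c b = 0" if "b \<in> Y" "c \<in> D" for b c
    using that onsD[OF B(1), of b c] onsD[OF B(1), of c b] B(2) by (auto simp: Y_def)
  have spnYK: "spn Y \<subseteq> K" using spn_subset[OF csub_spn, of Y B] in_spn[OF B(1)] B(3) by (auto simp: Y_def)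
  have spnDK: "spn D \<subseteq> K" using spn_subset[OF csub_spn, of D B] in_spn[OF B(1)] B by auto
  have spnYD: "cip u v = 0" if "u \<in> spn Y" "v \<in> spn D" for u v
  proof -
    have "cip v b = 0" if "b \<in> Y" for b
      using spn_perp[OF \<open>v \<in> spn D\<close>, of b] YDc that by blast
    then have "cip b v = 0" if "b \<in> Y" for b using that cip_cnj[of b v] by simp
    then show ?thesis using spn_perp[OF \<open>u \<in> spn Y\<close>, of v] by blast
  qed
  have in_D: "w \<in> spn D" if "w \<in> K" "\<And>b. b \<in> Y \<Longrightarrow> cip b w = 0" for w
  proof -
    have "w = proj (Y \<union> D) w" using that(1) spnD B(3) YD by metis
    also have "\<dots> = proj Y w + proj D w"
      unfolding proj_def using YD ons_finite[OF oY] ons_finite[OF oD(1)] by (intro sum.union_disjoint) auto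
    also have "proj Y w = 0" using that(2) by (intro proj_perp0)
    finally show ?thesis by (simp add: spn_def)
  qed
  \<comment> \<open>A nonzero vector of \<open>spn Y\<close> orthogonal to \<open>QQ\<close> would
    be orthogonal to \<open>PP\<close> too, hence lie in \<open>W = spn Z\<close>, to which
    \<open>Y\<close> is orthogonal.\<close>
  have cardY: "card Y \<le> card L * card Q"
  proof (rule ccontr)
    assume "\<not> card Y \<le> card L * card Q"
    then have "card QQ < card Y" using cQQ by simp
    then obtain w where w: "w \<in> spn Y" "w \<noteq> 0" "\<forall>q\<in>QQ. cip q w = 0"
      using ons_exists_perp[OF oY fQQ] by blast
    have d: "cip q w = 0" if "q \<in> D" for q
      using spnYD[OF w(1) in_spn[OF oD(1) that]] cip_cnj[of q w] by simp
    then have "w \<in> W" using w spnYK by (auto simp: W_def D_def)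
    then have "w \<in> spn Z" using Z by simp
    moreover have "proj Z w = 0" using d by (intro proj_perp0) (auto simp: D_def)
    ultimately show False using w(2) by (simp add: spn_def)
  qed

  \<comment> \<open>The diagonal entries: \<open>t j * y c\<close> on the target of
    \<open>(j, c)\<close> and 0 on \<open>Z\<close>. The sets \<open>PE x\<close> turn out to be
    disjoint, so at most one summand survives.\<close>
  define p where "p i b = (\<Sum>x\<in>I. if b \<in> PE x then t (fst x) * y (snd x) i else 0)" for i b
  define C where "C i = diagop D (p i)" for i
  have Clin: "clin (C i)" for i by (simp add: C_def clin_diagop)
  have fD: "finite D" using ons_finite[OF oD(1)] .
  have PEdisj: "PE x \<inter> PE x' = {}" if "x \<in> I" "x' \<in> I" "x \<noteq> x'" for x x'
  proof -
    have nz: "b \<noteq> 0" if "b \<in> P (fst x) (snd x)" for b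
      using ons_norm[OF P(1), of "fst x" "snd x" b] that \<open>x \<in> I\<close> by (auto simp: I_def)
    have "h x \<noteq> h x'" using inj_onD[OF h(2) _ that(1,2)] that(3) by blast
    show ?thesis
    proof (intro equals0I)
      fix z assume "z \<in> PE x \<inter> PE x'"
      then obtain b c where "b \<in> P (fst x) (snd x)" "emb (h x) b = emb (h x') c"
        unfolding PE_def by auto
      then show False using emb_inj[of "h x" b "h x'" c] nz[of b] \<open>h x \<noteq> h x'\<close> by auto
    qed
  qed
  have pPE: "p i b = t (fst x) * y (snd x) i" if "x \<in> I" "b \<in> PE x" for i x b
  proof -
    have "b \<in> PE x' \<longleftrightarrow> x' = x" if "x' \<in> I" for x'
      using PEdisj[of x' x] that \<open>x \<in> I\<close> \<open>b \<in> PE x\<close> by blast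
    then have "p i b = (\<Sum>x'\<in>I. if x' = x then t (fst x) * y (snd x) i else 0)"
      unfolding p_def by (intro sum.cong refl) simp
    then show ?thesis using that fI by simp
  qed
  have pZ: "p i b = 0" if "b \<in> Z" for i b
    unfolding p_def using that oD(2) by (intro sum.neutral) (auto simp: PP_def)
  have Cemb: "C i (emb (h x) f) = csc (of_real (t (fst x) * y (snd x) i)) (emb (h x) f)"
    if x: "x \<in> I" and f: "f \<in> spn (P (fst x) (snd x))" for i x f
  proof -
    have sub: "PE x \<subseteq> D" using x by (auto simp: D_def PP_def)
    have exp: "emb (h x) f = (\<Sum>b\<in>PE x. csc (cip b (emb (h x) f)) b)"
    proof -
      have "(\<Sum>b\<in>PE x. csc (cip b (emb (h x) f)) b) =
          (\<Sum>b\<in>P (fst x) (snd x). csc (cip b f) (emb (h x) b))"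
        unfolding PE_def
        by (subst sum.reindex) (auto simp: inj_on_def cip_emb slice_emb)
      also have "\<dots> = emb (h x) (proj (P (fst x) (snd x)) f)"
        by (simp add: proj_def emb_lin)
      finally show ?thesis using spnD[OF f] by simp
    qed
    have "cip b (emb (h x) f) = 0" if "b \<in> D - PE x" for b
    proof -
      have "cip b c = 0" if "c \<in> PE x" for c using onsD[OF oD(1), of b c] that \<open>b \<in> D - PE x\<close> sub by auto
      then show ?thesis by (subst exp) (simp add: cip_sum_right)
    qed
    then have "C i (emb (h x) f) = (\<Sum>b\<in>PE x. csc (of_real (p i b) * cip b (emb (h x) f)) b)"
      unfolding C_def diagop_def using fD sub by (intro sum.mono_neutral_right) auto
    also have "\<dots> = (\<Sum>b\<in>PE x. csc (of_real (t (fst x) * y (snd x) i)) (csc (cip b (emb (h x) f)) b))"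
      using pPE[OF x] by (intro sum.cong refl) simp
    also have "\<dots> = csc (of_real (t (fst x) * y (snd x) i)) (emb (h x) f)"
      by (simp only: csc_sum_right[symmetric] exp[symmetric])
    finally show ?thesis .
  qed
  have CD: "C i v \<in> spn D" for i v
    unfolding C_def diagop_def by (rule comb_in_spn[OF oD(1)])
  have XD: "norm (XX i w - C i w) \<le> 2 * e * norm w" if i: "i < m" and w: "w \<in> spn D" for i w
  proof -
    define z where "z = proj Z w"
    define f where "f x = proj (P (fst x) (snd x)) (slice (h x) w)" for x
    define u where "u = (\<Sum>x\<in>I. emb (h x) (f x))"
    have fx: "f x \<in> spn (P (fst x) (snd x))" if "x \<in> I" for x
      unfolding f_def using that P(1) by (intro proj_spn) (auto simp: I_def)
    have "proj PP w = (\<Sum>x\<in>I. \<Sum>b\<in>PE x. csc (cip b w) b)"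
      unfolding proj_def PP_def
    proof (rule sum.UNION_disjoint)
      show "\<forall>x\<in>I. finite (PE x)" using ons_finite[OF P(1)] by (auto simp: PE_def I_def)
    qed (use fI PEdisj in auto)
    also have "\<dots> = u"
      unfolding u_def
    proof (rule sum.cong[OF refl])
      fix x assume "x \<in> I"
      have "(\<Sum>b\<in>PE x. csc (cip b w) b) = (\<Sum>b\<in>P (fst x) (snd x). csc (cip b (slice (h x) w)) (emb (h x) b))"
        unfolding PE_def
        by (subst sum.reindex) (auto simp: inj_on_def cip_emb)
      then show "(\<Sum>b\<in>PE x. csc (cip b w) b) = emb (h x) (f x)"
        by (simp add: f_def proj_def emb_lin)
    qed
    finally have u: "proj PP w = u" .
    have wzu: "w = u + z"
    proof -
      have "proj D w = proj PP w + proj Z w"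
        unfolding proj_def D_def using oD(2) ons_finite[OF oPP] ons_finite[OF Z(1)]
        by (intro sum.union_disjoint) auto
      then show ?thesis using spnD[OF w] by (simp add: u z_def)
    qed
    have nu: "norm u \<le> norm w" using norm_proj_le[OF oPP, of w] u by simp
    have nz: "norm z \<le> norm w" unfolding z_def by (rule norm_proj_le[OF Z(1)])
    have zW: "z \<in> W" using proj_spn[OF Z(1)] Z(2) by (auto simp: z_def)
    have Xz: "norm (XX i z) \<le> e * norm z"
      unfolding XX_def
    proof (rule norm_ampl_le[OF L(1) _ e])
      fix l assume l: "l \<in> L"
      have "cip q (slice l z) = 0" if "q \<in> Q" for q
      proof -
        have "cip (emb l q) z = 0" using zW that l by (auto simp: W_def QQ_def copies_def)
        then show ?thesis by (simp add: cip_emb)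
      qed
      then show "norm (X i (slice l z)) \<le> e * norm (slice l z)"
        using Q(2)[OF i] Kslice[of z l] zW l by (auto simp: W_def)
    qed
    have Cz: "C i z = 0"
    proof -
      have "of_real (p i b) * cip b z = 0" if "b \<in> D" for b
        using that pZ[of b i] zW by (auto simp: D_def W_def)
      then have "csc (of_real (p i b) * cip b z) b = 0" if "b \<in> D" for b
        using that by (metis csc_0(1))
      then show ?thesis unfolding C_def diagop_def by (intro sum.neutral) blast
    qed
    have XXemb: "XX i (emb l v) = emb l (X i v)" if "l \<in> L" for l v
    proof -
      have "XX i (emb l v) = (\<Sum>k\<in>L. if k = l then emb l (X i v) else 0)"
        unfolding XX_def ampl_def using clin_0[OF X(1)[OF i]] by (intro sum.cong refl) (auto simp: slice_emb emb_lin)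
      then show ?thesis using that L(1) by simp
    qed
    have "XX i u - C i u = (\<Sum>x\<in>I. emb (h x) (dev (X i) (t (fst x) * y (snd x) i) (f x)))"
    proof -
      have "XX i u - C i u = (\<Sum>x\<in>I. XX i (emb (h x) (f x)) - C i (emb (h x) (f x)))"
        unfolding u_def by (simp add: clin_sum[OF XXlin[OF i]] clin_sum[OF Clin] sum_subtractf)
      also have "\<dots> = (\<Sum>x\<in>I. emb (h x) (dev (X i) (t (fst x) * y (snd x) i) (f x)))"
      proof (rule sum.cong[OF refl])
        fix x assume x: "x \<in> I"
        then have "h x \<in> L" using h by auto
        then show "XX i (emb (h x) (f x)) - C i (emb (h x) (f x)) =
            emb (h x) (dev (X i) (t (fst x) * y (snd x) i) (f x))"
          by (simp only: XXemb Cemb[OF x fx[OF x]] dev_def emb_lin)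
      qed
      finally show ?thesis .
    qed
    then have "(norm (XX i u - C i u))\<^sup>2 = (\<Sum>x\<in>I. (norm (dev (X i) (t (fst x) * y (snd x) i) (f x)))\<^sup>2)"
      using norm_sum_emb[OF fI h(2)] by simp
    also have "\<dots> \<le> (\<Sum>x\<in>I. (e * norm (f x))\<^sup>2)"
      using P(3)[OF _ _ _ i] fx by (intro sum_mono power_mono) (auto simp: I_def)
    also have "\<dots> = e\<^sup>2 * (\<Sum>x\<in>I. (norm (f x))\<^sup>2)" by (simp add: power_mult_distrib sum_distrib_left)
    also have "\<dots> = (e * norm u)\<^sup>2"
      using norm_sum_emb[OF fI h(2), of f] by (simp add: u_def power_mult_distrib)
    finally have Xu: "norm (XX i u - C i u) \<le> e * norm u" by (rule power2_le_imp_le) (use e in simp)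
    have "XX i w - C i w = (XX i u - C i u) + XX i z"
      by (simp add: wzu clin_add[OF XXlin[OF i]] clin_add[OF Clin] Cz)
    then have "norm (XX i w - C i w) \<le> e * norm u + e * norm z"
      using norm_triangle_mono[OF Xu Xz] by simp
    also have "\<dots> \<le> e * norm w + e * norm w"
      using e nu nz by (intro add_mono mult_left_mono) auto
    finally show ?thesis by simp
  qed
  \<comment> \<open>The means almost preserve \<open>Y\<close>: the component \<open>?d\<close>
    leaving \<open>Y\<close> lies in \<open>spn D\<close>, and by symmetry it is tested against
    \<open>XX i ?d\<close>, which is close to \<open>C i ?d\<close> in \<open>spn D\<close> and so
    nearly orthogonal to \<open>w\<close>.\<close>
  have XM: "norm (XX i w - proj Y (XX i w)) \<le> 2 * e * norm w" if i: "i < m" and w: "w \<in> spn Y" for i w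
  proof -
    let ?d = "XX i w - proj Y (XX i w)"
    have dD: "?d \<in> spn D"
    proof (rule in_D)
      show "?d \<in> K" using XXK[OF i] w spnYK proj_spn[OF oY] by (intro csub_diff[OF K]) auto
    qed (simp add: cip_proj_in[OF oY])
    have "cip ?d (proj Y (XX i w)) = 0"
      using spnYD[OF proj_spn[OF oY] dD] cip_cnj by (metis complex_cnj_zero)
    then have "cip ?d ?d = cip ?d (XX i w)" by (metis cip_diff_right diff_zero)
    also have "\<dots> = cip (XX i ?d) w" using csymD[OF XXsym[OF i]] by simp
    also have "\<dots> = cip (XX i ?d - C i ?d) w"
      using spnYD[OF w CD] cip_cnj[of "C i ?d" w] by simp
    finally have "cip ?d ?d = cip (XX i ?d - C i ?d) w" .
    then have "complex_of_real ((norm ?d)\<^sup>2) = cip (XX i ?d - C i ?d) w" by (simp only: cip_self)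
    then have "(norm ?d)\<^sup>2 = cmod (cip (XX i ?d - C i ?d) w)"
      by (metis norm_of_real abs_of_nonneg zero_le_power2)
    also have "\<dots> \<le> norm (XX i ?d - C i ?d) * norm w" by (rule cmod_cip_le)
    also have "\<dots> \<le> (2 * e * norm ?d) * norm w" using XD[OF i dD] by (intro mult_right_mono) auto
    finally have "norm ?d * norm ?d \<le> (2 * e * norm w) * norm ?d"
      by (simp add: power2_eq_square mult_ac)
    then show ?thesis by (cases "norm ?d = 0") (use e in \<open>auto simp: mult_le_cancel_right\<close>)
  qed

  have "\<exists>T. ons T \<and> spn T = GG c ` spn Y" if "c \<in> A" for c
  proof (rule onb_exists[OF csub_image[OF GGlin[OF that] csub_spn] ons_finite[OF oE]])
    show "GG c ` spn Y \<subseteq> spn (copies L E)" using GGK[OF that] spnYK by (auto simp: K_def)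
  qed
  then obtain T where T: "\<And>c. c \<in> A \<Longrightarrow> ons (T c)" "\<And>c. c \<in> A \<Longrightarrow> spn (T c) = GG c ` spn Y"
    by metis
  \<comment> \<open>The image of \<open>Y\<close> is spread over all labels but must fit under a
    single one; this is why the sizes required of \<open>P j c\<close> carry the factor
    \<open>card L\<close>.\<close>
  have cardT: "card (T c) \<le> card (P j c)" if j: "1 \<le> j" "j < J" and c: "c \<in> A" for j c
  proof -
    have TT: "T c \<subseteq> GG c ` spn Y" using in_spn[OF T(1)[OF c]] T(2)[OF c] by auto
    consider "card L * card Q \<le> card (P j c)"
      | R where "ons R" "\<forall>v\<in>spn E. G c v \<in> spn R" "card L * card R \<le> card (P j c)"
      using P(4)[OF j c] by blast
    then show ?thesis
    proof cases
      case 1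
      then show ?thesis using card_ons_image_le[OF GGlin[OF c] oY T(1)[OF c] TT] cardY by simp
    next
      case 2
      have "GG c v \<in> spn (copies L R)" if "v \<in> K" for v
        unfolding GG_def using that Kslice 2 by (intro ampl_in_spn L) auto
      then have "T c \<subseteq> spn (copies L R)" using TT spnYK by auto
      then have "card (T c) \<le> card (copies L R)"
        using ons_card_le[OF T(1)[OF c] ons_finite[OF ons_copies[OF 2(1) L(1)]]] by blast
      then show ?thesis using card_copies_le[OF ons_finite[OF 2(1)] L(1)] 2(3) by simp
    qed
  qed
  have "\<exists>f. f ` T c \<subseteq> P j c \<and> inj_on f (T c)" if "1 \<le> j" "j < J" "c \<in> A" for j c
    using card_le_inj[OF ons_finite[OF T(1)[OF that(3)]] ons_finite[OF P(1)[OF that]] cardT[OF that]] .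
  then obtain \<phi> where phi: "\<And>j c. 1 \<le> j \<Longrightarrow> j < J \<Longrightarrow> c \<in> A \<Longrightarrow> \<phi> j c ` T c \<subseteq> P j c"
    "\<And>j c. 1 \<le> j \<Longrightarrow> j < J \<Longrightarrow> c \<in> A \<Longrightarrow> inj_on (\<phi> j c) (T c)" by metis
  \<comment> \<open>An isometry from the image of \<open>Y\<close> under \<open>GG c\<close> into
    the target, obtained by injecting an orthonormal basis into \<open>P j c\<close>.\<close>
  define io where "io j c w = (\<Sum>b\<in>T c. csc (cip b w) (\<phi> j c b))" for j c w
  have iolin: "clin (io j c)" for j c
    by (rule clinI) (simp_all add: io_def csc_add_left sum.distrib csc_sum_right)
  have ioP: "io j c w \<in> spn (P j c)" if "1 \<le> j" "j < J" "c \<in> A" for j c w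
    unfolding io_def using phi(1)[OF that] in_spn[OF P(1)[OF that]]
    by (intro csub_sum csub_csc) auto
  have iocip: "cip (io j c u) (io j c v) = cip u v"
    if jc: "1 \<le> j" "j < J" "c \<in> A" and v: "v \<in> spn (T c)" for j c u v
  proof -
    have ff: "cip (\<phi> j c b) (\<phi> j c b') = (if b = b' then 1 else 0)" if "b \<in> T c" "b' \<in> T c" for b b'
    proof -
      have "\<phi> j c b \<in> P j c" "\<phi> j c b' \<in> P j c" using phi(1)[OF jc] that by auto
      then show ?thesis
        using onsD[OF P(1)[OF jc], of "\<phi> j c b" "\<phi> j c b'"] inj_on_eq_iff[OF phi(2)[OF jc] that]
        by simp
    qed
    have "cip (io j c u) (io j c v) = (\<Sum>b\<in>T c. \<Sum>b'\<in>T c. if b' = b then cnj (cip b' u) * cip b v else 0)"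
      unfolding io_def cip_sum_right cip_sum_left using ff by (intro sum.cong refl) auto
    also have "\<dots> = (\<Sum>b\<in>T c. cnj (cip b u) * cip b v)"
      using ons_finite[OF T(1)[OF jc(3)]] by (intro sum.cong refl) simp
    also have "\<dots> = cip u v" by (rule cip_spn_expand[OF T(1)[OF jc(3)] v, symmetric])
    finally show ?thesis .
  qed
  \<comment> \<open>The dilation by the family \<open>GG\<close>, with each outcome compressed into
    its target. Distinct labels give orthogonal ranges, and the resolution of the identity makes
    every \<open>V j\<close> isometric on \<open>Y\<close>.\<close>
  define V where "V j w = (if j = 0 then w else \<Sum>c\<in>A. emb (h (j, c)) (io j c (GG c w)))" for j w
  have Vlin: "clin (V j)" for j
    by (rule clinI) (simp_all add: V_def emb_lin clin_add[OF iolin] clin_csc[OF iolin]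
      clin_add[OF GGlin] clin_csc[OF GGlin] sum.distrib csc_sum_right)
  have inI: "(j, c) \<in> I" if "1 \<le> j" "j < J" "c \<in> A" for j c using that by (simp add: I_def)
  have embD: "emb (h (j, c)) f \<in> spn D" if "1 \<le> j" "j < J" "c \<in> A" "f \<in> spn (P j c)" for j c f
  proof -
    have "f = (\<Sum>b\<in>P j c. csc (cip b f) b)" using spnD[OF that(4)] by (simp add: proj_def)
    then have "emb (h (j, c)) f = emb (h (j, c)) (\<Sum>b\<in>P j c. csc (cip b f) b)" by (rule arg_cong)
    then have "emb (h (j, c)) f = (\<Sum>b\<in>P j c. csc (cip b f) (emb (h (j, c)) b))"
      by (simp only: emb_lin)
    moreover have "emb (h (j, c)) b \<in> spn D" if "b \<in> P j c" for b
    proof -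
      have "emb (h (j, c)) b \<in> PE (j, c)" using that by (simp add: PE_def)
      then have "emb (h (j, c)) b \<in> PP"
        unfolding PP_def using inI[OF \<open>1 \<le> j\<close> \<open>j < J\<close> \<open>c \<in> A\<close>] by blast
      then show ?thesis by (intro in_spn[OF oD(1)]) (simp add: D_def)
    qed
    ultimately show ?thesis by (auto intro!: csub_sum csub_csc)
  qed
  have VD: "V j w \<in> spn D" if "1 \<le> j" "j < J" for j w
    using that ioP embD by (auto simp: V_def intro!: csub_sum)
  have Vcip: "cip (V j u) (V k v) = (if j = k then cip u v else 0)"
    if jk: "j < J" "k < J" and u: "u \<in> spn Y" and v: "v \<in> spn Y" for j k u v
  proof (cases "j = 0 \<or> k = 0")
    case True
    show ?thesis
    proof (cases "j = k")
      case True
      then show ?thesis using \<open>j = 0 \<or> k = 0\<close> by (simp add: V_def)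
    next
      case False
      then consider "j = 0" "1 \<le> k" | "k = 0" "1 \<le> j" using True by linarith
      then show ?thesis
      proof cases
        case 1
        then show ?thesis using spnYD[OF u VD[OF 1(2) jk(2)]] False by (simp add: V_def)
      next
        case 2
        then have "cip (V k v) (V j u) = 0" using spnYD[OF v VD[OF 2(2) jk(1)]] by (simp add: V_def)
        then show ?thesis using cip_cnj[of "V j u" "V k v"] False by simp
      qed
    qed
  next
    case False
    then have j: "1 \<le> j" and k: "1 \<le> k" by auto
    have "cip (V j u) (V k v) =
        (\<Sum>d\<in>A. \<Sum>c\<in>A. if c = d then (if j = k then cip (io j c (GG c u)) (io k d (GG d v)) else 0) else 0)"
      using j k hinj[OF j jk(1) _ k jk(2)]
      by (auto simp: V_def cip_sum_left cip_sum_right cip_emb_emb intro!: sum.cong)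
    also have "\<dots> = (\<Sum>c\<in>A. if j = k then cip (io j c (GG c u)) (io j c (GG c v)) else 0)"
      using G(1) by (intro sum.cong refl) simp
    also have "\<dots> = (if j = k then \<Sum>c\<in>A. cip (GG c u) (GG c v) else 0)"
      using iocip[OF j jk(1)] T(2) v by (auto intro!: sum.cong)
    also have "\<dots> = (if j = k then cip u v else 0)" using GGcip u v spnYK by auto
    finally show ?thesis .
  qed
  have Vnorm: "norm (V j w) = norm w" if "j < J" "w \<in> spn Y" for j w
    using Vcip[OF that(1) that(1) that(2) that(2)]
    by (intro power2_eq_imp_eq[OF _ norm_ge_zero norm_ge_zero]) (simp add: norm_sq_cip)
  have Vsum: "(\<Sum>b\<in>Y. csc (cip b w) (V j b)) = V j (proj Y w)" for j w
    by (simp add: proj_def clin_sum[OF Vlin] clin_csc[OF Vlin])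
  have e5: "2 * e * norm w \<le> 5 * e * norm w" for w :: "('a \<times> 'l) fvec"
    using e by (intro mult_right_mono) auto
  \<comment> \<open>Of the five errors \<open>e\<close>, two come from replacing \<open>XX i\<close>
    by \<open>C i\<close> on the image, one from the family \<open>GG\<close>, and two from
    projecting \<open>XX i w\<close> back to \<open>Y\<close>.\<close>
  have XV: "norm (XX i (\<Sum>b\<in>Y. csc (cip b w) (V j b)) -
      csc (of_real (t j)) (\<Sum>b\<in>Y. csc (cip b (XX i w)) (V j b))) \<le> 5 * e * norm w"
    if i: "i < m" and j: "j < J" and w: "w \<in> spn Y" for i j w
  proof (cases "j = 0")
    case True
    have "norm (XX i w - proj Y (XX i w)) \<le> 5 * e * norm w"
      using XM[OF i w] e5[of w] by linarith
    then show ?thesis using True spnD[OF w] t(3) by (simp add: Vsum) (simp add: V_def)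
  next
    case False
    then have j1: "1 \<le> j" by simp
    define u where "u = proj Y (XX i w)"
    have wK: "w \<in> K" and uK: "u \<in> K" using w spnYK proj_spn[OF oY] by (auto simp: u_def)
    have uY: "u \<in> spn Y" by (simp add: u_def proj_spn[OF oY])
    have e1: "norm (XX i (V j w) - C i (V j w)) \<le> 2 * e * norm w"
      using XD[OF i VD[OF j1 j], of w] Vnorm[OF j w] by simp
    have "C i (V j w) - csc (of_real (t j)) (V j u) =
        csc (of_real (t j)) (\<Sum>c\<in>A. emb (h (j, c)) (io j c (csc (of_real (y c i)) (GG c w) - GG c u)))"
    proof -
      have "C i (V j w) = (\<Sum>c\<in>A. csc (of_real (t j * y c i)) (emb (h (j, c)) (io j c (GG c w))))"
        using False Cemb[OF inI[OF j1 j]] ioP[OF j1 j]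
        by (auto simp: V_def clin_sum[OF Clin] intro!: sum.cong)
      then show ?thesis using False
        by (simp add: V_def csc_sum_right clin_diff[OF iolin] clin_csc[OF iolin] emb_lin csc_diff_right
            sum_subtractf)
    qed
    then have "norm (C i (V j w) - csc (of_real (t j)) (V j u)) \<le>
        norm (\<Sum>c\<in>A. emb (h (j, c)) (io j c (csc (of_real (y c i)) (GG c w) - GG c u)))"
      using t(6)[OF j] by (simp add: mult_left_le_one_le)
    also have "\<dots> = L2_set (\<lambda>c. norm (csc (of_real (y c i)) (GG c w) - GG c u)) A"
    proof -
      have "(norm (\<Sum>c\<in>A. emb (h (j, c)) (io j c (csc (of_real (y c i)) (GG c w) - GG c u))))\<^sup>2
          = (\<Sum>c\<in>A. (norm (io j c (csc (of_real (y c i)) (GG c w) - GG c u)))\<^sup>2)"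
        using hinj[OF j1 j _ j1 j] by (intro norm_sum_emb G) (auto simp: inj_on_def)
      also have "\<dots> = (\<Sum>c\<in>A. (norm (csc (of_real (y c i)) (GG c w) - GG c u))\<^sup>2)"
      proof (rule sum.cong[OF refl])
        fix c assume c: "c \<in> A"
        have "csc (of_real (y c i)) (GG c w) - GG c u \<in> spn (T c)"
          using T(2)[OF c] w uY by (intro csub_diff[OF csub_spn] csub_csc[OF csub_spn]) auto
        from iocip[OF j1 j c this]
        show "(norm (io j c (csc (of_real (y c i)) (GG c w) - GG c u)))\<^sup>2 =
            (norm (csc (of_real (y c i)) (GG c w) - GG c u))\<^sup>2" by (simp only: norm_sq_cip)
      qed
      finally show ?thesis by (simp add: L2_set_def real_sqrt_unique)
    qed
    also have "\<dots> \<le> L2_set (\<lambda>c. norm (csc (of_real (y c i)) (GG c w) - GG c (XX i w)) + norm (GG c (XX i w - u))) A"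
    proof (rule L2_set_mono)
      fix c assume c: "c \<in> A"
      show "norm (csc (of_real (y c i)) (GG c w) - GG c u) \<le>
          norm (csc (of_real (y c i)) (GG c w) - GG c (XX i w)) + norm (GG c (XX i w - u))"
        using norm_triangle_ineq[of "csc (of_real (y c i)) (GG c w) - GG c (XX i w)" "GG c (XX i w - u)"]
        by (simp add: clin_diff[OF GGlin[OF c]])
    qed simp
    also have "\<dots> \<le> L2_set (\<lambda>c. norm (csc (of_real (y c i)) (GG c w) - GG c (XX i w))) A
        + L2_set (\<lambda>c. norm (GG c (XX i w - u))) A"
      by (rule L2_set_triangle_ineq)
    also have "\<dots> \<le> e * norm w + 2 * e * norm w"
    proof (rule add_mono)
      show "L2_set (\<lambda>c. norm (csc (of_real (y c i)) (GG c w) - GG c (XX i w))) A \<le> e * norm w"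
        unfolding L2_set_def using GGerr[OF i wK] e
        by (intro real_le_lsqrt) (auto simp: power_mult_distrib sum_nonneg)
      have "XX i w - u \<in> K" using XXK[OF i wK] uK by (rule csub_diff[OF K])
      then have "L2_set (\<lambda>c. norm (GG c (XX i w - u))) A = norm (XX i w - u)"
        unfolding L2_set_def by (simp add: GGsq)
      then show "L2_set (\<lambda>c. norm (GG c (XX i w - u))) A \<le> 2 * e * norm w"
        using XM[OF i w] by (simp add: u_def)
    qed
    finally have e2: "norm (C i (V j w) - csc (of_real (t j)) (V j u)) \<le> 3 * e * norm w" by simp
    have "norm (XX i (V j w) - csc (of_real (t j)) (V j u)) \<le> 2 * e * norm w + 3 * e * norm w"
      using norm_triangle_mono[OF e1 e2] by simp
    then show ?thesis using spnD[OF w] by (simp add: Vsum u_def)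
  qed
  have "\<exists>F q. ons F \<and> F \<subseteq> spn (Y \<union> D) \<and> (\<forall>i<m. \<forall>v\<in>spn (Y \<union> D). norm (XX i v - diagop F (q i) v)
      \<le> ((3 * (5 * e) + \<delta>) * sqrt J + (2 * real J + 1) * (5 * e)) * norm v)"
  proof (rule swindle[where V = V and t = t and p = p and J = J and e = "5 * e"])
    show "ons (Y \<union> D)" "Y \<inter> D = {}" using YD B by auto
    show "XX i v \<in> spn (Y \<union> D)" if "i < m" "v \<in> spn (Y \<union> D)" for i v
      using XXK that YD B by auto
    show "V 0 b = b" for b by (simp add: V_def)
    show "V j b \<in> spn (Y \<union> D)" if "j < J" "b \<in> Y" for j b
    proof (cases "j = 0")
      case True
      then show ?thesis using that in_spn[OF B(1)] YD by (auto simp: V_def)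
    next
      case False
      then show ?thesis using VD[of j b] that spnDK YD B by auto
    qed
    show "cip (V j b) (V k c) = (if j = k then cip b c else 0)"
      if "j < J" "k < J" "b \<in> Y" "c \<in> Y" for j k b c
      using Vcip[OF that(1,2)] in_spn[OF oY] that by blast
    show "norm (XX i w - diagop D (p i) w) \<le> 5 * e * norm w" if "i < m" "w \<in> spn D" for i w
      using XD[OF that] e5[of w] unfolding C_def by linarith
    show "norm (XX i (\<Sum>b\<in>Y. csc (cip b w) (V j b)) -
      csc (of_real (t j)) (\<Sum>b\<in>Y. csc (cip b (XX i w)) (V j b))) \<le> 5 * e * norm w"
      if "i < m" "j < J" "w \<in> spn Y" for i j w using XV[OF that] .
  qed (use XXlin XXsym XXn t e in auto)
  then show ?thesis using YD B by (simp add: K_def XX_def mult.assoc[symmetric])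
qed

section \<open>Localising partitions of unity\<close>

definition wds :: "'s set \<Rightarrow> nat \<Rightarrow> 's list set" where
  "wds S n = {xs. length xs = n \<and> set xs \<subseteq> S}"

lemma finite_wds [simp]: "finite S \<Longrightarrow> finite (wds S n)"
  using finite_lists_length_eq[of S n] by (simp add: wds_def conj_commute)

lemma card_wds: "finite S \<Longrightarrow> card (wds S n) = card S ^ n"
  using card_lists_length_eq[of S n] by (simp add: wds_def conj_commute)

lemma wds_0 [simp]: "wds S 0 = {[]}" by (auto simp: wds_def)

lemma wds_Suc: "wds S (Suc n) = (\<lambda>(a, xs). a # xs) ` (S \<times> wds S n)"
  by (auto simp: wds_def length_Suc_conv image_iff)

lemma sum_wds_Suc: "(\<Sum>xs\<in>wds S (Suc n). f xs) = (\<Sum>a\<in>S. \<Sum>xs\<in>wds S n. f (a # xs))"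
proof -
  have "(\<Sum>xs\<in>wds S (Suc n). f xs) = (\<Sum>(a, xs)\<in>S \<times> wds S n. f (a # xs))"
    unfolding wds_Suc by (subst sum.reindex) (auto simp: inj_on_def case_prod_beta)
  then show ?thesis by (simp add: sum.cartesian_product)
qed

text \<open>A bump of half-width \<open>s\<close> around the grid point \<open>s * b\<close>. The
  cosine profile is chosen so that the squares sum to one, which is the normalisation needed for a
  resolution of the identity.\<close>

definition hat :: "real \<Rightarrow> int \<Rightarrow> real \<Rightarrow> real" where
  "hat s b x = cos (pi / 2 * min 1 \<bar>x / s - of_int b\<bar>)"

lemma hat_eq_0: "1 \<le> \<bar>x / s - of_int b\<bar> \<Longrightarrow> hat s b x = 0"
  by (simp add: hat_def min_def)

lemma hat_near: "0 < s \<Longrightarrow> hat s b x \<noteq> 0 \<Longrightarrow> \<bar>x - s * of_int b\<bar> \<le> s"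
proof -
  assume s: "0 < s" and "hat s b x \<noteq> 0"
  then have 1: "\<bar>x / s - of_int b\<bar> \<le> 1" using hat_eq_0[of x s b] by linarith
  have "s * (x / s - of_int b) = x - s * of_int b" using s by (simp add: field_simps)
  then have "\<bar>x - s * of_int b\<bar> = s * \<bar>x / s - of_int b\<bar>"
    using s by (metis abs_mult abs_of_pos)
  also have "\<dots> \<le> s" using 1 s by simp
  finally show ?thesis .
qed

lemma abs_cos_diff_le: "\<bar>cos x - cos y\<bar> \<le> \<bar>x - y\<bar>" for x y :: real
proof -
  have "\<bar>cos x - cos y\<bar> = 2 * (\<bar>sin ((x + y) / 2)\<bar> * \<bar>sin ((y - x) / 2)\<bar>)"
    by (simp add: cos_diff_cos abs_mult)
  also have "\<dots> \<le> 2 * (1 * \<bar>(y - x) / 2\<bar>)"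
    by (intro mult_left_mono mult_mono abs_sin_x_le_abs_x) auto
  finally show ?thesis by simp
qed

text \<open>The slope of the cosine profile is at most \<open>pi / 2\<close>, rounded up to
  2.\<close>

lemma hat_lipschitz:
  assumes "0 < s" shows "\<bar>hat s b x - hat s b y\<bar> \<le> 2 / s * \<bar>x - y\<bar>"
proof -
  let ?f = "\<lambda>x. min 1 \<bar>x / s - of_int b\<bar>"
  have "\<bar>hat s b x - hat s b y\<bar> \<le> \<bar>pi / 2 * ?f x - pi / 2 * ?f y\<bar>"
    unfolding hat_def by (rule abs_cos_diff_le)
  also have "\<dots> = pi / 2 * \<bar>?f x - ?f y\<bar>"
    by (simp only: right_diff_distrib[symmetric] abs_mult) simp
  also have "\<dots> \<le> 2 * \<bar>x / s - y / s\<bar>"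
    using pi_less_4 by (intro mult_mono) (auto simp: min_def)
  also have "\<bar>x / s - y / s\<bar> = \<bar>x - y\<bar> / s"
    using assms by (simp flip: diff_divide_distrib)
  finally show ?thesis by simp
qed

text \<open>Only the two grid points next to \<open>x\<close> contribute, with the cosine and the
  sine of the same angle. If the right one falls off the grid then \<open>x / s\<close> is exactly
  the end point, and the missing bump vanishes there.\<close>

lemma hat_sum_sq:
  assumes s: "0 < s" "1 \<le> s * real k" and x: "\<bar>x\<bar> \<le> 1"
  shows "(\<Sum>b\<in>{-int k..int k}. (hat s b x)\<^sup>2) = 1"
proof -
  define c where "c = \<lfloor>x / s\<rfloor>"
  define \<theta> where "\<theta> = x / s - of_int c"
  have th: "0 \<le> \<theta>" "\<theta> < 1" unfolding \<theta>_def c_def by linarith+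
  have "\<bar>x\<bar> / s \<le> real k" using s x by (simp add: divide_le_eq mult.commute)
  then have xk: "- real k \<le> x / s" "x / s \<le> real k"
    using s by (auto simp: abs_le_iff abs_divide field_simps)
  let ?f = "\<lambda>b. (hat s b x)\<^sup>2"
  have zero: "?f b = 0" if "b \<noteq> c" "b \<noteq> c + 1" for b
  proof -
    have "b \<le> c - 1 \<or> b \<ge> c + 2" using that by linarith
    then have "real_of_int b \<le> real_of_int c - 1 \<or> real_of_int b \<ge> real_of_int c + 2" by linarith
    then have "1 \<le> \<bar>x / s - of_int b\<bar>" using th unfolding \<theta>_def by linarith
    then show ?thesis by (simp add: hat_eq_0)
  qed
  have c1: "- int k \<le> c" unfolding c_def using xk by (simp add: le_floor_iff)
  have c2: "c \<le> int k" unfolding c_def using xk by linarith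
  have c3: "?f (c + 1) = 0" if "c + 1 > int k"
  proof -
    have "c = int k" using that c2 by linarith
    then have "x / s \<le> of_int c" using xk by simp
    then have "1 \<le> \<bar>x / s - of_int (c + 1)\<bar>" by simp
    then show ?thesis by (simp only: hat_eq_0) simp
  qed
  have "(\<Sum>b\<in>{-int k..int k}. ?f b) = (\<Sum>b\<in>{-int k..int k} \<union> {c, c + 1}. ?f b)"
    using c1 c2 c3 by (intro sum.mono_neutral_left) auto
  also have "\<dots> = (\<Sum>b\<in>{c, c + 1}. ?f b)"
    using zero by (intro sum.mono_neutral_right) auto
  also have "\<dots> = (cos (pi / 2 * \<theta>))\<^sup>2 + (cos (pi / 2 * (1 - \<theta>)))\<^sup>2"
  proof -
    have "min 1 \<bar>x / s - of_int c\<bar> = \<theta>" "min 1 \<bar>x / s - of_int (c + 1)\<bar> = 1 - \<theta>"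
      using th by (auto simp: \<theta>_def)
    then have "hat s c x = cos (pi / 2 * \<theta>)" "hat s (c + 1) x = cos (pi / 2 * (1 - \<theta>))"
      unfolding hat_def by (simp_all only:)
    then show ?thesis by simp
  qed
  also have "cos (pi / 2 * (1 - \<theta>)) = sin (pi / 2 * \<theta>)"
    by (simp add: sin_cos_eq right_diff_distrib)
  finally show ?thesis by simp
qed

section \<open>The dilation of an almost commuting tuple\<close>

text \<open>The number of factors already applied selects the operator, so the head of the list
  belongs to the factor applied last.\<close>

primrec kraus :: "(nat \<Rightarrow> int \<Rightarrow> 'a fvec \<Rightarrow> 'a fvec) \<Rightarrow> int list \<Rightarrow> 'a fvec \<Rightarrow> 'a fvec" where
  "kraus H [] v = v"
| "kraus H (b # bs) v = H (length bs) b (kraus H bs v)"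

text \<open>The label of the factor applied last comes first, so \<open>rev bs ! i\<close> belongs to the \<open>i\<close>-th operator.\<close>

definition pt :: "real \<Rightarrow> int list \<Rightarrow> nat \<Rightarrow> real" where
  "pt s bs i = s * of_int (rev bs ! i)"

text \<open>The flag \<open>True\<close> marks the part of a piece that is kept at its grid point, \<open>False\<close> the remainder,
  which is assigned to the origin.\<close>

definition dG :: "(nat \<Rightarrow> int \<Rightarrow> 'a fvec \<Rightarrow> 'a fvec) \<Rightarrow> (int list \<Rightarrow> 'a fvec set) \<Rightarrow> int list \<times> bool
    \<Rightarrow> 'a fvec \<Rightarrow> 'a fvec" where
  "dG H R c v = (if snd c then proj (R (fst c)) (kraus H (fst c) v)
    else kraus H (fst c) v - proj (R (fst c)) (kraus H (fst c) v))"

definition dy :: "real \<Rightarrow> int list \<times> bool \<Rightarrow> nat \<Rightarrow> real" where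
  "dy s c i = (if snd c then pt s (fst c) i else 0)"

lemma L2_set_sq: "(L2_set f A)\<^sup>2 = (\<Sum>x\<in>A. (f x)\<^sup>2)"
  by (simp add: L2_set_def sum_nonneg)

lemma L2_set_leI: "(\<Sum>x\<in>A. (f x)\<^sup>2) \<le> c\<^sup>2 \<Longrightarrow> 0 \<le> c \<Longrightarrow> L2_set f A \<le> c"
  unfolding L2_set_def by (rule real_le_lsqrt) auto

context
  fixes X :: "nat \<Rightarrow> 'a fvec \<Rightarrow> 'a fvec" and E :: "'a fvec set" and m :: nat
    and H :: "nat \<Rightarrow> int \<Rightarrow> 'a fvec \<Rightarrow> 'a fvec" and Z :: "int set" and s \<gamma> :: real
  assumes X: "\<And>i. i < m \<Longrightarrow> clin (X i)" "\<And>i v. i < m \<Longrightarrow> norm (X i v) \<le> norm v"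
    and E: "ons E" "\<And>i v. i < m \<Longrightarrow> v \<in> spn E \<Longrightarrow> X i v \<in> spn E"
    and Z: "finite Z"
    and H: "\<And>k b. k < m \<Longrightarrow> b \<in> Z \<Longrightarrow> clin (H k b)"
      "\<And>k b v. k < m \<Longrightarrow> b \<in> Z \<Longrightarrow> v \<in> spn E \<Longrightarrow> H k b v \<in> spn E"
      "\<And>k u v. k < m \<Longrightarrow> u \<in> spn E \<Longrightarrow> v \<in> spn E \<Longrightarrow> (\<Sum>b\<in>Z. cip (H k b u) (H k b v)) = cip u v"
      "\<And>i k b v. i < m \<Longrightarrow> k < m \<Longrightarrow> b \<in> Z \<Longrightarrow> v \<in> spn E \<Longrightarrow>
        norm (X i (H k b v) - H k b (X i v)) \<le> \<gamma> * norm v"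
      "\<And>k b v. k < m \<Longrightarrow> b \<in> Z \<Longrightarrow> v \<in> spn E \<Longrightarrow>
        norm (dev (X k) (s * of_int b) (H k b v)) \<le> s * norm (H k b v)"
    and s: "0 \<le> s" and \<gamma>: "0 \<le> \<gamma>"
begin

private lemma H_sq: "k < m \<Longrightarrow> v \<in> spn E \<Longrightarrow> (\<Sum>b\<in>Z. (norm (H k b v))\<^sup>2) = (norm v)\<^sup>2"
  using H(3)[of k v v] by (simp add: norm_sq_cip flip: Re_sum)

private lemma H_norm: "k < m \<Longrightarrow> b \<in> Z \<Longrightarrow> v \<in> spn E \<Longrightarrow> norm (H k b v) \<le> norm v"
proof -
  assume *: "k < m" "b \<in> Z" "v \<in> spn E"
  have "(norm (H k b v))\<^sup>2 \<le> (\<Sum>b\<in>Z. (norm (H k b v))\<^sup>2)"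
    using Z *(2) by (intro member_le_sum) auto
  then have "(norm (H k b v))\<^sup>2 \<le> (norm v)\<^sup>2" using H_sq * by simp
  then show ?thesis by (rule power2_le_imp_le) simp
qed

private lemma kraus_clin: "n \<le> m \<Longrightarrow> bs \<in> wds Z n \<Longrightarrow> clin (kraus H bs)"
proof (induction bs arbitrary: n)
  case Nil
  then show ?case by (simp add: clin_def)
next
  case (Cons b bs)
  then obtain n' where n: "n = Suc n'" "length bs = n'" by (cases n) (auto simp: wds_def)
  then have *: "b \<in> Z" "bs \<in> wds Z n'" "n' < m" "n' \<le> m" using Cons.prems by (auto simp: wds_def)
  then have "clin (kraus H bs)" using Cons.IH by blast
  moreover have "clin (H (length bs) b)" using H(1) n Cons.prems * by auto
  ultimately show ?case by (simp add: clin_def)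
qed

private lemma kraus_spn: "n \<le> m \<Longrightarrow> bs \<in> wds Z n \<Longrightarrow> v \<in> spn E \<Longrightarrow> kraus H bs v \<in> spn E"
proof (induction bs arbitrary: n)
  case (Cons b bs)
  then obtain n' where n: "n = Suc n'" "length bs = n'" by (cases n) (auto simp: wds_def)
  then have *: "b \<in> Z" "bs \<in> wds Z n'" "n' < m" "n' \<le> m" using Cons.prems by (auto simp: wds_def)
  then have "kraus H bs v \<in> spn E" using Cons.IH Cons.prems by blast
  then show ?case using n H(2) * by auto
qed simp

private lemma kraus_cip:
  "n \<le> m \<Longrightarrow> u \<in> spn E \<Longrightarrow> v \<in> spn E \<Longrightarrow> (\<Sum>bs\<in>wds Z n. cip (kraus H bs u) (kraus H bs v)) = cip u v"
proof (induction n)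
  case (Suc n)
  have len: "length bs = n" if "bs \<in> wds Z n" for bs using that by (simp add: wds_def)
  have "(\<Sum>bs\<in>wds Z (Suc n). cip (kraus H bs u) (kraus H bs v)) =
      (\<Sum>bs\<in>wds Z n. \<Sum>b\<in>Z. cip (H n b (kraus H bs u)) (H n b (kraus H bs v)))"
    unfolding sum_wds_Suc using len by (subst sum.swap) (auto intro!: sum.cong)
  also have "\<dots> = (\<Sum>bs\<in>wds Z n. cip (kraus H bs u) (kraus H bs v))"
    using H(3) kraus_spn[of n] Suc.prems by (intro sum.cong) auto
  finally show ?case using Suc by simp
qed simp

private lemma kraus_sq: "n \<le> m \<Longrightarrow> v \<in> spn E \<Longrightarrow> (\<Sum>bs\<in>wds Z n. (norm (kraus H bs v))\<^sup>2) = (norm v)\<^sup>2"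
  using kraus_cip[of n v v] by (simp add: norm_sq_cip flip: Re_sum)

private lemma kraus_norm: "n \<le> m \<Longrightarrow> bs \<in> wds Z n \<Longrightarrow> v \<in> spn E \<Longrightarrow> norm (kraus H bs v) \<le> norm v"
proof -
  assume *: "n \<le> m" "bs \<in> wds Z n" "v \<in> spn E"
  have "(norm (kraus H bs v))\<^sup>2 \<le> (\<Sum>bs\<in>wds Z n. (norm (kraus H bs v))\<^sup>2)"
    using Z *(2) by (intro member_le_sum) auto
  then have "(norm (kraus H bs v))\<^sup>2 \<le> (norm v)\<^sup>2" using kraus_sq * by simp
  then show ?thesis by (rule power2_le_imp_le) simp
qed

private lemma kraus_comm:
  "n \<le> m \<Longrightarrow> bs \<in> wds Z n \<Longrightarrow> i < m \<Longrightarrow> v \<in> spn E \<Longrightarrow>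
    norm (X i (kraus H bs v) - kraus H bs (X i v)) \<le> real n * \<gamma> * norm v"
proof (induction bs arbitrary: n)
  case Nil
  then show ?case using \<gamma> by simp
next
  case (Cons b bs)
  then obtain n' where n: "n = Suc n'" "length bs = n'" by (cases n) (auto simp: wds_def)
  then have *: "b \<in> Z" "bs \<in> wds Z n'" "n' < m" "n' \<le> m" using Cons.prems by (auto simp: wds_def)
  let ?w = "kraus H bs v" and ?w' = "kraus H bs (X i v)"
  have wE: "?w \<in> spn E" and w'E: "?w' \<in> spn E" using kraus_spn[OF *(4,2)] Cons.prems E(2) by auto
  have d: "X i ?w - ?w' \<in> spn E" using wE w'E E(2) Cons.prems by (intro csub_diff[OF csub_spn]) auto
  have "norm (X i (H n' b ?w) - H n' b (X i ?w)) \<le> \<gamma> * norm ?w"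
    using H(4) * wE Cons.prems by auto
  also have "\<dots> \<le> \<gamma> * norm v" using kraus_norm[OF *(4,2)] Cons.prems \<gamma> by (intro mult_left_mono) auto
  finally have 1: "norm (X i (H n' b ?w) - H n' b (X i ?w)) \<le> \<gamma> * norm v" .
  have "norm (H n' b (X i ?w - ?w')) \<le> norm (X i ?w - ?w')" using H_norm * d by auto
  also have "\<dots> \<le> real n' * \<gamma> * norm v" using Cons.IH[OF *(4,2)] Cons.prems by auto
  finally have 2: "norm (H n' b (X i ?w - ?w')) \<le> real n' * \<gamma> * norm v" .
  have "X i (kraus H (b # bs) v) - kraus H (b # bs) (X i v) =
      (X i (H n' b ?w) - H n' b (X i ?w)) + H n' b (X i ?w - ?w')"
    using n * by (simp add: clin_diff[OF H(1)])
  then have "norm (X i (kraus H (b # bs) v) - kraus H (b # bs) (X i v)) \<le> \<gamma> * norm v + real n' * \<gamma> * norm v"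
    using norm_triangle_mono[OF 1 2] by simp
  then show ?case by (simp add: n algebra_simps)
qed

text \<open>The factor belonging to \<open>X i\<close> localises it with error \<open>s\<close>;
  each later factor disturbs this only through a commutator. Errors are collected in the square-sum
  norm over all labels, so the localisation error is not multiplied by the number of labels, while a
  commutator costs \<open>\<gamma> * sqrt (card Z)\<close>.\<close>

private lemma kraus_local:
  "n \<le> m \<Longrightarrow> i < n \<Longrightarrow> v \<in> spn E \<Longrightarrow>
    L2_set (\<lambda>bs. norm (dev (X i) (pt s bs i) (kraus H bs v))) (wds Z n)
      \<le> (s + real n * \<gamma> * sqrt (card Z)) * norm v"
proof (induction n)
  case (Suc n)
  have n: "n < m" "n \<le> m" using Suc.prems by auto
  have len: "length bs = n" if "bs \<in> wds Z n" for bs using that by (simp add: wds_def)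
  show ?case
  proof (cases "i = n")
    case True
    have "(\<Sum>bs\<in>wds Z (Suc n). (norm (dev (X i) (pt s bs i) (kraus H bs v)))\<^sup>2)
      \<le> (\<Sum>bs\<in>wds Z n. \<Sum>b\<in>Z. (s * norm (H n b (kraus H bs v)))\<^sup>2)"
      unfolding sum_wds_Suc
    proof (subst sum.swap, intro sum_mono power_mono norm_ge_zero)
      fix bs b assume bs: "bs \<in> wds Z n" and b: "b \<in> Z"
      have "pt s (b # bs) i = s * of_int b" using len[OF bs] True by (simp add: pt_def nth_append)
      then show "norm (dev (X i) (pt s (b # bs) i) (kraus H (b # bs) v)) \<le> s * norm (H n b (kraus H bs v))"
        using H(5)[OF n(1) b kraus_spn[OF n(2) bs Suc.prems(3)]] len[OF bs] True by simp
    qed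
    also have "\<dots> = (\<Sum>bs\<in>wds Z n. s\<^sup>2 * (norm (kraus H bs v))\<^sup>2)"
      using H_sq[OF n(1) kraus_spn[OF n(2) _ Suc.prems(3)]]
      by (intro sum.cong refl) (simp add: power_mult_distrib flip: sum_distrib_left)
    also have "\<dots> = (s * norm v)\<^sup>2"
      using kraus_sq[OF n(2) Suc.prems(3)] by (simp add: power_mult_distrib flip: sum_distrib_left)
    finally have "L2_set (\<lambda>bs. norm (dev (X i) (pt s bs i) (kraus H bs v))) (wds Z (Suc n)) \<le> s * norm v"
      by (rule L2_set_leI) (use s in simp)
    also have "\<dots> \<le> (s + real (Suc n) * \<gamma> * sqrt (card Z)) * norm v"
      using \<gamma> by (intro mult_right_mono) auto
    finally show ?thesis .
  next
    case False
    then have i: "i < n" "i < m" using Suc.prems n by auto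
    define f where "f = (\<lambda>bs. norm (dev (X i) (pt s bs i) (kraus H bs v)))"
    define a where "a = (\<lambda>x. norm (H n (fst x) (dev (X i) (pt s (snd x) i) (kraus H (snd x) v))))"
    define c where "c = (\<lambda>x. \<gamma> * norm (kraus H (snd (x :: int \<times> int list)) v))"
    have fle: "f (b # bs) \<le> a (b, bs) + c (b, bs)" if b: "b \<in> Z" and bs: "bs \<in> wds Z n" for b bs
    proof -
      let ?w = "kraus H bs v"
      have wE: "?w \<in> spn E" using kraus_spn[OF n(2) bs Suc.prems(3)] .
      have "pt s (b # bs) i = pt s bs i" using i len[OF bs] by (simp add: pt_def nth_append)
      then have "dev (X i) (pt s (b # bs) i) (kraus H (b # bs) v) =
          H n b (dev (X i) (pt s bs i) ?w) + (X i (H n b ?w) - H n b (X i ?w))"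
        using len[OF bs] by (simp add: dev_def clin_diff[OF H(1)[OF n(1) b]] clin_csc[OF H(1)[OF n(1) b]])
      then show ?thesis
        unfolding f_def a_def c_def
        using norm_triangle_mono[OF order_refl H(4)[OF i(2) n(1) b wE]] by simp
    qed
    have "L2_set f (wds Z (Suc n)) = L2_set (\<lambda>x. f (fst x # snd x)) (Z \<times> wds Z n)"
      by (simp add: L2_set_def sum_wds_Suc sum.cartesian_product case_prod_beta)
    also have "\<dots> \<le> L2_set (\<lambda>x. a x + c x) (Z \<times> wds Z n)"
      using fle by (intro L2_set_mono) (auto simp: f_def)
    also have "\<dots> \<le> L2_set a (Z \<times> wds Z n) + L2_set c (Z \<times> wds Z n)"
      by (rule L2_set_triangle_ineq)
    also have "L2_set a (Z \<times> wds Z n) = L2_set f (wds Z n)"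
    proof -
      have "(\<Sum>x\<in>Z \<times> wds Z n. (a x)\<^sup>2) = (\<Sum>bs\<in>wds Z n. \<Sum>b\<in>Z. (a (b, bs))\<^sup>2)"
        by (subst sum.swap) (simp add: sum.cartesian_product)
      also have "\<dots> = (\<Sum>bs\<in>wds Z n. (f bs)\<^sup>2)"
      proof (rule sum.cong[OF refl])
        fix bs assume bs: "bs \<in> wds Z n"
        have "dev (X i) (pt s bs i) (kraus H bs v) \<in> spn E"
          unfolding dev_def using E(2)[OF i(2)] kraus_spn[OF n(2) bs Suc.prems(3)]
          by (intro csub_diff[OF csub_spn] csub_csc[OF csub_spn]) auto
        then show "(\<Sum>b\<in>Z. (a (b, bs))\<^sup>2) = (f bs)\<^sup>2"
          using H_sq[OF n(1)] by (simp add: a_def f_def)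
      qed
      finally show ?thesis by (simp add: L2_set_def)
    qed
    also have "L2_set c (Z \<times> wds Z n) = \<gamma> * sqrt (card Z) * norm v"
    proof -
      have "(\<Sum>x\<in>Z \<times> wds Z n. (c x)\<^sup>2) = (\<Sum>b\<in>Z. \<Sum>bs\<in>wds Z n. \<gamma>\<^sup>2 * (norm (kraus H bs v))\<^sup>2)"
        using sum.cartesian_product[of "\<lambda>b bs. (c (b, bs))\<^sup>2" "wds Z n" Z, symmetric]
        by (simp add: c_def power_mult_distrib case_prod_beta)
      also have "\<dots> = real (card Z) * (\<gamma>\<^sup>2 * (norm v)\<^sup>2)"
        using kraus_sq[OF n(2) Suc.prems(3)] by (simp flip: sum_distrib_left)
      finally show ?thesis using \<gamma> by (simp add: L2_set_def real_sqrt_mult)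
    qed
    also have "L2_set f (wds Z n) \<le> (s + real n * \<gamma> * sqrt (card Z)) * norm v"
      using Suc.IH[OF n(2) i(1) Suc.prems(3)] by (simp add: f_def)
    finally show ?thesis by (simp add: f_def algebra_simps)
  qed
qed simp

text \<open>A kept piece is close to its grid point because the whole piece is. A remainder is
  assigned the value 0, so its error is the size of the remainder of \<open>X i v\<close>: outside
  the spectral subspace this is at most the deviations divided by \<open>r\<close>, and where
  nothing is kept the grid point itself is within \<open>r0\<close> of the origin.\<close>

lemma dilation:
  fixes R :: "int list \<Rightarrow> 'a fvec set"
  assumes r: "0 < r" "0 \<le> r0"
    and R: "\<And>bs. bs \<in> wds Z m \<Longrightarrow> ons (R bs)" "\<And>bs. bs \<in> wds Z m \<Longrightarrow> R bs \<subseteq> spn E"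
      "\<And>bs. bs \<in> wds Z m \<Longrightarrow>
        (\<forall>w\<in>spn E. r\<^sup>2 * (norm (w - proj (R bs) w))\<^sup>2 \<le> (\<Sum>i<m. (norm (dev (X i) (pt s bs i) w))\<^sup>2)) \<or>
        (R bs = {} \<and> (\<forall>i<m. \<bar>pt s bs i\<bar> \<le> r0))"
  defines "G \<equiv> dG H R" and "y \<equiv> dy s"
    and "\<omega> \<equiv> s + real m * \<gamma> * sqrt (card Z)"
  shows "\<And>c. c \<in> wds Z m \<times> UNIV \<Longrightarrow> clin (G c)"
    "\<And>c v. c \<in> wds Z m \<times> UNIV \<Longrightarrow> v \<in> spn E \<Longrightarrow> G c v \<in> spn E"
    "\<And>u v. u \<in> spn E \<Longrightarrow> v \<in> spn E \<Longrightarrow> (\<Sum>c\<in>wds Z m \<times> UNIV. cip (G c u) (G c v)) = cip u v"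
    "\<And>i v. i < m \<Longrightarrow> v \<in> spn E \<Longrightarrow>
      (\<Sum>c\<in>wds Z m \<times> UNIV. (norm (csc (of_real (y c i)) (G c v) - G c (X i v)))\<^sup>2)
        \<le> (2 * \<omega> + 2 * (real m * \<gamma> * sqrt (card (wds Z m))) + sqrt m * \<omega> / r + r0)\<^sup>2 * (norm v)\<^sup>2"
proof -
  let ?A = "wds Z m"
  show "clin (G c)" if "c \<in> ?A \<times> UNIV" for c
  proof -
    obtain bs q where c: "c = (bs, q)" "bs \<in> ?A" using \<open>c \<in> ?A \<times> UNIV\<close> by auto
    have "clin (kraus H bs)" using kraus_clin[of m bs] c by simp
    then show ?thesis
      by (intro clinI) (auto simp: G_def dG_def c clin_add clin_csc proj_lin csc_diff_right)
  qed
  show "G c v \<in> spn E" if "c \<in> ?A \<times> UNIV" "v \<in> spn E" for c v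
  proof -
    obtain bs q where c: "c = (bs, q)" "bs \<in> ?A" using \<open>c \<in> ?A \<times> UNIV\<close> by auto
    have "kraus H bs v \<in> spn E" using kraus_spn[of m bs] c that by simp
    then show ?thesis using csub_proj[OF csub_spn R(2)[OF c(2)]] csub_diff[OF csub_spn]
      by (auto simp: G_def dG_def c)
  qed
  have sumA: "(\<Sum>c\<in>?A \<times> UNIV. f c) = (\<Sum>bs\<in>?A. f (bs, True) + f (bs, False))" for f :: "_ \<Rightarrow> 'z::comm_monoid_add"
  proof -
    have "(\<Sum>c\<in>?A \<times> UNIV. f c) = (\<Sum>bs\<in>?A. \<Sum>q\<in>UNIV. f (bs, q))"
      by (simp add: sum.cartesian_product)
    then show ?thesis by (simp add: UNIV_bool add.commute)
  qed
  show "(\<Sum>c\<in>?A \<times> UNIV. cip (G c u) (G c v)) = cip u v" if "u \<in> spn E" "v \<in> spn E" for u v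
  proof -
    have "cip (proj (R bs) a) (proj (R bs) b) + cip (a - proj (R bs) a) (b - proj (R bs) b) = cip a b"
      if "bs \<in> ?A" for bs a b
      using R(1)[OF that] by (simp add: cip_proj proj_proj)
    then have "(\<Sum>c\<in>?A \<times> UNIV. cip (G c u) (G c v)) = (\<Sum>bs\<in>?A. cip (kraus H bs u) (kraus H bs v))"
      unfolding sumA by (intro sum.cong refl) (simp add: G_def dG_def del: cip_diff_left cip_diff_right)
    then show ?thesis using kraus_cip[of m u v] that by simp
  qed
  fix i v assume i: "i < m" and v: "v \<in> spn E"
  define M where "M = real m * \<gamma> * sqrt (card ?A)"
  have om0: "0 \<le> \<omega>" using s \<gamma> by (simp add: \<omega>_def)
  let ?g = "\<lambda>bs. kraus H bs v"
  have Xv: "X i v \<in> spn E" using E(2) i v by auto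
  have loc: "L2_set (\<lambda>bs. norm (dev (X k) (pt s bs k) (kraus H bs w))) ?A \<le> \<omega> * norm w"
    if "k < m" "w \<in> spn E" for k w
    using kraus_local[of m k w] that by (simp add: \<omega>_def)
  have comm: "norm (X i (?g bs) - kraus H bs (X i v)) \<le> real m * \<gamma> * norm v" if "bs \<in> ?A" for bs
    using kraus_comm[of m bs i v] that i v by simp
  have commL: "L2_set (\<lambda>bs. real m * \<gamma> * norm v) ?A = M * norm v"
    using \<gamma> by (simp add: L2_set_constant M_def abs_mult)
  define D where "D = (\<lambda>bs. norm (dev (X i) (pt s bs i) (?g bs)))"
  have DL: "L2_set D ?A \<le> \<omega> * norm v" unfolding D_def using loc[OF i v] .
  have dev0: "norm (csc (of_real (pt s bs i)) (?g bs) - kraus H bs (X i v)) \<le> D bs + real m * \<gamma> * norm v"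
    if "bs \<in> ?A" for bs
  proof -
    have eq: "csc (of_real (pt s bs i)) (?g bs) - kraus H bs (X i v) =
        (X i (?g bs) - kraus H bs (X i v)) - dev (X i) (pt s bs i) (?g bs)"
      by (simp add: dev_def)
    show ?thesis
      unfolding eq D_def
      using norm_triangle_ineq4[of "X i (?g bs) - kraus H bs (X i v)" "dev (X i) (pt s bs i) (?g bs)"]
        comm[OF that] by linarith
  qed
  define t1 where "t1 bs = norm (csc (of_real (y (bs, True) i)) (G (bs, True) v) - G (bs, True) (X i v))" for bs
  define t2 where "t2 bs = norm (csc (of_real (y (bs, False) i)) (G (bs, False) v) - G (bs, False) (X i v))" for bs
  have "L2_set t1 ?A \<le> L2_set (\<lambda>bs. D bs + real m * \<gamma> * norm v) ?A"
  proof (rule L2_set_mono)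
    fix bs assume bs: "bs \<in> ?A"
    have "csc (of_real (y (bs, True) i)) (G (bs, True) v) - G (bs, True) (X i v) =
        proj (R bs) (csc (of_real (pt s bs i)) (?g bs) - kraus H bs (X i v))"
      by (simp add: y_def dy_def G_def dG_def proj_lin)
    then have "t1 bs \<le> norm (csc (of_real (pt s bs i)) (?g bs) - kraus H bs (X i v))"
      using norm_proj_le[OF R(1)[OF bs]] by (simp add: t1_def)
    then show "t1 bs \<le> D bs + real m * \<gamma> * norm v" using dev0[OF bs] by simp
  qed (simp add: t1_def)
  also have "\<dots> \<le> L2_set D ?A + L2_set (\<lambda>bs. real m * \<gamma> * norm v) ?A" by (rule L2_set_triangle_ineq)
  also have "\<dots> \<le> (\<omega> + M) * norm v" using DL commL by (simp add: algebra_simps)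
  finally have T1: "L2_set t1 ?A \<le> (\<omega> + M) * norm v" .

  \<comment> \<open>The total deviation of the piece of \<open>X i v\<close>; dividing it by
    \<open>r\<close> bounds what lies outside \<open>R bs\<close>. The sum over all \<open>m\<close>
    operators accounts for \<open>sqrt m\<close>.\<close>
  define S where "S bs = L2_set (\<lambda>k. norm (dev (X k) (pt s bs k) (kraus H bs (X i v)))) {..<m}" for bs
  have SL: "L2_set (\<lambda>bs. S bs / r) ?A \<le> sqrt m * \<omega> / r * norm v"
  proof (rule L2_set_leI)
    have "(\<Sum>bs\<in>?A. (S bs / r)\<^sup>2) = (\<Sum>k<m. \<Sum>bs\<in>?A. (norm (dev (X k) (pt s bs k) (kraus H bs (X i v))))\<^sup>2) / r\<^sup>2"
      by (simp add: S_def L2_set_sq power_divide sum.swap[of _ "{..<m}"] flip: sum_divide_distrib)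
    also have "\<dots> \<le> (\<Sum>k<m. (\<omega> * norm v)\<^sup>2) / r\<^sup>2"
    proof (intro divide_right_mono sum_mono)
      fix k assume "k \<in> {..<m}"
      then have "L2_set (\<lambda>bs. norm (dev (X k) (pt s bs k) (kraus H bs (X i v)))) ?A \<le> \<omega> * norm (X i v)"
        using loc[OF _ Xv] by simp
      also have "\<dots> \<le> \<omega> * norm v" using X(2)[OF i] om0 by (intro mult_left_mono) auto
      finally have "(L2_set (\<lambda>bs. norm (dev (X k) (pt s bs k) (kraus H bs (X i v)))) ?A)\<^sup>2 \<le> (\<omega> * norm v)\<^sup>2"
        by (intro power_mono) auto
      then show "(\<Sum>bs\<in>?A. (norm (dev (X k) (pt s bs k) (kraus H bs (X i v))))\<^sup>2) \<le> (\<omega> * norm v)\<^sup>2"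
        by (simp add: L2_set_sq)
    qed simp
    also have "\<dots> = (sqrt m * \<omega> / r * norm v)\<^sup>2" by (simp add: power_mult_distrib power_divide)
    finally show "(\<Sum>bs\<in>?A. (S bs / r)\<^sup>2) \<le> (sqrt m * \<omega> / r * norm v)\<^sup>2" .
  qed (use om0 r in simp)
  have "L2_set t2 ?A \<le> L2_set (\<lambda>bs. S bs / r + (D bs + (r0 * norm (?g bs) + real m * \<gamma> * norm v))) ?A"
  proof (rule L2_set_mono)
    fix bs assume bs: "bs \<in> ?A"
    let ?w = "kraus H bs (X i v)"
    have wE: "?w \<in> spn E" using kraus_spn[of m bs] bs Xv by simp
    have t2: "t2 bs = norm (?w - proj (R bs) ?w)"
      by (simp add: t2_def y_def dy_def G_def dG_def norm_minus_commute)
    have S0: "0 \<le> S bs / r" "0 \<le> D bs" "0 \<le> r0 * norm (?g bs)" "0 \<le> real m * \<gamma> * norm v"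
      using r \<gamma> by (auto simp: S_def D_def)
    from R(3)[OF bs]
    show "t2 bs \<le> S bs / r + (D bs + (r0 * norm (?g bs) + real m * \<gamma> * norm v))"
    proof
      assume "\<forall>w\<in>spn E. r\<^sup>2 * (norm (w - proj (R bs) w))\<^sup>2 \<le> (\<Sum>i<m. (norm (dev (X i) (pt s bs i) w))\<^sup>2)"
      then have "(r * t2 bs)\<^sup>2 \<le> (S bs)\<^sup>2"
        using wE by (simp add: t2 S_def L2_set_sq power_mult_distrib)
      then have "r * t2 bs \<le> S bs" by (rule power2_le_imp_le) (simp add: S_def)
      then have "t2 bs \<le> S bs / r" using r by (simp add: field_simps)
      then show ?thesis using S0 by linarith
    next
      assume inn: "R bs = {} \<and> (\<forall>i<m. \<bar>pt s bs i\<bar> \<le> r0)"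
      have "norm (csc (of_real (pt s bs i)) (?g bs)) \<le> r0 * norm (?g bs)"
        using inn i by (simp add: mult_right_mono)
      moreover have "norm ?w \<le> norm (csc (of_real (pt s bs i)) (?g bs))
          + norm (csc (of_real (pt s bs i)) (?g bs) - ?w)"
        using norm_triangle_ineq4[of "csc (of_real (pt s bs i)) (?g bs)" "csc (of_real (pt s bs i)) (?g bs) - ?w"]
        by simp
      moreover have "t2 bs = norm ?w" using inn by (simp add: t2 proj_def)
      ultimately show ?thesis using dev0[OF bs] S0 by linarith
    qed
  qed (simp add: t2_def)
  also have "\<dots> \<le> L2_set (\<lambda>bs. S bs / r) ?A + (L2_set D ?A + (L2_set (\<lambda>bs. r0 * norm (?g bs)) ?A
      + L2_set (\<lambda>bs. real m * \<gamma> * norm v) ?A))"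
    by (intro order_trans[OF L2_set_triangle_ineq] add_left_mono)
      (rule order_refl | intro order_trans[OF L2_set_triangle_ineq] add_left_mono)+
  also have "\<dots> \<le> sqrt m * \<omega> / r * norm v + (\<omega> * norm v + (r0 * norm v + M * norm v))"
  proof (intro add_mono SL DL)
    have "(\<Sum>bs\<in>?A. (r0 * norm (?g bs))\<^sup>2) = (r0 * norm v)\<^sup>2"
      using kraus_sq[of m v] v by (simp add: power_mult_distrib flip: sum_distrib_left)
    then show "L2_set (\<lambda>bs. r0 * norm (?g bs)) ?A \<le> r0 * norm v"
      by (intro L2_set_leI) (use r in auto)
  qed (simp add: commL)
  finally have T2: "L2_set t2 ?A \<le> (sqrt m * \<omega> / r + \<omega> + r0 + M) * norm v" by (simp add: algebra_simps)
  have "(\<Sum>c\<in>?A \<times> UNIV. (norm (csc (of_real (y c i)) (G c v) - G c (X i v)))\<^sup>2)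
      = (L2_set t1 ?A)\<^sup>2 + (L2_set t2 ?A)\<^sup>2"
    unfolding sumA L2_set_sq by (simp add: t1_def t2_def sum.distrib)
  also have "\<dots> \<le> (L2_set t1 ?A + L2_set t2 ?A)\<^sup>2"
    by (simp add: power2_sum)
  also have "\<dots> \<le> ((\<omega> + M) * norm v + (sqrt m * \<omega> / r + \<omega> + r0 + M) * norm v)\<^sup>2"
    using T1 T2 by (intro power_mono add_mono) auto
  also have "\<dots> = (2 * \<omega> + 2 * M + sqrt m * \<omega> / r + r0)\<^sup>2 * (norm v)\<^sup>2"
    by (simp add: algebra_simps flip: power_mult_distrib)
  finally show "(\<Sum>c\<in>?A \<times> UNIV. (norm (csc (of_real (y c i)) (G c v) - G c (X i v)))\<^sup>2)
      \<le> (2 * \<omega> + 2 * (real m * \<gamma> * sqrt (card ?A)) + sqrt m * \<omega> / r + r0)\<^sup>2 * (norm v)\<^sup>2"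
    by (simp add: M_def)
qed

end

section \<open>Matrices and coordinates\<close>

definition mkv :: "'a set \<Rightarrow> ('a \<Rightarrow> complex) \<Rightarrow> 'a fvec" where
  "mkv S f = FVec (\<lambda>a. if a \<in> S then f a else 0)"

definition del :: "'a \<Rightarrow> 'a fvec" where
  "del a = FVec (\<lambda>b. if b = a then 1 else 0)"

definition mop :: "'a set \<Rightarrow> ('a \<Rightarrow> 'a \<Rightarrow> complex) \<Rightarrow> 'a fvec \<Rightarrow> 'a fvec" where
  "mop S M v = mkv S (\<lambda>a. \<Sum>b\<in>S. M a b * coord v b)"

lemma coord_mkv: "finite S \<Longrightarrow> coord (mkv S f) a = (if a \<in> S then f a else 0)"
  unfolding mkv_def by (subst coord_FVec) (auto intro: finite_subset[of _ S])

lemma coord_del: "coord (del a) b = (if b = a then 1 else 0)"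
  unfolding del_def by (subst coord_FVec) (auto intro: finite_subset[of _ "{a}"])

lemma coord_mop: "finite S \<Longrightarrow> coord (mop S M v) a = (if a \<in> S then \<Sum>b\<in>S. M a b * coord v b else 0)"
  by (simp add: mop_def coord_mkv)

lemma cip_del: "cip (del a) v = coord v a"
proof -
  have "cip (del a) v = (\<Sum>b\<in>{a}. cnj (coord (del a) b) * coord v b)"
    by (rule cip_superset) (auto simp: csupp_def coord_del)
  then show ?thesis by (simp add: coord_del)
qed

lemma del_eq_iff [simp]: "del a = del b \<longleftrightarrow> a = b"
  by (metis coord_del zero_neq_one)

lemma ons_del: "finite S \<Longrightarrow> ons (del ` S)"
  unfolding ons_def by (auto simp: cip_del coord_del)

lemma card_del: "card (del ` S) = card S"
  by (intro card_image) (auto simp: inj_on_def)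

lemma proj_del: "finite S \<Longrightarrow> proj (del ` S) v = mkv S (coord v)"
proof (rule fvec_eqI)
  fix a assume S: "finite S"
  have "coord (proj (del ` S) v) a = (\<Sum>b\<in>S. if a = b then coord v b else 0)"
    unfolding proj_def
    by (subst sum.reindex) (auto simp: cip_del coord_del inj_on_def intro!: sum.cong)
  then show "coord (proj (del ` S) v) a = coord (mkv S (coord v)) a"
    using S by (simp add: coord_mkv)
qed

lemma spn_del: "finite S \<Longrightarrow> v \<in> spn (del ` S) \<longleftrightarrow> csupp v \<subseteq> S"
  by (auto simp: spn_def proj_del csupp_def coord_mkv fun_eq_iff coord_inject[symmetric])

lemma cip_coords: "finite S \<Longrightarrow> csupp u \<subseteq> S \<Longrightarrow> cip u v = (\<Sum>a\<in>S. cnj (coord u a) * coord v a)"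
  by (rule cip_superset)

lemma cip_coords_right: "finite S \<Longrightarrow> csupp v \<subseteq> S \<Longrightarrow> cip u v = (\<Sum>a\<in>S. cnj (coord u a) * coord v a)"
  using cip_coords[of S v u] cip_cnj[of u v] by (simp add: mult.commute)

lemma norm_coords: "finite S \<Longrightarrow> csupp v \<subseteq> S \<Longrightarrow> (norm v)\<^sup>2 = (\<Sum>a\<in>S. (cmod (coord v a))\<^sup>2)"
proof -
  assume *: "finite S" "csupp v \<subseteq> S"
  have "Re (cnj z * z) = (cmod z)\<^sup>2" for z by (simp add: cmod_def power2_eq_square)
  then show ?thesis using cip_coords[OF *, of v] by (simp add: norm_sq_cip)
qed

lemma csupp_mkv: "finite S \<Longrightarrow> csupp (mkv S f) \<subseteq> S"
  by (auto simp: csupp_def coord_mkv split: if_splits)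

lemma csupp_mop: "finite S \<Longrightarrow> csupp (mop S M v) \<subseteq> S"
  by (simp add: mop_def csupp_mkv)

lemma clin_mop: "finite S \<Longrightarrow> clin (mop S M)"
  by (rule clinI; rule fvec_eqI) (auto simp: coord_mop sum.distrib algebra_simps sum_distrib_left)

lemma csym_mop:
  assumes "finite S" "\<And>a b. a \<in> S \<Longrightarrow> b \<in> S \<Longrightarrow> M a b = cnj (M b a)"
  shows "csym (mop S M)"
  unfolding csym_def
proof (intro allI)
  fix u v
  have "cip (mop S M u) v = (\<Sum>a\<in>S. \<Sum>b\<in>S. cnj (M a b) * cnj (coord u b) * coord v a)"
    by (simp add: cip_coords[OF assms(1) csupp_mop[OF assms(1)]] coord_mop assms(1) sum_distrib_right)
  also have "\<dots> = (\<Sum>b\<in>S. \<Sum>a\<in>S. cnj (M a b) * cnj (coord u b) * coord v a)"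
    by (rule sum.swap)
  also have "\<dots> = (\<Sum>b\<in>S. \<Sum>a\<in>S. cnj (coord u b) * (M b a * coord v a))"
  proof (intro sum.cong refl)
    fix b a assume "b \<in> S" "a \<in> S"
    then have "M b a = cnj (M a b)" by (intro assms(2))
    then show "cnj (M a b) * cnj (coord u b) * coord v a = cnj (coord u b) * (M b a * coord v a)"
      by simp
  qed
  also have "\<dots> = cip u (mop S M v)"
    by (simp add: cip_coords_right[OF assms(1) csupp_mop[OF assms(1)]] coord_mop assms(1) sum_distrib_left)
  finally show "cip (mop S M u) v = cip u (mop S M v)" .
qed

lemma ons_spn_eq:
  assumes "ons B" "ons E" "B \<subseteq> spn E" "card B = card E"
  shows "spn B = spn E"
proof -
  obtain B' where B': "ons B'" "B \<subseteq> B'" "spn B' = spn E"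
    using onb_extend[OF csub_spn ons_finite[OF assms(2)] order_refl assms(1,3)] by blast
  have "B' \<subseteq> spn E" using in_spn[OF B'(1)] B'(3) by auto
  then have "card B' \<le> card E" using ons_card_le[OF B'(1) ons_finite[OF assms(2)]] by simp
  then have "B = B'" using B'(2) assms(4) card_seteq[OF ons_finite[OF B'(1)]] by simp
  then show ?thesis using B' by simp
qed

lemma card_onb:
  assumes "ons B" "ons E" "spn B = spn E" shows "card B = card E"
proof (rule antisym)
  show "card B \<le> card E" using ons_card_le[OF assms(1) ons_finite[OF assms(2)]] in_spn[OF assms(1)] assms(3) by auto
  show "card E \<le> card B" using ons_card_le[OF assms(2) ons_finite[OF assms(1)]] in_spn[OF assms(2)] assms(3) by auto
qed

text \<open>The columns of \<open>U\<close> are an orthonormal eigenbasis. Orthogonality of the rows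
  is its completeness, read off from the expansion of a standard basis vector.\<close>

lemma matrix_eigenbasis:
  assumes "mat_selfadjoint d A"
  shows "\<exists>U l. (\<forall>a<d. \<forall>b<d. (\<Sum>s<d. cnj (U s a) * U s b) = (if a = b then 1 else 0)) \<and>
    (\<forall>s<d. \<forall>t<d. (\<Sum>a<d. U s a * cnj (U t a)) = (if s = t then 1 else 0)) \<and>
    (\<forall>s<d. \<forall>a<d. (\<Sum>t<d. A s t * U t a) = complex_of_real (l a) * U s a)"
proof -
  let ?S = "{..<d}"
  let ?T = "mop ?S A"
  let ?E = "del ` ?S"
  have oE: "ons ?E" by (simp add: ons_del)
  have "A a b = cnj (A b a)" if "a \<in> ?S" "b \<in> ?S" for a b
    using assms that unfolding mat_selfadjoint_def lessThan_iff by blast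
  then have "csym ?T" by (rule csym_mop[OF finite_lessThan])
  moreover have "?T v \<in> spn ?E" for v by (simp add: spn_del csupp_mop)
  ultimately obtain B ev where B: "ons B" "spn B = spn ?E"
      "\<And>b. b \<in> B \<Longrightarrow> ?T b = csc (complex_of_real (ev b)) b"
    using spectral_theorem[OF clin_mop[OF finite_lessThan] _ csub_spn _ ons_finite[OF oE] order_refl]
    by blast
  have "card B = d" using card_onb[OF B(1) oE B(2)] by (simp add: card_del)
  then obtain u where u: "bij_betw u ?S B"
    using ex_bij_betw_nat_finite[OF ons_finite[OF B(1)]] by (auto simp: atLeast0LessThan)
  define U where "U s a = coord (u a) s" for s a
  have uB: "u a \<in> B" if "a < d" for a using u that by (auto simp: bij_betw_def)
  have usupp: "csupp (u a) \<subseteq> ?S" if "a < d" for a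
    using uB[OF that] in_spn[OF B(1)] B(2) spn_del[of ?S "u a"] by auto
  have uinj: "u a = u b \<longleftrightarrow> a = b" if "a < d" "b < d" for a b
    using u that by (auto simp: bij_betw_def inj_on_def)
  have "(\<Sum>s<d. cnj (U s a) * U s b) = (if a = b then 1 else 0)" if "a < d" "b < d" for a b
    using cip_coords[OF _ usupp[OF that(1)], of "u b"] onsD[OF B(1) uB[OF that(1)] uB[OF that(2)]] uinj[OF that]
    by (simp add: U_def)
  moreover have "(\<Sum>a<d. U s a * cnj (U t a)) = (if s = t then 1 else 0)" if "s < d" "t < d" for s t
  proof -
    have "del t \<in> spn B" using B(2) in_spn[OF oE] that by auto
    then have "del t = (\<Sum>b\<in>B. csc (cip b (del t)) b)" using spnD[of "del t" B] by (simp add: proj_def)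
    also have "\<dots> = (\<Sum>a<d. csc (cip (u a) (del t)) (u a))"
      using sum.reindex_bij_betw[OF u, of "\<lambda>b. csc (cip b (del t)) b"] by simp
    finally have "coord (del t) s = coord (\<Sum>a<d. csc (cip (u a) (del t)) (u a)) s" by simp
    also have "\<dots> = (\<Sum>a<d. cip (u a) (del t) * U s a)" by (simp add: U_def)
    also have "\<dots> = (\<Sum>a<d. U s a * cnj (U t a))"
    proof (rule sum.cong[OF refl])
      fix a
      have "cip (u a) (del t) = cnj (coord (u a) t)" using cip_cnj[of "u a" "del t"] by (simp add: cip_del)
      then show "cip (u a) (del t) * U s a = U s a * cnj (U t a)" by (simp add: U_def)
    qed
    finally show ?thesis by (simp add: coord_del)
  qed
  moreover have "(\<Sum>t<d. A s t * U t a) = complex_of_real (ev (u a)) * U s a" if "s < d" "a < d" for s a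
    using arg_cong[OF B(3)[OF uB[OF that(2)]], of "\<lambda>v. coord v s"] that
    by (simp add: U_def coord_mop)
  ultimately show ?thesis by (intro exI[of _ U] exI[of _ "\<lambda>a. ev (u a)"]) blast
qed

section \<open>Orthonormal bases indexed by a finite set\<close>

locale onb_family =
  fixes I :: "'i set" and e :: "'i \<Rightarrow> 'a fvec" and E :: "'a fvec set"
  assumes finI: "finite I"
    and orth: "\<And>a b. a \<in> I \<Longrightarrow> b \<in> I \<Longrightarrow> cip (e a) (e b) = (if a = b then 1 else 0)"
    and eE: "\<And>a. a \<in> I \<Longrightarrow> e a \<in> spn E"
    and oE: "ons E"
    and cardE: "card E = card I"
begin

lemma inj_e: "inj_on e I"
  using orth by (metis inj_onI zero_neq_one)

lemma ons_e: "ons (e ` I)"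
  unfolding ons_def using finI orth inj_e by (auto simp: inj_on_eq_iff)

lemma spn_e: "spn (e ` I) = spn E"
  using ons_e oE eE cardE card_image[OF inj_e] by (intro ons_spn_eq) auto

lemma expand: "v \<in> spn E \<Longrightarrow> (\<Sum>a\<in>I. csc (cip (e a) v) (e a)) = v"
  using proj_expand[OF spn_e, of v] by (simp add: sum.reindex[OF inj_e])

lemma cip_sum_e: "b \<in> I \<Longrightarrow> cip (e b) (\<Sum>a\<in>I. csc (c a) (e a)) = c b"
proof -
  assume b: "b \<in> I"
  have "cip (e b) (\<Sum>a\<in>I. csc (c a) (e a)) = (\<Sum>a\<in>I. if a = b then c b else 0)"
    unfolding cip_sum_right using b orth by (intro sum.cong) auto
  then show ?thesis using finI b by simp
qed

lemma sum_in_spn: "(\<Sum>a\<in>I. csc (c a) (e a)) \<in> spn E"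
  using eE by (intro csub_sum[OF csub_spn] csub_csc[OF csub_spn])

lemma cip_expand: "v \<in> spn E \<Longrightarrow> cip u v = (\<Sum>a\<in>I. cnj (cip (e a) u) * cip (e a) v)"
proof -
  assume "v \<in> spn E"
  then have "cip u v = cip u (\<Sum>a\<in>I. csc (cip (e a) v) (e a))" by (simp add: expand)
  also have "\<dots> = (\<Sum>a\<in>I. cnj (cip (e a) u) * cip (e a) v)"
    unfolding cip_sum_right by (intro sum.cong refl) (simp, metis cip_cnj mult.commute)
  finally show ?thesis .
qed

lemma norm_expand: "v \<in> spn E \<Longrightarrow> (norm v)\<^sup>2 = (\<Sum>a\<in>I. (cmod (cip (e a) v))\<^sup>2)"
proof -
  assume "v \<in> spn E"
  have "Re (cnj z * z) = (cmod z)\<^sup>2" for z by (simp add: cmod_def power2_eq_square)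
  then show ?thesis using cip_expand[OF \<open>v \<in> spn E\<close>, of v] by (simp add: norm_sq_cip)
qed

text \<open>Functional calculus in coordinates: if \<open>e\<close> is an eigenbasis and
  \<open>h\<close> depends only on the eigenvalue of the basis vector, this is that function of the
  operator.\<close>

definition fop :: "('i \<Rightarrow> real) \<Rightarrow> 'a fvec \<Rightarrow> 'a fvec" where
  "fop h v = (\<Sum>a\<in>I. csc (of_real (h a) * cip (e a) v) (e a))"

lemma clin_fop: "clin (fop h)"
  by (rule clinI) (simp_all add: fop_def csc_add_left sum.distrib csc_sum_right algebra_simps)

lemma fop_spn: "fop h v \<in> spn E" unfolding fop_def by (rule sum_in_spn)

lemma cip_fop: "b \<in> I \<Longrightarrow> cip (e b) (fop h v) = of_real (h b) * cip (e b) v"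
  unfolding fop_def by (rule cip_sum_e)

lemma fop_partition:
  assumes "finite Z" "\<And>a. a \<in> I \<Longrightarrow> (\<Sum>b\<in>Z. (h b a)\<^sup>2) = 1" "v \<in> spn E"
  shows "(\<Sum>b\<in>Z. cip (fop (h b) u) (fop (h b) v)) = cip u v"
proof -
  have "(\<Sum>b\<in>Z. cip (fop (h b) u) (fop (h b) v)) =
      (\<Sum>b\<in>Z. \<Sum>a\<in>I. of_real ((h b a)\<^sup>2) * (cnj (cip (e a) u) * cip (e a) v))"
  proof (rule sum.cong[OF refl])
    fix b
    show "cip (fop (h b) u) (fop (h b) v) =
        (\<Sum>a\<in>I. of_real ((h b a)\<^sup>2) * (cnj (cip (e a) u) * cip (e a) v))"
      by (subst cip_expand[OF fop_spn], intro sum.cong refl)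
        (simp add: cip_fop power2_eq_square mult_ac)
  qed
  also have "\<dots> = (\<Sum>a\<in>I. \<Sum>b\<in>Z. of_real ((h b a)\<^sup>2) * (cnj (cip (e a) u) * cip (e a) v))"
    by (rule sum.swap)
  also have "\<dots> = (\<Sum>a\<in>I. cnj (cip (e a) u) * cip (e a) v)"
  proof (rule sum.cong[OF refl])
    fix a assume "a \<in> I"
    have "(\<Sum>b\<in>Z. of_real ((h b a)\<^sup>2) * (cnj (cip (e a) u) * cip (e a) v)) =
        of_real (\<Sum>b\<in>Z. (h b a)\<^sup>2) * (cnj (cip (e a) u) * cip (e a) v)"
      by (simp only: sum_distrib_right[symmetric] of_real_sum)
    then show "(\<Sum>b\<in>Z. of_real ((h b a)\<^sup>2) * (cnj (cip (e a) u) * cip (e a) v)) = cnj (cip (e a) u) * cip (e a) v"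
      using assms(2)[OF \<open>a \<in> I\<close>] by simp
  qed
  also have "\<dots> = cip u v" by (rule cip_expand[OF assms(3), symmetric])
  finally show ?thesis .
qed

lemma norm_le_coordwise:
  assumes "u \<in> spn E" "v \<in> spn E" "\<And>a. a \<in> I \<Longrightarrow> cmod (cip (e a) u) \<le> c * cmod (cip (e a) v)" "0 \<le> c"
  shows "norm u \<le> c * norm v"
proof -
  have "(norm u)\<^sup>2 \<le> (\<Sum>a\<in>I. (c * cmod (cip (e a) v))\<^sup>2)"
    unfolding norm_expand[OF assms(1)] using assms(3) by (intro sum_mono power_mono) auto
  also have "\<dots> = (c * norm v)\<^sup>2"
    by (simp add: norm_expand[OF assms(2)] power_mult_distrib sum_distrib_left)
  finally show ?thesis by (rule power2_le_imp_le) (use assms(4) in simp)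
qed

text \<open>Cauchy-Schwarz with the modulus of each entry split into two square roots: one half is
  absorbed by the row sums, the other by the column sums.\<close>

lemma schur_test:
  assumes T: "\<And>a. a \<in> I \<Longrightarrow> cip (e a) w = (\<Sum>b\<in>I. M a b * cip (e b) v)" and w: "w \<in> spn E" and v: "v \<in> spn E"
    and row: "\<And>a. a \<in> I \<Longrightarrow> (\<Sum>b\<in>I. cmod (M a b)) \<le> c"
    and col: "\<And>b. b \<in> I \<Longrightarrow> (\<Sum>a\<in>I. cmod (M a b)) \<le> c" and c: "0 \<le> c"
  shows "norm w \<le> c * norm v"
proof -
  let ?x = "\<lambda>b. cmod (cip (e b) v)"
  have "(cmod (cip (e a) w))\<^sup>2 \<le> c * (\<Sum>b\<in>I. cmod (M a b) * (?x b)\<^sup>2)" if a: "a \<in> I" for a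
  proof -
    have "cmod (cip (e a) w) \<le> (\<Sum>b\<in>I. \<bar>sqrt (cmod (M a b))\<bar> * \<bar>sqrt (cmod (M a b)) * ?x b\<bar>)"
      unfolding T[OF a] by (rule order_trans[OF norm_sum]) (simp add: norm_mult abs_mult mult.assoc[symmetric])
    also have "\<dots> \<le> L2_set (\<lambda>b. sqrt (cmod (M a b))) I * L2_set (\<lambda>b. sqrt (cmod (M a b)) * ?x b) I"
      by (rule L2_set_mult_ineq)
    finally have "(cmod (cip (e a) w))\<^sup>2 \<le>
        (L2_set (\<lambda>b. sqrt (cmod (M a b))) I * L2_set (\<lambda>b. sqrt (cmod (M a b)) * ?x b) I)\<^sup>2"
      by (intro power_mono) auto
    also have "\<dots> = (\<Sum>b\<in>I. cmod (M a b)) * (\<Sum>b\<in>I. cmod (M a b) * (?x b)\<^sup>2)"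
      by (simp add: power_mult_distrib L2_set_sq)
    also have "\<dots> \<le> c * (\<Sum>b\<in>I. cmod (M a b) * (?x b)\<^sup>2)"
      using row[OF a] by (intro mult_right_mono sum_nonneg) auto
    finally show ?thesis .
  qed
  then have "(norm w)\<^sup>2 \<le> (\<Sum>a\<in>I. c * (\<Sum>b\<in>I. cmod (M a b) * (?x b)\<^sup>2))"
    unfolding norm_expand[OF w] by (intro sum_mono)
  also have "\<dots> = c * (\<Sum>b\<in>I. (\<Sum>a\<in>I. cmod (M a b)) * (?x b)\<^sup>2)"
    unfolding sum_distrib_left[symmetric] sum_distrib_right by (subst sum.swap) simp
  also have "\<dots> \<le> c * (\<Sum>b\<in>I. c * (?x b)\<^sup>2)"
    using c col by (intro mult_left_mono sum_mono mult_right_mono) auto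
  also have "\<dots> = c\<^sup>2 * (\<Sum>b\<in>I. (?x b)\<^sup>2)"
    by (simp add: power2_eq_square[of c] flip: sum_distrib_left)
  also have "\<dots> = (c * norm v)\<^sup>2" by (simp add: norm_expand[OF v] power_mult_distrib)
  finally show ?thesis by (rule power2_le_imp_le) (use c in simp)
qed

end

section \<open>Words over a finite alphabet\<close>

text \<open>Matrix entry, between two words, of the sum of \<open>A\<close> over all sites: either
  the first letter is acted upon and the rest agree, or the first letters agree and the rest is
  acted upon.\<close>

fun sm :: "(nat \<Rightarrow> nat \<Rightarrow> complex) \<Rightarrow> nat list \<Rightarrow> nat list \<Rightarrow> complex" where
  "sm A (a # xs) (b # ys) = (if xs = ys then A a b else 0) + (if a = b then sm A xs ys else 0)"
| "sm A _ _ = 0"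

text \<open>Standard coordinates of the product vector whose factors are the columns of
  \<open>U\<close> selected by the first word.\<close>

fun pv :: "(nat \<Rightarrow> nat \<Rightarrow> complex) \<Rightarrow> nat list \<Rightarrow> nat list \<Rightarrow> complex" where
  "pv U (a # xs) (s # ys) = U s a * pv U xs ys"
| "pv U [] [] = 1"
| "pv U _ _ = 0"

abbreviation wd :: "nat \<Rightarrow> nat \<Rightarrow> nat list set" where
  "wd d N \<equiv> wds {..<d} N"

lemma card_wd: "card (wd d N) = d ^ N" by (simp add: card_wds)

lemma sm_append:
  "length xs = length ys \<Longrightarrow>
    sm A (xs @ xs') (ys @ ys') = (if xs' = ys' then sm A xs ys else 0) + (if xs = ys then sm A xs' ys' else 0)"
  by (induction xs ys rule: list_induct2) auto

lemma sm_herm: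
  assumes h: "\<And>a b. a < d \<Longrightarrow> b < d \<Longrightarrow> A a b = cnj (A b a)"
  shows "xs \<in> wd d N \<Longrightarrow> ys \<in> wd d N \<Longrightarrow> sm A xs ys = cnj (sm A ys xs)"
proof (induction N arbitrary: xs ys)
  case (Suc N)
  then obtain a x b y where *: "xs = a # x" "ys = b # y" "a < d" "b < d" "x \<in> wd d N" "y \<in> wd d N"
    by (auto simp: wds_Suc)
  have "cnj (A b a) = A a b" using h[OF *(3,4)] by simp
  moreover have "cnj (sm A y x) = sm A x y" using Suc.IH[OF *(5,6)] by simp
  ultimately show ?case by (auto simp: *)
qed simp

lemma pv_orth:
  assumes "\<And>a b. a < d \<Longrightarrow> b < d \<Longrightarrow> (\<Sum>s<d. cnj (U s a) * U s b) = (if a = b then 1 else 0)"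
  shows "al \<in> wd d N \<Longrightarrow> be \<in> wd d N \<Longrightarrow> (\<Sum>x\<in>wd d N. cnj (pv U al x) * pv U be x) = (if al = be then 1 else 0)"
proof (induction N arbitrary: al be)
  case (Suc N)
  then obtain a xs b ys where *: "al = a # xs" "be = b # ys" "a < d" "b < d" "xs \<in> wd d N" "ys \<in> wd d N"
    by (auto simp: wds_Suc)
  have "(\<Sum>x\<in>wd d (Suc N). cnj (pv U al x) * pv U be x) =
      (\<Sum>s<d. \<Sum>x\<in>wd d N. (cnj (U s a) * U s b) * (cnj (pv U xs x) * pv U ys x))"
    unfolding sum_wds_Suc * by (simp add: mult_ac)
  also have "\<dots> = (\<Sum>s<d. cnj (U s a) * U s b) * (\<Sum>x\<in>wd d N. cnj (pv U xs x) * pv U ys x)"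
    by (rule sum_product[symmetric])
  finally show ?case using assms[OF *(3,4)] Suc.IH[OF *(5,6)] * by auto
qed auto

text \<open>The one-site relation \<open>A U = U A'\<close> passes to sums over sites. With
  \<open>A'\<close> diagonal it diagonalises a mean, and otherwise it expresses one mean in the
  eigenbasis of another.\<close>

lemma sm_pv:
  assumes "\<And>s b. s < d \<Longrightarrow> b < d \<Longrightarrow> (\<Sum>t<d. A s t * U t b) = (\<Sum>a<d. U s a * A' a b)"
  shows "x \<in> wd d N \<Longrightarrow> be \<in> wd d N \<Longrightarrow>
    (\<Sum>y\<in>wd d N. sm A x y * pv U be y) = (\<Sum>al\<in>wd d N. pv U al x * sm A' al be)"
proof (induction N arbitrary: x be)
  case (Suc N)
  then obtain s x' b ys where *: "x = s # x'" "be = b # ys" "s < d" "b < d" "x' \<in> wd d N" "ys \<in> wd d N"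
    by (auto simp: wds_Suc)
  have "(\<Sum>y\<in>wd d (Suc N). sm A x y * pv U be y) =
      (\<Sum>t<d. \<Sum>y\<in>wd d N. (if x' = y then A s t * U t b * pv U ys y else 0)
        + (if s = t then U t b * (sm A x' y * pv U ys y) else 0))"
    unfolding sum_wds_Suc * by (intro sum.cong refl) (simp add: algebra_simps)
  also have "\<dots> = (\<Sum>t<d. A s t * U t b) * pv U ys x' + U s b * (\<Sum>y\<in>wd d N. sm A x' y * pv U ys y)"
    using * by (simp add: sum.distrib sum_distrib_right sum_distrib_left if_distrib[of "\<lambda>f. f _"]
        sum.If_cases[of "{..<d}"] flip: sum.If_cases) (subst sum.swap, simp)
  also have "\<dots> = (\<Sum>a<d. U s a * A' a b) * pv U ys x' + U s b * (\<Sum>al\<in>wd d N. pv U al x' * sm A' al ys)"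
    using assms[OF *(3,4)] Suc.IH[OF *(5,6)] by simp
  also have "\<dots> = (\<Sum>a<d. \<Sum>al\<in>wd d N. (if al = ys then U s a * A' a b * pv U al x' else 0)
        + (if a = b then U s a * (pv U al x' * sm A' al ys) else 0))"
    using * by (simp add: sum.distrib sum_distrib_right sum_distrib_left) (subst sum.swap, simp)
  also have "\<dots> = (\<Sum>al\<in>wd d (Suc N). pv U al x * sm A' al be)"
    unfolding sum_wds_Suc * by (intro sum.cong refl) (simp add: algebra_simps)
  finally show ?case .
qed auto

lemma sm_diag: "length xs = length ys \<Longrightarrow>
  sm (\<lambda>a b. if a = b then of_real (l b) else 0) xs ys = (if xs = ys then of_real (sum_list (map l ys)) else 0)"
  by (induction xs ys rule: list_induct2) auto

text \<open>A nonzero entry links words that differ in at most one letter, so at most one summand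
  changes, by at most 2.\<close>

lemma sm_eigendiff:
  fixes l :: "nat \<Rightarrow> real"
  assumes "\<And>a. a < d \<Longrightarrow> \<bar>l a\<bar> \<le> 1"
  shows "xs \<in> wd d N \<Longrightarrow> ys \<in> wd d N \<Longrightarrow> sm A xs ys \<noteq> 0 \<Longrightarrow>
    \<bar>sum_list (map l xs) - sum_list (map l ys)\<bar> \<le> 2"
proof (induction N arbitrary: xs ys)
  case (Suc N)
  then obtain a x b y where *: "xs = a # x" "ys = b # y" "a < d" "b < d" "x \<in> wd d N" "y \<in> wd d N"
    by (auto simp: wds_Suc)
  show ?case
  proof (cases "x = y")
    case True
    then show ?thesis using * assms[OF *(3)] assms[OF *(4)] by (auto simp: abs_le_iff)
  next
    case False
    then have "a = b" "sm A x y \<noteq> 0" using Suc.prems * by (auto split: if_splits)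
    then show ?thesis using Suc.IH[OF *(5,6)] * by simp
  qed
qed auto

lemma sm_row:
  assumes "\<And>a b. a < d \<Longrightarrow> b < d \<Longrightarrow> cmod (A a b) \<le> c" "0 \<le> c"
  shows "xs \<in> wd d N \<Longrightarrow> (\<Sum>ys\<in>wd d N. cmod (sm A xs ys)) \<le> real N * real d * c"
    and "xs \<in> wd d N \<Longrightarrow> (\<Sum>ys\<in>wd d N. cmod (sm A ys xs)) \<le> real N * real d * c"
proof (induction N arbitrary: xs)
  case (Suc N)
  {
    case 1
    then obtain a x where *: "xs = a # x" "a < d" "x \<in> wd d N" by (auto simp: wds_Suc)
    have "(\<Sum>ys\<in>wd d (Suc N). cmod (sm A xs ys)) \<le>
        (\<Sum>b<d. \<Sum>ys\<in>wd d N. (if ys = x then cmod (A a b) else 0) + (if b = a then cmod (sm A x ys) else 0))"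
      unfolding sum_wds_Suc * by (intro sum_mono) (auto intro: norm_triangle_ineq)
    also have "\<dots> = (\<Sum>b<d. cmod (A a b)) + (\<Sum>ys\<in>wd d N. cmod (sm A x ys))"
      using * by (simp add: sum.distrib) (subst sum.swap, simp)
    also have "\<dots> \<le> real d * c + real N * real d * c"
      using Suc(1)[OF *(3)] assms(1)[OF *(2)] sum_bounded_above[of "{..<d}" "\<lambda>b. cmod (A a b)" c] by simp
    finally show ?case by (simp add: algebra_simps)
  next
    case 2
    then obtain a x where *: "xs = a # x" "a < d" "x \<in> wd d N" by (auto simp: wds_Suc)
    have "(\<Sum>ys\<in>wd d (Suc N). cmod (sm A ys xs)) \<le>
        (\<Sum>b<d. \<Sum>ys\<in>wd d N. (if ys = x then cmod (A b a) else 0) + (if b = a then cmod (sm A ys x) else 0))"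
      unfolding sum_wds_Suc * by (intro sum_mono) (auto intro: norm_triangle_ineq)
    also have "\<dots> = (\<Sum>b<d. cmod (A b a)) + (\<Sum>ys\<in>wd d N. cmod (sm A ys x))"
      using * by (simp add: sum.distrib) (subst sum.swap, simp)
    also have "\<dots> \<le> real d * c + real N * real d * c"
      using Suc(2)[OF *(3)] assms(1)[OF _ *(2)] sum_bounded_above[of "{..<d}" "\<lambda>b. cmod (A b a)" c] by simp
    finally show ?case by (simp add: algebra_simps)
  }
qed auto

section \<open>Subadditive sequences\<close>

text \<open>As in Fekete's lemma, \<open>f k / k\<close> approaches its infimum \<open>L\<close>,
  and \<open>c \<le> L\<close>. From \<open>(Q - j) * k\<close> to \<open>Q * k\<close> the sequence
  therefore gains about \<open>j * k * L\<close>, which outgrows every bound, uniformly in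
  \<open>j\<close>.\<close>

lemma subadditive_increment:
  fixes f :: "nat \<Rightarrow> real"
  assumes sub: "\<And>k l. 1 \<le> k \<Longrightarrow> 1 \<le> l \<Longrightarrow> f (k + l) \<le> f k + f l"
    and low: "\<And>k. 1 \<le> k \<Longrightarrow> c * real k - b \<le> f k" and c: "0 < c" and Q: "1 \<le> Q"
  shows "\<exists>k0. \<forall>k\<ge>k0. \<forall>j\<in>{1..<Q}. B \<le> f (Q * k) - f ((Q - j) * k)"
proof -
  have mult: "f (n * k) \<le> real n * f k" if "1 \<le> k" "1 \<le> n" for n k
    using that(2)
  proof (induction n rule: nat_induct_at_least)
    case (Suc n)
    then have "f (Suc n * k) \<le> f k + f (n * k)" using sub[of k "n * k"] that(1) by simp
    then show ?case using Suc by (simp add: algebra_simps)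
  qed simp
  \<comment> \<open>The offset \<open>b\<close> is removed by applying the lower bound to the
    multiples \<open>n * k\<close> and letting \<open>n\<close> grow.\<close>
  have lowc: "c * real k \<le> f k" if k: "1 \<le> k" for k
  proof (rule ccontr)
    assume "\<not> c * real k \<le> f k"
    then have pos: "0 < c * real k - f k" by simp
    obtain n where n: "b < real n * (c * real k - f k)" using reals_Archimedean3[OF pos] by blast
    have "real (Suc n) * (c * real k - f k) \<le> b"
      using mult[OF k, of "Suc n"] low[of "Suc n * k"] k by (simp add: algebra_simps)
    moreover have "real n * (c * real k - f k) \<le> real (Suc n) * (c * real k - f k)"
      using pos by (intro mult_right_mono) auto
    ultimately show False using n by linarith
  qed
  define L where "L = (INF k\<in>{1..}. f k / real k)"
  have bdd: "bdd_below ((\<lambda>k. f k / real k) ` {1..})"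
    by (rule bdd_belowI2[of _ c]) (use lowc in \<open>simp add: field_simps\<close>)
  have Lle: "L * real k \<le> f k" if "1 \<le> k" for k
  proof -
    have "L \<le> f k / real k" unfolding L_def using bdd that by (intro cINF_lower) auto
    then show ?thesis using that by (simp add: field_simps)
  qed
  have cL: "c \<le> L" unfolding L_def
    by (rule cINF_greatest) (use lowc in \<open>auto simp: field_simps\<close>)
  \<comment> \<open>With this choice the loss from approximating \<open>L\<close> is at most a
    quarter of \<open>c * k\<close>.\<close>
  define \<eta> where "\<eta> = c / (2 * real Q)"
  have eta: "0 < \<eta>" using c Q by (simp add: \<eta>_def)
  obtain p where p: "1 \<le> p" "f p / real p < L + \<eta> / 2"
    using cINF_less_iff[OF _ bdd, of "L + \<eta> / 2"] eta by (auto simp: L_def)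
  define C where "C = (\<Sum>s\<in>{1..p}. \<bar>f s\<bar>)"
  have C: "f s \<le> C" if "s \<in> {1..p}" for s
    using member_le_sum[of s "{1..p}" "\<lambda>s. \<bar>f s\<bar>"] that by (auto simp: C_def)
  have C0: "0 \<le> C" by (simp add: C_def sum_nonneg)
  have up: "f k \<le> real k * (L + \<eta> / 2) + C" if k: "1 \<le> k" for k
  proof -
    \<comment> \<open>Dividing \<open>k - 1\<close> instead of \<open>k\<close> puts the remainder
      \<open>s\<close> into \<open>1..p\<close>; subadditivity is assumed at positive arguments
      only.\<close>
    define q where "q = (k - 1) div p"
    define s where "s = (k - 1) mod p + 1"
    have ks: "k = q * p + s" using k by (simp add: q_def s_def)
    have s: "s \<in> {1..p}" using p by (auto simp: s_def Suc_le_eq)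
    have fp: "f p \<le> real p * (L + \<eta> / 2)" using p by (simp add: field_simps)
    show ?thesis
    proof (cases "q = 0")
      case True
      have "0 \<le> real k * (L + \<eta> / 2)" using cL c eta by simp
      then show ?thesis using C[OF s] True ks by simp
    next
      case False
      then have "f k \<le> f (q * p) + f s" using sub[of "q * p" s] p s by (simp add: ks)
      also have "\<dots> \<le> real q * f p + C" using mult[of p q] False p C[OF s] by simp
      also have "\<dots> \<le> real q * (real p * (L + \<eta> / 2)) + C"
        using fp by (intro add_right_mono mult_left_mono) auto
      also have "\<dots> = real (q * p) * (L + \<eta> / 2) + C" by simp
      also have "\<dots> \<le> real k * (L + \<eta> / 2) + C"
        using ks cL c eta by (intro add_right_mono mult_right_mono) auto
      finally show ?thesis .
    qed
  qed
  define k0 where "k0 = nat \<lceil>(2 * (\<bar>B\<bar> + C)) / c\<rceil> + 1"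
  have "B \<le> f (Q * k) - f ((Q - j) * k)" if k: "k0 \<le> k" and j: "j \<in> {1..<Q}" for k j
  proof -
    have k1: "1 \<le> k" using k by (simp add: k0_def)
    have "(2 * (\<bar>B\<bar> + C)) / c \<le> real k0" unfolding k0_def by linarith
    then have "2 * (\<bar>B\<bar> + C) \<le> c * real k0" using c by (simp add: field_simps)
    also have "\<dots> \<le> c * real k" using k c by simp
    finally have kB: "2 * (\<bar>B\<bar> + C) \<le> c * real k" .
    have "1 \<le> (Q - j) * k" using k1 j by (simp add: Suc_le_eq)
    then have "f ((Q - j) * k) \<le> (real Q - real j) * real k * (L + \<eta> / 2) + C"
      using up[of "(Q - j) * k"] j by (simp add: of_nat_diff)
    moreover have "L * real Q * real k \<le> f (Q * k)"
      using Lle[of "Q * k"] k1 Q by (simp add: mult.assoc)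
    ultimately have "f (Q * k) - f ((Q - j) * k) \<ge>
        L * real Q * real k - (real Q - real j) * real k * (L + \<eta> / 2) - C"
      by linarith
    moreover have "L * real Q * real k - (real Q - real j) * real k * (L + \<eta> / 2)
        = real j * (L * real k) - (real Q - real j) * (real k * \<eta> / 2)" by (simp add: field_simps)
    moreover have "real j * (L * real k) \<ge> 1 * (c * real k)"
      using j cL c by (intro mult_mono) auto
    moreover have "(real Q - real j) * (real k * \<eta> / 2) \<le> real Q * (real k * \<eta> / 2)"
      using eta by (intro mult_right_mono) auto
    moreover have "real Q * (real k * \<eta> / 2) = c * real k / 4" using Q by (simp add: \<eta>_def)
    ultimately have "f (Q * k) - f ((Q - j) * k) \<ge> c * real k - c * real k / 4 - C" by linarith
    moreover have "B \<le> D" if "a - a / 4 - C \<le> D" "2 * (\<bar>B\<bar> + C) \<le> a" for a D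
      using that C0 abs_ge_self[of B] abs_ge_zero[of B] by argo
    ultimately show ?thesis using kB by blast
  qed
  then show ?thesis by blast
qed

section \<open>Dimension counts\<close>

text \<open>Extend a basis \<open>B\<close> of the complement to one of \<open>spn E\<close>. If the
  added part had more than \<open>card Q\<close> vectors, its span would contain a nonzero vector
  orthogonal to \<open>Q\<close>, which then belongs to \<open>spn B\<close> as well as being
  orthogonal to it.\<close>

lemma onb_perp:
  assumes "ons E" "finite Q"
  shows "\<exists>B. ons B \<and> B \<subseteq> spn E \<and> (\<forall>b\<in>spn B. \<forall>q\<in>Q. cip q b = 0) \<and> card E \<le> card B + card Q"
proof -
  let ?W = "spn E \<inter> {w. \<forall>q\<in>Q. cip q w = 0}"
  have "csub ?W" by (intro csub_Int csub_perp csub_spn)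
  then obtain B where B: "ons B" "spn B = ?W" using onb_exists[of ?W E] ons_finite[OF assms(1)] by blast
  have BE: "B \<subseteq> spn E" using in_spn[OF B(1)] B(2) by auto
  obtain C where C: "ons C" "B \<subseteq> C" "spn C = spn E"
    using onb_extend[OF csub_spn ons_finite[OF assms(1)] order_refl B(1) BE] by blast
  have oY: "ons (C - B)" using ons_subset[OF C(1)] by blast
  have "card (C - B) \<le> card Q"
  proof (rule ccontr)
    assume "\<not> card (C - B) \<le> card Q"
    then obtain w where w: "w \<in> spn (C - B)" "w \<noteq> 0" "\<forall>q\<in>Q. cip q w = 0"
      using ons_exists_perp[OF oY assms(2)] by auto
    have "spn (C - B) \<subseteq> spn E" using spn_subset[OF csub_spn, of "C - B" E] in_spn[OF C(1)] C(3) by auto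
    then have "w \<in> spn B" using w B(2) by auto
    moreover have "cip b w = 0" if "b \<in> B" for b
    proof -
      have "cip c b = 0" if "c \<in> C - B" for c using onsD[OF C(1), of c b] that \<open>b \<in> B\<close> C(2) by auto
      then have "cip w b = 0" by (rule spn_perp[OF w(1)])
      then show ?thesis using cip_cnj[of b w] by simp
    qed
    ultimately show False using w(2) proj_perp0[of B w] by (simp add: spn_def)
  qed
  moreover have "card C = card E" by (rule card_onb[OF C(1) assms(1) C(3)])
  moreover have "card C = card B + card (C - B)"
    using C(2) ons_finite[OF C(1)] by (metis card_Diff_subset card_mono finite_subset le_add_diff_inverse)
  ultimately show ?thesis using B BE by (intro exI[of _ B]) auto
qed

section \<open>Mean observables on words\<close>

text \<open>Self-adjoint matrices together with their eigendata. Trace zero puts the typical value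
  of every mean at the origin, and the bound 1 on the eigenvalues makes the means
  contractions.\<close>

locale spin =
  fixes d m :: nat and A U :: "nat \<Rightarrow> nat \<Rightarrow> nat \<Rightarrow> complex" and l :: "nat \<Rightarrow> nat \<Rightarrow> real"
  assumes d: "1 \<le> d"
    and herm: "\<And>i a b. i < m \<Longrightarrow> a < d \<Longrightarrow> b < d \<Longrightarrow> A i a b = cnj (A i b a)"
    and uni: "\<And>i a b. i < m \<Longrightarrow> a < d \<Longrightarrow> b < d \<Longrightarrow> (\<Sum>s<d. cnj (U i s a) * U i s b) = (if a = b then 1 else 0)"
    and comp: "\<And>i s t. i < m \<Longrightarrow> s < d \<Longrightarrow> t < d \<Longrightarrow> (\<Sum>a<d. U i s a * cnj (U i t a)) = (if s = t then 1 else 0)"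
    and eig: "\<And>i s a. i < m \<Longrightarrow> s < d \<Longrightarrow> a < d \<Longrightarrow> (\<Sum>t<d. A i s t * U i t a) = of_real (l i a) * U i s a"
    and lb: "\<And>i a. i < m \<Longrightarrow> a < d \<Longrightarrow> \<bar>l i a\<bar> \<le> 1"
    and tr: "\<And>i. i < m \<Longrightarrow> (\<Sum>a<d. l i a) = 0"
begin

definition EE :: "nat \<Rightarrow> nat list fvec set" where "EE N = del ` wd d N"

text \<open>The mean of \<open>A i\<close> over a chain of \<open>N\<close> sites, acting on vectors
  indexed by words.\<close>

definition X :: "nat \<Rightarrow> nat \<Rightarrow> nat list fvec \<Rightarrow> nat list fvec" where
  "X N i = mop (wd d N) (\<lambda>x y. sm (A i) x y / of_nat N)"

definition pvec :: "nat \<Rightarrow> nat \<Rightarrow> nat list \<Rightarrow> nat list fvec" where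
  "pvec N i al = mkv (wd d N) (pv (U i) al)"

definition xi :: "nat \<Rightarrow> nat \<Rightarrow> nat list \<Rightarrow> real" where
  "xi N i al = sum_list (map (l i) al) / real N"

text \<open>The matrix \<open>A i\<close> in the eigenbasis of \<open>A k\<close>.\<close>

definition AA :: "nat \<Rightarrow> nat \<Rightarrow> nat \<Rightarrow> nat \<Rightarrow> complex" where
  "AA i k a b = (\<Sum>s<d. \<Sum>t<d. cnj (U k s a) * A i s t * U k t b)"

lemma ons_EE: "ons (EE N)" by (simp add: EE_def ons_del)
lemma card_EE: "card (EE N) = d ^ N" by (simp add: EE_def card_del card_wd)
lemma spn_EE: "v \<in> spn (EE N) \<longleftrightarrow> csupp v \<subseteq> wd d N" by (simp add: EE_def spn_del)

lemma clin_X: "clin (X N i)" by (simp add: X_def clin_mop)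
lemma X_spn: "X N i v \<in> spn (EE N)" by (simp add: spn_EE X_def csupp_mop)

lemma csym_X: "i < m \<Longrightarrow> csym (X N i)"
  unfolding X_def
proof (rule csym_mop)
  fix x y assume "i < m" "x \<in> wd d N" "y \<in> wd d N"
  then have "sm (A i) x y = cnj (sm (A i) y x)" using sm_herm[of d "A i" x N y] herm by blast
  then show "sm (A i) x y / of_nat N = cnj (sm (A i) y x / of_nat N)" by simp
qed simp

lemma basis: "i < m \<Longrightarrow> onb_family (wd d N) (pvec N i) (EE N)"
proof
  assume i: "i < m"
  show "cip (pvec N i a) (pvec N i b) = (if a = b then 1 else 0)" if "a \<in> wd d N" "b \<in> wd d N" for a b
    using pv_orth[of d "U i" a N b] uni[OF i] that
    by (simp add: cip_coords[of "wd d N"] pvec_def csupp_mkv coord_mkv)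
qed (auto simp: ons_EE card_EE card_wd spn_EE pvec_def csupp_mkv)

lemma X_pvec_general:
  assumes i: "i < m" and k: "k < m" and be: "be \<in> wd d N"
  shows "X N i (pvec N k be) = (\<Sum>al\<in>wd d N. csc (sm (AA i k) al be / of_nat N) (pvec N k al))"
proof (rule fvec_eqI)
  fix x
  have A': "(\<Sum>t<d. A i s t * U k t b) = (\<Sum>a<d. U k s a * AA i k a b)" if "s < d" "b < d" for s b
  proof -
    have "(\<Sum>a<d. U k s a * AA i k a b) = (\<Sum>a<d. \<Sum>s'<d. \<Sum>t<d. (U k s a * cnj (U k s' a)) * (A i s' t * U k t b))"
      unfolding AA_def sum_distrib_left by (intro sum.cong refl) (simp add: mult_ac)
    also have "\<dots> = (\<Sum>s'<d. \<Sum>t<d. \<Sum>a<d. (U k s a * cnj (U k s' a)) * (A i s' t * U k t b))"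
      by (subst sum.swap) (intro sum.cong refl sum.swap)
    also have "\<dots> = (\<Sum>s'<d. \<Sum>t<d. if s = s' then A i s' t * U k t b else 0)"
      using comp[OF k that(1)] by (intro sum.cong refl) (simp flip: sum_distrib_right)
    also have "\<dots> = (\<Sum>s'<d. if s = s' then \<Sum>t<d. A i s' t * U k t b else 0)"
      by (intro sum.cong refl) simp
    finally show ?thesis using that by simp
  qed
  show "coord (X N i (pvec N k be)) x = coord (\<Sum>al\<in>wd d N. csc (sm (AA i k) al be / of_nat N) (pvec N k al)) x"
  proof (cases "x \<in> wd d N")
    case True
    have "coord (X N i (pvec N k be)) x = (\<Sum>y\<in>wd d N. sm (A i) x y * pv (U k) be y) / of_nat N"
      using True by (simp add: X_def coord_mop pvec_def coord_mkv sum_divide_distrib)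
    also have "\<dots> = (\<Sum>al\<in>wd d N. pv (U k) al x * sm (AA i k) al be) / of_nat N"
      using sm_pv[of d "A i" "U k" "AA i k" x N be] A' True be by simp
    also have "\<dots> = coord (\<Sum>al\<in>wd d N. csc (sm (AA i k) al be / of_nat N) (pvec N k al)) x"
      using True by (simp add: pvec_def coord_mkv sum_divide_distrib mult_ac)
    finally show ?thesis .
  next
    case False
    then show ?thesis by (simp add: X_def coord_mop pvec_def coord_mkv)
  qed
qed

lemma X_pvec:
  assumes i: "i < m" and be: "be \<in> wd d N"
  shows "X N i (pvec N i be) = csc (of_real (xi N i be)) (pvec N i be)"
proof (rule fvec_eqI)
  fix x
  have A': "(\<Sum>t<d. A i s t * U i t b) = (\<Sum>a<d. U i s a * (if a = b then of_real (l i b) else 0))"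
    if "s < d" "b < d" for s b
    using eig[OF i that] that by (simp add: if_distrib[of "\<lambda>z. _ * z"] cong: if_cong)
  show "coord (X N i (pvec N i be)) x = coord (csc (of_real (xi N i be)) (pvec N i be)) x"
  proof (cases "x \<in> wd d N")
    case True
    have "coord (X N i (pvec N i be)) x = (\<Sum>y\<in>wd d N. sm (A i) x y * pv (U i) be y) / of_nat N"
      using True by (simp add: X_def coord_mop pvec_def coord_mkv sum_divide_distrib)
    also have "\<dots> = (\<Sum>al\<in>wd d N. pv (U i) al x * sm (\<lambda>a b. if a = b then of_real (l i b) else 0) al be) / of_nat N"
      using sm_pv[of d "A i" "U i" "\<lambda>a b. if a = b then of_real (l i b) else 0" x N be] A' True be by simp
    also have "\<dots> = (\<Sum>al\<in>wd d N. if al = be then pv (U i) be x * of_real (sum_list (map (l i) be)) else 0) / of_nat N"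
      using be by (intro arg_cong2[where f="(/)"] sum.cong refl) (auto simp: sm_diag wds_def)
    also have "\<dots> = coord (csc (of_real (xi N i be)) (pvec N i be)) x"
      using True be by (simp add: pvec_def coord_mkv xi_def mult.commute)
    finally show ?thesis .
  next
    case False
    then show ?thesis by (simp add: X_def coord_mop pvec_def coord_mkv)
  qed
qed

lemma cip_X:
  assumes "i < m" "al \<in> wd d N"
  shows "cip (pvec N i al) (X N i v) = of_real (xi N i al) * cip (pvec N i al) v"
  using csymD[OF csym_X[OF assms(1)], of N "pvec N i al" v] X_pvec[OF assms] by simp

lemma cip_X_general:
  assumes i: "i < m" and k: "k < m" and al: "al \<in> wd d N" and v: "v \<in> spn (EE N)"
  shows "cip (pvec N k al) (X N i v) = (\<Sum>be\<in>wd d N. sm (AA i k) al be / of_nat N * cip (pvec N k be) v)"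
proof -
  note B = basis[OF k, of N]
  have "X N i v = (\<Sum>be\<in>wd d N. csc (cip (pvec N k be) v) (X N i (pvec N k be)))"
    using onb_family.expand[OF B v] clin_sum[OF clin_X, of N i "\<lambda>be. csc (cip (pvec N k be) v) (pvec N k be)" "wd d N"]
    by (simp add: clin_csc[OF clin_X])
  then have "cip (pvec N k al) (X N i v) =
      (\<Sum>be\<in>wd d N. cip (pvec N k be) v * cip (pvec N k al) (X N i (pvec N k be)))"
    by (simp add: cip_sum_right)
  also have "\<dots> = (\<Sum>be\<in>wd d N. sm (AA i k) al be / of_nat N * cip (pvec N k be) v)"
    using onb_family.cip_sum_e[OF B al] X_pvec_general[OF i k] by (intro sum.cong refl) simp
  finally show ?thesis .
qed

lemma abs_sum_list_le:
  "i < m \<Longrightarrow> al \<in> wd d N \<Longrightarrow> \<bar>sum_list (map (l i) al)\<bar> \<le> real N"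
proof (induction N arbitrary: al)
  case (Suc N)
  then obtain a x where *: "al = a # x" "a < d" "x \<in> wd d N" by (auto simp: wds_Suc)
  then show ?case using Suc.IH[OF Suc.prems(1) *(3)] lb[OF Suc.prems(1) *(2)] by simp
qed simp

lemma abs_xi_le: "i < m \<Longrightarrow> al \<in> wd d N \<Longrightarrow> \<bar>xi N i al\<bar> \<le> 1"
  using abs_sum_list_le[of i al N] by (cases "N = 0") (auto simp: xi_def field_simps)

lemma norm_X_le:
  assumes i: "i < m" shows "norm (X N i v) \<le> norm v"
proof -
  have eq: "X N i v = X N i (proj (EE N) v)"
    by (rule fvec_eqI) (simp add: X_def coord_mop EE_def proj_del coord_mkv)
  have "norm (X N i (proj (EE N) v)) \<le> 1 * norm (proj (EE N) v)"
    by (rule onb_family.norm_le_coordwise[OF basis[OF i, of N] X_spn proj_spn[OF ons_EE]])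
      (auto simp: cip_X[OF i] norm_mult intro!: mult_right_mono mult_left_le_one_le abs_xi_le[OF i])
  then show ?thesis using norm_proj_le[OF ons_EE, of N v] eq by simp
qed

text \<open>In the eigenbasis of the \<open>k\<close>-th mean, the commutator has the entries of the
  \<open>i\<close>-th mean multiplied by differences of \<open>h\<close>. Where an entry is nonzero
  the two eigenvalues differ by at most \<open>2 / N\<close>, and the row and column sums of a mean
  are bounded independently of \<open>N\<close>, so the Schur test applies and a Lipschitz bound on
  the scalar function suffices.\<close>

lemma commutator_bound:
  obtains c where "0 \<le> c" "\<And>N i k (h :: real \<Rightarrow> real) L v. i < m \<Longrightarrow> k < m \<Longrightarrow> v \<in> spn (EE N) \<Longrightarrow>
    (\<And>x y. \<bar>h x - h y\<bar> \<le> L * \<bar>x - y\<bar>) \<Longrightarrow> 0 \<le> L \<Longrightarrow> 1 \<le> N \<Longrightarrow>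
    norm (X N i (onb_family.fop (wd d N) (pvec N k) (\<lambda>al. h (xi N k al)) v)
      - onb_family.fop (wd d N) (pvec N k) (\<lambda>al. h (xi N k al)) (X N i v)) \<le> c * L / real N * norm v"
proof -
  define c0 where "c0 = (\<Sum>i<m. \<Sum>k<m. \<Sum>a<d. \<Sum>b<d. cmod (AA i k a b))"
  have c00: "0 \<le> c0" unfolding c0_def by (intro sum_nonneg) auto
  have AAle: "cmod (AA i k a b) \<le> c0" if "i < m" "k < m" "a < d" "b < d" for i k a b
  proof -
    have "cmod (AA i k a b) \<le> (\<Sum>b<d. cmod (AA i k a b))" using that by (intro member_le_sum) auto
    also have "\<dots> \<le> (\<Sum>a<d. \<Sum>b<d. cmod (AA i k a b))"
      using that by (intro member_le_sum[of a]) (auto intro!: sum_nonneg)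
    also have "\<dots> \<le> (\<Sum>k<m. \<Sum>a<d. \<Sum>b<d. cmod (AA i k a b))"
      using that by (intro member_le_sum[of k]) (auto intro!: sum_nonneg)
    also have "\<dots> \<le> c0" unfolding c0_def
      using that by (intro member_le_sum[of i]) (auto intro!: sum_nonneg)
    finally show ?thesis .
  qed
  show ?thesis
  proof (rule that[of "2 * real d * c0"])
    show "0 \<le> 2 * real d * c0" using c00 by simp
    fix N i k and h :: "real \<Rightarrow> real" and L v
    assume i: "i < m" and k: "k < m" and v: "v \<in> spn (EE N)"
      and lip: "\<And>x y. \<bar>h x - h y\<bar> \<le> L * \<bar>x - y\<bar>" and L: "0 \<le> L" and N: "1 \<le> (N::nat)"
    interpret B: onb_family "wd d N" "pvec N k" "EE N" by (rule basis[OF k])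
    define H where "H = B.fop (\<lambda>al. h (xi N k al))"
    define M where "M al be = sm (AA i k) al be / of_nat N * of_real (h (xi N k be) - h (xi N k al))" for al be
    have Mle: "cmod (M al be) \<le> 2 * L / (real N)\<^sup>2 * cmod (sm (AA i k) al be)"
      if "al \<in> wd d N" "be \<in> wd d N" for al be
    proof (cases "sm (AA i k) al be = 0")
      case True
      then show ?thesis using L by (simp add: M_def)
    next
      case False
      have "\<bar>sum_list (map (l k) al) - sum_list (map (l k) be)\<bar> \<le> 2"
        using sm_eigendiff[of d "l k" al N be "AA i k"] lb[OF k] that False by blast
      then have "\<bar>xi N k be - xi N k al\<bar> \<le> 2 / real N"
        using N by (simp add: xi_def abs_minus_commute divide_right_mono flip: diff_divide_distrib)
      then have "\<bar>h (xi N k be) - h (xi N k al)\<bar> \<le> L * (2 / real N)"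
        using lip[of "xi N k be" "xi N k al"] L by (smt (verit) mult_left_mono)
      then have "cmod (sm (AA i k) al be) / real N * \<bar>h (xi N k be) - h (xi N k al)\<bar> \<le>
          cmod (sm (AA i k) al be) / real N * (L * (2 / real N))"
        by (intro mult_left_mono) auto
      then show ?thesis
        by (simp add: M_def norm_mult norm_divide power2_eq_square mult_ac del: of_real_diff)
    qed
    have bnd: "2 * L / (real N)\<^sup>2 * (real N * real d * c0) = 2 * real d * c0 * L / real N"
      using N by (simp add: power2_eq_square field_simps)
    have "norm (X N i (H v) - H (X N i v)) \<le> 2 * real d * c0 * L / real N * norm v"
    proof (rule B.schur_test[where M = M])
      fix al assume al: "al \<in> wd d N"
      have "cip (pvec N k al) (X N i (H v) - H (X N i v)) =
          (\<Sum>be\<in>wd d N. sm (AA i k) al be / of_nat N * (of_real (h (xi N k be)) * cip (pvec N k be) v))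
          - of_real (h (xi N k al)) * (\<Sum>be\<in>wd d N. sm (AA i k) al be / of_nat N * cip (pvec N k be) v)"
        using al by (simp add: H_def cip_X_general[OF i k al B.fop_spn] cip_X_general[OF i k al v] B.cip_fop)
      also have "\<dots> = (\<Sum>be\<in>wd d N. M al be * cip (pvec N k be) v)"
        by (simp add: M_def sum_distrib_left flip: sum_subtractf) (simp add: algebra_simps diff_divide_distrib)
      finally show "cip (pvec N k al) (X N i (H v) - H (X N i v)) = (\<Sum>be\<in>wd d N. M al be * cip (pvec N k be) v)" .
      have "(\<Sum>be\<in>wd d N. cmod (M al be)) \<le> 2 * L / (real N)\<^sup>2 * (\<Sum>be\<in>wd d N. cmod (sm (AA i k) al be))"
        unfolding sum_distrib_left using Mle al by (intro sum_mono) auto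
      also have "\<dots> \<le> 2 * L / (real N)\<^sup>2 * (real N * real d * c0)"
        using sm_row(1)[of d "AA i k" c0 al N] AAle i k c00 al L by (intro mult_left_mono) auto
      finally show "(\<Sum>be\<in>wd d N. cmod (M al be)) \<le> 2 * real d * c0 * L / real N" by (simp only: bnd)
    next
      fix be assume be: "be \<in> wd d N"
      have "(\<Sum>al\<in>wd d N. cmod (M al be)) \<le> 2 * L / (real N)\<^sup>2 * (\<Sum>al\<in>wd d N. cmod (sm (AA i k) al be))"
        unfolding sum_distrib_left using Mle be by (intro sum_mono) auto
      also have "\<dots> \<le> 2 * L / (real N)\<^sup>2 * (real N * real d * c0)"
        using sm_row(2)[of d "AA i k" c0 be N] AAle i k c00 be L by (intro mult_left_mono) auto
      finally show "(\<Sum>al\<in>wd d N. cmod (M al be)) \<le> 2 * real d * c0 * L / real N" by (simp only: bnd)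
    next
      show "X N i (H v) - H (X N i v) \<in> spn (EE N)"
        unfolding H_def using X_spn B.fop_spn by (intro csub_diff[OF csub_spn])
    qed (use v L c00 in auto)
    then show "norm (X N i (B.fop (\<lambda>al. h (xi N k al)) v) - B.fop (\<lambda>al. h (xi N k al)) (X N i v))
        \<le> 2 * real d * c0 * L / real N * norm v" by (simp add: H_def)
  qed
qed

subsection \<open>Large deviations\<close>

definition bad :: "nat \<Rightarrow> nat \<Rightarrow> real \<Rightarrow> nat list set" where
  "bad N i \<rho> = {al\<in>wd d N. \<rho> < \<bar>xi N i al\<bar>}"

lemma exp_le_quadratic: "\<bar>y\<bar> \<le> 1 \<Longrightarrow> exp y \<le> 1 + y + y\<^sup>2" for y :: real
proof (cases "0 \<le> y")
  case False
  assume "\<bar>y\<bar> \<le> 1"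
  have "1 - y \<le> exp (- y)" using exp_ge_add_one_self[of "- y"] by simp
  then have "exp y \<le> 1 / (1 - y)" using False by (simp add: exp_minus field_simps)
  also have "\<dots> \<le> 1 + y + y\<^sup>2"
  proof -
    have "y ^ 3 \<le> 0" using False by (simp add: power3_eq_cube mult_nonneg_nonpos mult_nonpos_nonpos)
    then have "1 \<le> (1 + y + y\<^sup>2) * (1 - y)" by (simp add: algebra_simps power2_eq_square power3_eq_cube)
    then show ?thesis using False by (simp add: field_simps)
  qed
  finally show ?thesis .
qed (use exp_bound in auto)

text \<open>The exponential sum factorises over the sites, and at one site the linear term cancels
  because the trace is zero.\<close>

lemma exp_moment:
  assumes i: "i < m" and s: "\<bar>s\<bar> \<le> 1"
  shows "(\<Sum>al\<in>wd d N. exp (s * sum_list (map (l i) al))) \<le> (real d * exp (s\<^sup>2)) ^ N"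
proof -
  have one: "(\<Sum>a<d. exp (s * l i a)) \<le> real d * exp (s\<^sup>2)"
  proof -
    have "(\<Sum>a<d. exp (s * l i a)) \<le> (\<Sum>a<d. 1 + s * l i a + s\<^sup>2)"
    proof (rule sum_mono)
      fix a assume "a \<in> {..<d}"
      then have la: "\<bar>l i a\<bar> \<le> 1" using lb[OF i] by simp
      have "\<bar>s * l i a\<bar> \<le> 1" using s la by (simp add: abs_mult mult_le_one)
      then have "exp (s * l i a) \<le> 1 + s * l i a + (s * l i a)\<^sup>2" by (rule exp_le_quadratic)
      also have "(s * l i a)\<^sup>2 \<le> s\<^sup>2"
        using la by (simp add: power_mult_distrib mult_left_le abs_square_le_1)
      finally show "exp (s * l i a) \<le> 1 + s * l i a + s\<^sup>2" by simp
    qed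
    also have "\<dots> = real d * (1 + s\<^sup>2)"
      using tr[OF i] by (simp add: sum.distrib algebra_simps flip: sum_distrib_left)
    also have "\<dots> \<le> real d * exp (s\<^sup>2)" using exp_ge_add_one_self[of "s\<^sup>2"] by (intro mult_left_mono) auto
    finally show ?thesis .
  qed
  show ?thesis
  proof (induction N)
    case (Suc N)
    have "(\<Sum>al\<in>wd d (Suc N). exp (s * sum_list (map (l i) al))) =
        (\<Sum>a<d. exp (s * l i a)) * (\<Sum>al\<in>wd d N. exp (s * sum_list (map (l i) al)))"
      unfolding sum_wds_Suc by (simp add: sum_product distrib_left exp_add)
    also have "\<dots> \<le> (real d * exp (s\<^sup>2)) * (real d * exp (s\<^sup>2)) ^ N"
      using one Suc by (intro mult_mono sum_nonneg) auto
    finally show ?case by simp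
  qed simp
qed

text \<open>Chernoff bound for both tails. The parameter \<open>\<rho> / 2\<close> minimises the
  exponent \<open>s\<^sup>2 - s * \<rho>\<close>, and \<open>\<rho> \<le> 2\<close> keeps it in the
  range of \<open>exp_moment\<close>.\<close>

lemma card_bad_le:
  assumes i: "i < m" and r: "0 < \<rho>" "\<rho> \<le> 2"
  shows "real (card (bad N i \<rho>)) \<le> 2 * real d ^ N * exp (- (real N * \<rho>\<^sup>2 / 4))"
proof (cases "N = 0")
  case True
  then have "bad N i \<rho> = {}" using r by (auto simp: bad_def xi_def)
  then show ?thesis by simp
next
  case False
  let ?S = "\<lambda>al. sum_list (map (l i) al)"
  have s: "\<bar>\<rho> / 2\<bar> \<le> 1" "\<bar>- (\<rho> / 2)\<bar> \<le> 1" using r by auto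
  have "real (card (bad N i \<rho>)) * exp (\<rho> / 2 * (real N * \<rho>)) = (\<Sum>al\<in>bad N i \<rho>. exp (\<rho> / 2 * (real N * \<rho>)))"
    by simp
  also have "\<dots> \<le> (\<Sum>al\<in>bad N i \<rho>. exp (\<rho> / 2 * ?S al) + exp (- (\<rho> / 2) * ?S al))"
  proof (rule sum_mono)
    fix al assume "al \<in> bad N i \<rho>"
    then have "real N * \<rho> < \<bar>?S al\<bar>" using False by (simp add: bad_def xi_def field_simps)
    then have "exp (\<rho> / 2 * (real N * \<rho>)) \<le> exp (\<rho> / 2 * \<bar>?S al\<bar>)" using r by simp
    also have "\<dots> \<le> exp (\<rho> / 2 * ?S al) + exp (- (\<rho> / 2) * ?S al)"
      by (cases "0 \<le> ?S al") (auto simp: add_increasing add_increasing2)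
    finally show "exp (\<rho> / 2 * (real N * \<rho>)) \<le> exp (\<rho> / 2 * ?S al) + exp (- (\<rho> / 2) * ?S al)" .
  qed
  also have "\<dots> \<le> (\<Sum>al\<in>wd d N. exp (\<rho> / 2 * ?S al) + exp (- (\<rho> / 2) * ?S al))"
    by (intro sum_mono2) (auto simp: bad_def add_nonneg_nonneg)
  also have "\<dots> \<le> (real d * exp ((\<rho> / 2)\<^sup>2)) ^ N + (real d * exp ((- (\<rho> / 2))\<^sup>2)) ^ N"
    unfolding sum.distrib using exp_moment[OF i s(1), of N] exp_moment[OF i s(2), of N] by (rule add_mono)
  also have "\<dots> = 2 * real d ^ N * exp (real N * (\<rho> / 2)\<^sup>2)"
    by (simp add: power_mult_distrib exp_of_nat_mult)
  finally have "real (card (bad N i \<rho>)) \<le> 2 * real d ^ N * exp (real N * (\<rho> / 2)\<^sup>2) * exp (- (\<rho> / 2 * (real N * \<rho>)))"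
    by (simp add: exp_minus field_simps)
  also have "\<dots> = 2 * real d ^ N * (exp (real N * (\<rho> / 2)\<^sup>2) * exp (- (\<rho> / 2 * (real N * \<rho>))))"
    by simp
  also have "exp (real N * (\<rho> / 2)\<^sup>2) * exp (- (\<rho> / 2 * (real N * \<rho>))) = exp (- (real N * \<rho>\<^sup>2 / 4))"
    unfolding exp_add[symmetric] by (intro arg_cong[where f=exp]) (simp add: power2_eq_square field_simps)
  finally show ?thesis .
qed

text \<open>Eigenvectors of different means, hence in general not orthonormal together; what counts
  is their number and that all means are small on their orthogonal complement.\<close>

definition badvecs :: "nat \<Rightarrow> real \<Rightarrow> nat list fvec set" where
  "badvecs N \<rho> = (\<Union>i<m. pvec N i ` bad N i \<rho>)"

lemma finite_bad [simp]: "finite (bad N i \<rho>)" by (simp add: bad_def)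
lemma finite_badvecs [simp]: "finite (badvecs N \<rho>)" by (simp add: badvecs_def)

lemma card_badvecs_le:
  assumes r: "0 < \<rho>" "\<rho> \<le> 2"
  shows "real (card (badvecs N \<rho>)) \<le> real m * (2 * real d ^ N * exp (- (real N * \<rho>\<^sup>2 / 4)))"
proof -
  have "card (badvecs N \<rho>) \<le> (\<Sum>i<m. card (pvec N i ` bad N i \<rho>))"
    unfolding badvecs_def by (intro card_UN_le) auto
  also have "\<dots> \<le> (\<Sum>i<m. card (bad N i \<rho>))" by (intro sum_mono card_image_le) auto
  finally have "real (card (badvecs N \<rho>)) \<le> (\<Sum>i<m. real (card (bad N i \<rho>)))"
    by (metis of_nat_le_iff of_nat_sum)
  also have "\<dots> \<le> (\<Sum>i<m. 2 * real d ^ N * exp (- (real N * \<rho>\<^sup>2 / 4)))"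
    using card_bad_le r by (intro sum_mono) auto
  finally show ?thesis by simp
qed

lemma norm_X_perp_bad:
  assumes i: "i < m" and w: "w \<in> spn (EE N)" "\<And>al. al \<in> bad N i \<rho> \<Longrightarrow> cip (pvec N i al) w = 0" and r: "0 \<le> \<rho>"
  shows "norm (X N i w) \<le> \<rho> * norm w"
proof (rule onb_family.norm_le_coordwise[OF basis[OF i, of N] X_spn w(1) _ r])
  fix al assume al: "al \<in> wd d N"
  show "cmod (cip (pvec N i al) (X N i w)) \<le> \<rho> * cmod (cip (pvec N i al) w)"
  proof (cases "al \<in> bad N i \<rho>")
    case True
    then show ?thesis using w(2) by (simp add: cip_X[OF i al])
  next
    case False
    then have "\<bar>xi N i al\<bar> \<le> \<rho>" using al by (simp add: bad_def)
    then show ?thesis by (simp add: cip_X[OF i al] norm_mult mult_right_mono)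
  qed
qed

subsection \<open>Dimensions of joint approximate eigenspaces\<close>

definition eigsp :: "nat \<Rightarrow> (nat \<Rightarrow> real) \<Rightarrow> real \<Rightarrow> nat list fvec set \<Rightarrow> bool" where
  "eigsp N x r B \<longleftrightarrow> ons B \<and> B \<subseteq> spn (EE N) \<and>
    (\<forall>i<m. \<forall>v\<in>spn B. norm (dev (X N i) (x i) v) \<le> r * norm v)"

text \<open>The largest dimension of a joint approximate eigenspace at \<open>x\<close> with
  tolerance \<open>r\<close>. The maximum is over a finite set of sizes, nonempty because of
  \<open>eigsp_empty\<close>.\<close>

definition nu :: "nat \<Rightarrow> (nat \<Rightarrow> real) \<Rightarrow> real \<Rightarrow> nat" where
  "nu N x r = Max (card ` {B. eigsp N x r B})"

lemma eigsp_card_le: "eigsp N x r B \<Longrightarrow> card B \<le> d ^ N"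
  using ons_card_le[of B "EE N"] ons_finite[OF ons_EE] by (simp add: eigsp_def card_EE)

lemma eigsp_empty: "eigsp N x r {}"
  using clin_0[OF clin_dev[OF clin_X]] by (auto simp: eigsp_def spn_def proj_def)

lemma finite_eigsp_cards: "finite (card ` {B. eigsp N x r B})"
  by (rule finite_subset[of _ "{..d ^ N}"]) (auto simp: eigsp_card_le)

lemma nu_ge: "eigsp N x r B \<Longrightarrow> card B \<le> nu N x r"
  unfolding nu_def by (rule Max_ge[OF finite_eigsp_cards]) auto

lemma nu_witness: obtains B where "eigsp N x r B" "card B = nu N x r"
proof -
  have "nu N x r \<in> card ` {B. eigsp N x r B}"
    unfolding nu_def by (rule Max_in[OF finite_eigsp_cards]) (use eigsp_empty in blast)
  then show ?thesis using that by auto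
qed

text \<open>Too large an approximate eigenspace contains a vector orthogonal to all eigenvectors of
  the \<open>i\<close>-th mean with value beyond \<open>r0 / 2\<close>. That mean is at most
  \<open>r0 / 2\<close> on it and yet within \<open>r \<le> r0 / 2\<close> of \<open>x i\<close>,
  contradicting \<open>r0 < \<bar>x i\<bar>\<close>.\<close>

lemma nu_upper:
  assumes i: "i < m" and x: "r0 < \<bar>x i\<bar>" and r: "r \<le> r0 / 2" and r0: "0 < r0" "r0 \<le> 2"
  shows "real (nu N x r) \<le> 2 * real d ^ N * exp (- (real N * r0\<^sup>2 / 16))"
proof -
  obtain B where B: "eigsp N x r B" "card B = nu N x r" by (rule nu_witness)
  let ?Q = "pvec N i ` bad N i (r0 / 2)"
  have "card B \<le> card ?Q"
  proof (rule ccontr)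
    assume "\<not> card B \<le> card ?Q"
    then obtain w where w: "w \<in> spn B" "w \<noteq> 0" "\<forall>q\<in>?Q. cip q w = 0"
      using ons_exists_perp[of B ?Q] B(1) by (auto simp: eigsp_def)
    have wE: "w \<in> spn (EE N)" using w(1) spn_subset[OF csub_spn, of B "EE N"] B(1) by (auto simp: eigsp_def)
    have "norm (X N i w) \<le> r0 / 2 * norm w"
      using r0 w(3) by (intro norm_X_perp_bad[OF i wE]) auto
    moreover have "norm (dev (X N i) (x i) w) \<le> r * norm w" using B(1) w(1) i by (simp add: eigsp_def)
    moreover have "norm (csc (of_real (x i)) w) \<le> norm (X N i w) + norm (dev (X N i) (x i) w)"
      using norm_triangle_ineq4[of "X N i w" "dev (X N i) (x i) w"] by (simp add: dev_def)
    ultimately have "\<bar>x i\<bar> * norm w \<le> (r0 / 2 + r) * norm w" by (simp add: algebra_simps)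
    then have "\<bar>x i\<bar> \<le> r0 / 2 + r" using w(2) by simp
    then show False using x r by simp
  qed
  also have "\<dots> \<le> card (bad N i (r0 / 2))" by (intro card_image_le) simp
  finally have "real (nu N x r) \<le> real (card (bad N i (r0 / 2)))" using B by simp
  also have "\<dots> \<le> 2 * real d ^ N * exp (- (real N * (r0 / 2)\<^sup>2 / 4))"
    using r0 by (intro card_bad_le[OF i]) auto
  finally show ?thesis by (simp add: power_divide)
qed

text \<open>The orthogonal complement of \<open>badvecs\<close> is itself an approximate eigenspace
  at the origin.\<close>

lemma nu_zero:
  assumes r: "0 < r" "r \<le> 2"
  shows "real d ^ N \<le> real (nu N (\<lambda>_. 0) r) + real m * (2 * real d ^ N * exp (- (real N * r\<^sup>2 / 4)))"
proof -
  obtain B where B: "ons B" "B \<subseteq> spn (EE N)" "\<forall>b\<in>spn B. \<forall>q\<in>badvecs N r. cip q b = 0"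
      "card (EE N) \<le> card B + card (badvecs N r)"
    using onb_perp[OF ons_EE finite_badvecs] by blast
  have "eigsp N (\<lambda>_. 0) r B"
    unfolding eigsp_def
  proof (intro conjI B allI impI ballI)
    fix i v assume i: "i < m" and v: "v \<in> spn B"
    have "v \<in> spn (EE N)" using v spn_subset[OF csub_spn B(2)] by auto
    then have "norm (X N i v) \<le> r * norm v"
      using B(3) v r i by (intro norm_X_perp_bad[OF i]) (auto simp: badvecs_def)
    then show "norm (dev (X N i) 0 v) \<le> r * norm v" by (simp add: dev_def)
  qed
  then have "d ^ N \<le> nu N (\<lambda>_. 0) r + card (badvecs N r)" using nu_ge B(4) by (fastforce simp: card_EE)
  then have "real d ^ N \<le> real (nu N (\<lambda>_. 0) r) + real (card (badvecs N r))"
    by (metis of_nat_add of_nat_le_iff of_nat_power)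
  then show ?thesis using card_badvecs_le[OF r, of N] by linarith
qed

end

section \<open>Concatenation of chains and supermultiplicativity of approximate eigenspaces\<close>

lemma sum_wds_append:
  "(\<Sum>x\<in>wds S (N + M). f x) = (\<Sum>a\<in>wds S N. \<Sum>b\<in>wds S M. f (a @ b))"
proof (induction N arbitrary: f)
  case (Suc N)
  then show ?case by (simp add: sum_wds_Suc)
qed simp

lemma append_in_wds: "a \<in> wds S N \<Longrightarrow> b \<in> wds S M \<Longrightarrow> a @ b \<in> wds S (N + M)"
  by (auto simp: wds_def)

lemma L2_set_nested:
  "L2_set (\<lambda>(a, b). f a b) (P \<times> R) = sqrt (\<Sum>a\<in>P. \<Sum>b\<in>R. (f a b)\<^sup>2)"
  by (simp add: L2_set_def sum.cartesian_product case_prod_beta)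

lemma exp_decay:
  assumes "0 < r" shows "(\<lambda>n. exp (- (real n * r\<^sup>2 / 4))) \<longlonglongrightarrow> 0"
proof -
  have "exp (- (real n * r\<^sup>2 / 4)) = exp (- (r\<^sup>2 / 4)) ^ n" for n
    by (simp flip: exp_of_nat_mult)
  then show ?thesis using assms by (simp add: LIMSEQ_realpow_zero)
qed

context spin
begin

text \<open>\<open>psl\<close> fixes the last letters of a word and \<open>ssl\<close> the first
  ones: slices of a vector in the tensor product of two chains.\<close>

definition psl :: "nat \<Rightarrow> nat list \<Rightarrow> nat list fvec \<Rightarrow> nat list fvec" where
  "psl N b v = mkv (wd d N) (\<lambda>a. coord v (a @ b))"

definition ssl :: "nat \<Rightarrow> nat list \<Rightarrow> nat list fvec \<Rightarrow> nat list fvec" where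
  "ssl M a v = mkv (wd d M) (\<lambda>b. coord v (a @ b))"

lemma clin_psl: "clin (psl N b)"
  by (rule clinI; rule fvec_eqI) (auto simp: psl_def coord_mkv)

lemma clin_ssl: "clin (ssl N b)"
  by (rule clinI; rule fvec_eqI) (auto simp: ssl_def coord_mkv)

lemma psl_spn: "psl N b v \<in> spn (EE N)" by (simp add: spn_EE psl_def csupp_mkv)
lemma ssl_spn: "ssl N b v \<in> spn (EE N)" by (simp add: spn_EE ssl_def csupp_mkv)

lemma norm_EE: "v \<in> spn (EE N) \<Longrightarrow> (norm v)\<^sup>2 = (\<Sum>a\<in>wd d N. (cmod (coord v a))\<^sup>2)"
  by (rule norm_coords) (auto simp: spn_EE)

lemma norm_psl:
  assumes "v \<in> spn (EE (N + M))"
  shows "(\<Sum>b\<in>wd d M. (norm (psl N b v))\<^sup>2) = (norm v)\<^sup>2"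
proof -
  have "(\<Sum>b\<in>wd d M. (norm (psl N b v))\<^sup>2) = (\<Sum>b\<in>wd d M. \<Sum>a\<in>wd d N. (cmod (coord v (a @ b)))\<^sup>2)"
    by (simp add: norm_EE[OF psl_spn]) (simp add: psl_def coord_mkv)
  also have "\<dots> = (norm v)\<^sup>2" unfolding norm_EE[OF assms] sum_wds_append by (rule sum.swap)
  finally show ?thesis .
qed

lemma norm_ssl:
  assumes "v \<in> spn (EE (N + M))"
  shows "(\<Sum>a\<in>wd d N. (norm (ssl M a v))\<^sup>2) = (norm v)\<^sup>2"
  unfolding norm_EE[OF assms] sum_wds_append
  by (simp add: norm_EE[OF ssl_spn]) (simp add: ssl_def coord_mkv)

text \<open>Sums over sites, not means, add up under concatenation; hence the weights.\<close>

lemma X_append: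
  assumes "a \<in> wd d N" "b \<in> wd d M"
  shows "of_nat (N + M) * coord (X (N + M) i v) (a @ b) =
    of_nat N * coord (X N i (psl N b v)) a + of_nat M * coord (X M i (ssl M a v)) b"
proof (cases "N + M = 0")
  case False
  have sX: "of_nat n * coord (X n i u) c = (\<Sum>y\<in>wd d n. sm (A i) c y * coord u y)" if "c \<in> wd d n" for n u c
    using that by (cases "n = 0") (auto simp: X_def coord_mop sum_divide_distrib[symmetric] simp del: of_nat_Suc)
  have "of_nat (N + M) * coord (X (N + M) i v) (a @ b) =
      (\<Sum>a'\<in>wd d N. \<Sum>b'\<in>wd d M. sm (A i) (a @ b) (a' @ b') * coord v (a' @ b'))"
    unfolding sX[OF append_in_wds[OF assms]] sum_wds_append ..
  also have "\<dots> = (\<Sum>a'\<in>wd d N. \<Sum>b'\<in>wd d M. (if b = b' then sm (A i) a a' * coord v (a' @ b) else 0)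
      + (if a = a' then sm (A i) b b' * coord v (a @ b') else 0))"
  proof (intro sum.cong refl)
    fix a' b' assume "a' \<in> wd d N" "b' \<in> wd d M"
    then have "length a = length a'" using assms by (simp add: wds_def)
    then show "sm (A i) (a @ b) (a' @ b') * coord v (a' @ b') =
      (if b = b' then sm (A i) a a' * coord v (a' @ b) else 0) + (if a = a' then sm (A i) b b' * coord v (a @ b') else 0)"
      by (simp add: sm_append distrib_right)
  qed
  also have "\<dots> = (\<Sum>a'\<in>wd d N. sm (A i) a a' * coord v (a' @ b)) + (\<Sum>b'\<in>wd d M. sm (A i) b b' * coord v (a @ b'))"
  proof -
    have "(\<Sum>a'\<in>wd d N. \<Sum>b'\<in>wd d M. if a = a' then sm (A i) b b' * coord v (a @ b') else 0) =
        (\<Sum>b'\<in>wd d M. sm (A i) b b' * coord v (a @ b'))"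
      by (subst sum.swap) (simp add: assms)
    then show ?thesis by (simp add: sum.distrib assms)
  qed
  also have "(\<Sum>a'\<in>wd d N. sm (A i) a a' * coord v (a' @ b)) = of_nat N * coord (X N i (psl N b v)) a"
    unfolding sX[OF assms(1)] by (intro sum.cong refl) (simp add: psl_def coord_mkv)
  also have "(\<Sum>b'\<in>wd d M. sm (A i) b b' * coord v (a @ b')) = of_nat M * coord (X M i (ssl M a v)) b"
    unfolding sX[OF assms(2)] by (intro sum.cong refl) (simp add: ssl_def coord_mkv)
  finally show ?thesis .
qed simp

lemma dev_spn: "v \<in> spn (EE N) \<Longrightarrow> dev (X N i) x v \<in> spn (EE N)"
  unfolding dev_def by (intro csub_diff[OF csub_spn] csub_csc[OF csub_spn] X_spn)

text \<open>The deviation on the joined chain is the length-weighted average of the two deviations,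
  each estimated slice by slice. The tolerance \<open>r\<close> is thus inherited without
  loss.\<close>

lemma norm_dev_append:
  assumes v: "v \<in> spn (EE (N + M))" and r: "0 \<le> r" and NM: "1 \<le> N + M"
    and 1: "\<And>b. b \<in> wd d M \<Longrightarrow> norm (dev (X N i) x (psl N b v)) \<le> r * norm (psl N b v)"
    and 2: "\<And>a. a \<in> wd d N \<Longrightarrow> norm (dev (X M i) y (ssl M a v)) \<le> r * norm (ssl M a v)"
    and z: "real (N + M) * z = real N * x + real M * y"
  shows "norm (dev (X (N + M) i) z v) \<le> r * norm v"
proof -
  define f where "f a b = real N * cmod (coord (dev (X N i) x (psl N b v)) a)" for a b
  define g where "g a b = real M * cmod (coord (dev (X M i) y (ssl M a v)) b)" for a b
  have pw: "real (N + M) * cmod (coord (dev (X (N + M) i) z v) (a @ b)) \<le> f a b + g a b"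
    if ab: "a \<in> wd d N" "b \<in> wd d M" for a b
  proof -
    have "complex_of_real (real (N + M) * z) = of_real (real N * x + real M * y)" by (simp only: z)
    then have zc: "of_nat (N + M) * complex_of_real z = of_nat N * of_real x + of_nat M * of_real y" by simp
    have "of_nat (N + M) * coord (dev (X (N + M) i) z v) (a @ b) =
        of_nat (N + M) * coord (X (N + M) i v) (a @ b) - (of_nat (N + M) * complex_of_real z) * coord v (a @ b)"
      by (simp add: dev_def algebra_simps)
    also have "\<dots> = of_nat N * coord (dev (X N i) x (psl N b v)) a + of_nat M * coord (dev (X M i) y (ssl M a v)) b"
      unfolding X_append[OF ab] zc using ab by (simp add: dev_def psl_def ssl_def coord_mkv algebra_simps)
    finally have "cmod (of_nat (N + M) * coord (dev (X (N + M) i) z v) (a @ b)) \<le> f a b + g a b"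
      unfolding f_def g_def by (metis norm_mult norm_of_nat norm_triangle_ineq)
    then show ?thesis by (simp only: norm_mult norm_of_nat)
  qed
  have "real (N + M) * norm (dev (X (N + M) i) z v) =
      L2_set (\<lambda>(a, b). real (N + M) * cmod (coord (dev (X (N + M) i) z v) (a @ b))) (wd d N \<times> wd d M)"
  proof -
    have "norm (dev (X (N + M) i) z v) = sqrt (\<Sum>a\<in>wd d N. \<Sum>b\<in>wd d M. (cmod (coord (dev (X (N + M) i) z v) (a @ b)))\<^sup>2)"
      using norm_EE[OF dev_spn[OF v]] unfolding sum_wds_append by (metis norm_ge_zero real_sqrt_unique)
    moreover have "L2_set (\<lambda>(a, b). real (N + M) * cmod (coord (dev (X (N + M) i) z v) (a @ b))) (wd d N \<times> wd d M)
      = sqrt ((real (N + M))\<^sup>2 * (\<Sum>a\<in>wd d N. \<Sum>b\<in>wd d M. (cmod (coord (dev (X (N + M) i) z v) (a @ b)))\<^sup>2))"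
      by (simp only: L2_set_nested power_mult_distrib sum_distrib_left)
    ultimately show ?thesis by (simp add: real_sqrt_mult)
  qed
  also have "\<dots> \<le> L2_set (\<lambda>x. (\<lambda>(a, b). f a b) x + (\<lambda>(a, b). g a b) x) (wd d N \<times> wd d M)"
    using pw by (intro L2_set_mono) auto
  also have "\<dots> \<le> L2_set (\<lambda>(a, b). f a b) (wd d N \<times> wd d M) + L2_set (\<lambda>(a, b). g a b) (wd d N \<times> wd d M)"
    by (rule L2_set_triangle_ineq)
  also have "L2_set (\<lambda>(a, b). f a b) (wd d N \<times> wd d M) \<le> real N * r * norm v"
    unfolding L2_set_nested
  proof (rule real_le_lsqrt)
    have "(\<Sum>a\<in>wd d N. \<Sum>b\<in>wd d M. (f a b)\<^sup>2) = (\<Sum>b\<in>wd d M. (real N)\<^sup>2 * (norm (dev (X N i) x (psl N b v)))\<^sup>2)"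
      by (subst sum.swap) (simp add: f_def norm_EE[OF dev_spn[OF psl_spn]] power_mult_distrib sum_distrib_left)
    also have "\<dots> \<le> (\<Sum>b\<in>wd d M. (real N)\<^sup>2 * (r * norm (psl N b v))\<^sup>2)"
      using 1 by (intro sum_mono mult_left_mono power_mono) auto
    also have "\<dots> = (real N * r)\<^sup>2 * (\<Sum>b\<in>wd d M. (norm (psl N b v))\<^sup>2)"
      by (simp add: power_mult_distrib sum_distrib_left mult.assoc)
    also have "\<dots> = (real N * r * norm v)\<^sup>2" by (simp add: norm_psl[OF v] power_mult_distrib)
    finally show "(\<Sum>a\<in>wd d N. \<Sum>b\<in>wd d M. (f a b)\<^sup>2) \<le> (real N * r * norm v)\<^sup>2" .
  qed (use r in auto)
  also have "L2_set (\<lambda>(a, b). g a b) (wd d N \<times> wd d M) \<le> real M * r * norm v"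
    unfolding L2_set_nested
  proof (rule real_le_lsqrt)
    have "(\<Sum>a\<in>wd d N. \<Sum>b\<in>wd d M. (g a b)\<^sup>2) = (\<Sum>a\<in>wd d N. (real M)\<^sup>2 * (norm (dev (X M i) y (ssl M a v)))\<^sup>2)"
      by (simp add: g_def norm_EE[OF dev_spn[OF ssl_spn]] power_mult_distrib sum_distrib_left)
    also have "\<dots> \<le> (\<Sum>a\<in>wd d N. (real M)\<^sup>2 * (r * norm (ssl M a v))\<^sup>2)"
      using 2 by (intro sum_mono mult_left_mono power_mono) auto
    also have "\<dots> = (real M * r)\<^sup>2 * (\<Sum>a\<in>wd d N. (norm (ssl M a v))\<^sup>2)"
      by (simp add: power_mult_distrib sum_distrib_left mult.assoc)
    also have "\<dots> = (real M * r * norm v)\<^sup>2" by (simp add: norm_ssl[OF v] power_mult_distrib)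
    finally show "(\<Sum>a\<in>wd d N. \<Sum>b\<in>wd d M. (g a b)\<^sup>2) \<le> (real M * r * norm v)\<^sup>2" .
  qed (use r in auto)
  finally have "real (N + M) * norm (dev (X (N + M) i) z v) \<le> real (N + M) * (r * norm v)"
    by (simp add: algebra_simps)
  then show ?thesis using NM by (simp add: mult_le_cancel_left)
qed

definition tn :: "nat \<Rightarrow> nat \<Rightarrow> nat list fvec \<Rightarrow> nat list fvec \<Rightarrow> nat list fvec" where
  "tn N M u w = mkv (wd d (N + M)) (\<lambda>x. coord u (take N x) * coord w (drop N x))"

lemma coord_tn: "a \<in> wd d N \<Longrightarrow> b \<in> wd d M \<Longrightarrow> coord (tn N M u w) (a @ b) = coord u a * coord w b"
proof -
  assume *: "a \<in> wd d N" "b \<in> wd d M"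
  then have "length a = N" by (simp add: wds_def)
  then show ?thesis using append_in_wds[OF *] by (simp add: tn_def coord_mkv)
qed

lemma tn_spn: "tn N M u w \<in> spn (EE (N + M))" by (simp add: spn_EE tn_def csupp_mkv)

lemma cip_tn:
  assumes "u \<in> spn (EE N)" "w \<in> spn (EE M)"
  shows "cip (tn N M u w) (tn N M u' w') = cip u u' * cip w w'"
proof -
  have "cip (tn N M u w) (tn N M u' w') =
      (\<Sum>a\<in>wd d N. \<Sum>b\<in>wd d M. (cnj (coord u a) * coord u' a) * (cnj (coord w b) * coord w' b))"
    using tn_spn[of N M u w]
    by (simp add: cip_coords[of "wd d (N + M)"] spn_EE sum_wds_append coord_tn mult_ac cong: sum.cong)
  also have "\<dots> = cip u u' * cip w w'"
    using assms by (simp add: cip_coords[of "wd d N"] cip_coords[of "wd d M"] spn_EE sum_product)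
  finally show ?thesis .
qed

lemma psl_tn: "b \<in> wd d M \<Longrightarrow> u \<in> spn (EE N) \<Longrightarrow> psl N b (tn N M u w) = csc (coord w b) u"
  by (rule fvec_eqI) (auto simp: psl_def coord_mkv coord_tn spn_EE csupp_def)

lemma ssl_tn: "a \<in> wd d N \<Longrightarrow> w \<in> spn (EE M) \<Longrightarrow> ssl M a (tn N M u w) = csc (coord u a) w"
  by (rule fvec_eqI) (auto simp: ssl_def coord_mkv coord_tn spn_EE csupp_def)

text \<open>Tensor products of approximate eigenvectors. Because the tolerance does not deteriorate,
  the inequality holds at one fixed \<open>r\<close>, as a Fekete argument requires.\<close>

lemma nu_super:
  assumes NM: "1 \<le> N + M" and r: "0 \<le> r"
    and z: "\<And>i. i < m \<Longrightarrow> real (N + M) * z i = real N * x i + real M * y i"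
  shows "nu N x r * nu M y r \<le> nu (N + M) z r"
proof -
  obtain B where B: "eigsp N x r B" "card B = nu N x r" by (rule nu_witness)
  obtain C where C: "eigsp M y r C" "card C = nu M y r" by (rule nu_witness)
  have oB: "ons B" "B \<subseteq> spn (EE N)" and oC: "ons C" "C \<subseteq> spn (EE M)"
    using B C by (auto simp: eigsp_def)
  define T where "T = (\<lambda>(b, c). tn N M b c) ` (B \<times> C)"
  have cT: "cip (tn N M b c) (tn N M b' c') = (if b = b' \<and> c = c' then 1 else 0)"
    if "b \<in> B" "c \<in> C" "b' \<in> B" "c' \<in> C" for b c b' c'
    using that oB oC by (auto simp: cip_tn onsD subset_iff)
  have eqT: "tn N M b c = tn N M b' c' \<longleftrightarrow> b = b' \<and> c = c'" if "b \<in> B" "c \<in> C" "b' \<in> B" "c' \<in> C" for b c b' c'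
    using cT[OF that] cT[OF that(1,2,1,2)] by (metis zero_neq_one)
  have "ons T"
    unfolding ons_def T_def using ons_finite[OF oB(1)] ons_finite[OF oC(1)] cT eqT by auto
  moreover have "inj_on (\<lambda>(b, c). tn N M b c) (B \<times> C)" using eqT by (auto simp: inj_on_def)
  then have "card T = card B * card C" by (simp add: T_def card_image card_cartesian_product)
  moreover have "T \<subseteq> spn (EE (N + M))" using tn_spn by (auto simp: T_def)
  moreover have "norm (dev (X (N + M) i) (z i) v) \<le> r * norm v" if i: "i < m" and v: "v \<in> spn T" for i v
  proof (rule norm_dev_append[OF _ r NM _ _ z[OF i]])
    show "v \<in> spn (EE (N + M))" using v spn_subset[OF csub_spn \<open>T \<subseteq> spn (EE (N + M))\<close>] by auto
    have vT: "v = (\<Sum>t\<in>T. csc (cip t v) t)" using spnD[OF v] by (simp add: proj_def)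
    show "norm (dev (X N i) (x i) (psl N b v)) \<le> r * norm (psl N b v)" if b: "b \<in> wd d M" for b
    proof -
      have "psl N b (\<Sum>t\<in>T. csc (cip t v) t) \<in> spn B"
        unfolding clin_sum[OF clin_psl] clin_csc[OF clin_psl]
      proof (intro csub_sum csub_csc csub_spn)
        fix t assume "t \<in> T"
        then obtain u w where "u \<in> B" "w \<in> C" "t = tn N M u w" by (auto simp: T_def)
        then show "psl N b t \<in> spn B"
          using psl_tn[OF b subsetD[OF oB(2)]] csub_csc[OF csub_spn in_spn[OF oB(1)]] by simp
      qed
      then have "psl N b v \<in> spn B" using vT by simp
      then show ?thesis using B(1) i by (simp add: eigsp_def)
    qed
    show "norm (dev (X M i) (y i) (ssl M a v)) \<le> r * norm (ssl M a v)" if a: "a \<in> wd d N" for a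
    proof -
      have "ssl M a (\<Sum>t\<in>T. csc (cip t v) t) \<in> spn C"
        unfolding clin_sum[OF clin_ssl] clin_csc[OF clin_ssl]
      proof (intro csub_sum csub_csc csub_spn)
        fix t assume "t \<in> T"
        then obtain u w where "u \<in> B" "w \<in> C" "t = tn N M u w" by (auto simp: T_def)
        then show "ssl M a t \<in> spn C"
          using ssl_tn[OF a subsetD[OF oC(2)]] csub_csc[OF csub_spn in_spn[OF oC(1)]] by simp
      qed
      then have "ssl M a v \<in> spn C" using vT by simp
      then show ?thesis using C(1) i by (simp add: eigsp_def)
    qed
  qed
  ultimately show ?thesis using nu_ge[of "N + M" z r T] B C by (simp add: eigsp_def)
qed

text \<open>Moving a point towards the origin raises the number of approximate eigenvectors by an
  arbitrarily large factor, because \<open>ln (nu N x r)\<close> grows linearly with a rate strictly below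
  \<open>ln d\<close> away from the origin.\<close>

lemma gain:
  assumes i: "i < m" and x: "r0 < \<bar>x i\<bar>" and r: "0 < r" "r \<le> r0 / 2" and r0: "0 < r0" "r0 \<le> 2"
  shows "\<exists>N0\<ge>1. \<forall>N1\<ge>1. N0 dvd N1 \<longrightarrow> (\<forall>Q\<ge>1. \<forall>C>0. \<exists>k0. \<forall>k\<ge>k0. \<forall>j\<in>{1..<Q}.
    C * real (nu (Q * k * N1) x r) \<le> real (nu (Q * k * N1) (\<lambda>i. (1 - real j / real Q) * x i) r))"
proof (cases "\<forall>N\<ge>1. nu N x r = 0")
  case True
  show ?thesis
  proof (rule exI[of _ 1], intro conjI allI impI)
    fix N1 Q :: nat and C :: real assume "1 \<le> N1" "1 \<le> Q"
    show "\<exists>k0. \<forall>k\<ge>k0. \<forall>j\<in>{1..<Q}.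
      C * real (nu (Q * k * N1) x r) \<le> real (nu (Q * k * N1) (\<lambda>i. (1 - real j / real Q) * x i) r)"
    proof (intro exI[of _ 1] allI impI ballI)
      fix k j :: nat assume "1 \<le> k"
      then have "1 \<le> Q * k * N1" using \<open>1 \<le> N1\<close> \<open>1 \<le> Q\<close> by (simp add: Suc_le_eq)
      then show "C * real (nu (Q * k * N1) x r) \<le> real (nu (Q * k * N1) (\<lambda>i. (1 - real j / real Q) * x i) r)"
        using True by simp
    qed
  qed simp
next
  case False
  \<comment> \<open>A single length with an approximate eigenvector yields one at every multiple, so
    the logarithms along multiples of \<open>N1\<close> are meaningful.\<close>
  then obtain N0 where N0: "1 \<le> N0" "0 < nu N0 x r" by auto
  show ?thesis
  proof (rule exI[of _ N0], intro conjI N0 allI impI)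
    fix N1 Q :: nat and C :: real assume N1: "1 \<le> N1" "N0 dvd N1" and Q: "1 \<le> Q" and C: "0 < C"
    define p where "p k = nu (k * N1) x r" for k
    have super: "nu a x r * nu b x r \<le> nu (a + b) x r" if "1 \<le> a + b" for a b
      using that r by (intro nu_super) (auto simp: algebra_simps)
    have pos0: "0 < nu (n * N0) x r" if "1 \<le> n" for n
      using that
    proof (induction n rule: nat_induct_at_least)
      case (Suc n)
      have "0 < nu (n * N0) x r * nu N0 x r" using Suc N0 by simp
      also have "\<dots> \<le> nu (n * N0 + N0) x r" using N0 by (intro super) simp
      finally show ?case by (simp add: add.commute)
    qed (use N0 in simp)
    have ppos: "0 < p k" if "1 \<le> k" for k
    proof -
      obtain q where q: "N1 = N0 * q" using N1 by (auto simp: dvd_def)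
      have "1 \<le> k * q" using that N1 q by (cases q) auto
      then show ?thesis using pos0[of "k * q"] by (simp add: p_def q mult_ac)
    qed
    have psuper: "p a * p b \<le> p (a + b)" if "1 \<le> a" for a b
    proof -
      have "1 * 1 \<le> a * N1" using that N1 by (intro mult_le_mono) auto
      then have "1 \<le> a * N1 + b * N1" by linarith
      then show ?thesis using super[of "a * N1" "b * N1"] by (simp add: p_def distrib_right)
    qed
    \<comment> \<open>Logarithm of the ratio of the full dimension to that of the approximate
      eigenspace: subadditive since \<open>nu\<close> is supermultiplicative, and bounded below
      linearly by \<open>nu_upper\<close>.\<close>
    define f where "f k = real (k * N1) * ln (real d) - ln (real (p k))" for k
    have "\<exists>k0. \<forall>k\<ge>k0. \<forall>j\<in>{1..<Q}. ln (2 * C) \<le> f (Q * k) - f ((Q - j) * k)"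
    proof (rule subadditive_increment[where c = "real N1 * r0\<^sup>2 / 16" and b = "ln 2"])
      show "f (k + l) \<le> f k + f l" if "1 \<le> k" "1 \<le> l" for k l
      proof -
        have "real (p k) * real (p l) \<le> real (p (k + l))"
          using psuper[OF that(1), of l] by (metis of_nat_le_iff of_nat_mult)
        then have "ln (real (p k) * real (p l)) \<le> ln (real (p (k + l)))"
          using ppos that by simp
        then have "ln (real (p k)) + ln (real (p l)) \<le> ln (real (p (k + l)))"
          using ppos that by (simp add: ln_mult)
        then show ?thesis by (simp add: f_def algebra_simps)
      qed
      show "real N1 * r0\<^sup>2 / 16 * real k - ln 2 \<le> f k" if "1 \<le> k" for k
      proof -
        have "ln (real (p k)) \<le> ln (2 * real d ^ (k * N1) * exp (- (real (k * N1) * r0\<^sup>2 / 16)))"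
          using nu_upper[where x = x and N = "k * N1", OF i x r(2) r0] ppos[OF that] by (simp add: p_def)
        also have "\<dots> = ln 2 + real (k * N1) * ln (real d) - real (k * N1) * r0\<^sup>2 / 16"
          using d by (simp add: ln_mult ln_realpow)
        finally show ?thesis by (simp add: f_def algebra_simps)
      qed
    qed (use N1 r0 Q in auto)
    then obtain k1 where k1: "\<And>k j. k1 \<le> k \<Longrightarrow> j \<in> {1..<Q} \<Longrightarrow> ln (2 * C) \<le> f (Q * k) - f ((Q - j) * k)"
      by blast
    have "((\<lambda>n. exp (- (real n * r\<^sup>2 / 4))) \<longlongrightarrow> 0) sequentially"
      using r(1) by (rule exp_decay)
    \<comment> \<open>This threshold makes the loss in \<open>nu_zero\<close> at most half the
      dimension; the half is compensated by the factor 2 in \<open>2 * C\<close>.\<close>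
    then have "\<forall>\<^sub>F n in sequentially. exp (- (real n * r\<^sup>2 / 4)) < 1 / (4 * real m)"
      using i by (intro order_tendstoD(2)) auto
    then obtain k2 where k2: "\<And>n. k2 \<le> n \<Longrightarrow> exp (- (real n * r\<^sup>2 / 4)) < 1 / (4 * real m)"
      by (auto simp: eventually_sequentially)
    have half: "real d ^ n / 2 \<le> real (nu n (\<lambda>_. 0) r)" if "k2 \<le> n" for n
    proof -
      have "real m * (2 * real d ^ n * exp (- (real n * r\<^sup>2 / 4))) \<le> real m * (2 * real d ^ n * (1 / (4 * real m)))"
        using k2[OF that] by (intro mult_left_mono) auto
      also have "\<dots> = real d ^ n / 2" using i by simp
      finally show ?thesis using nu_zero[OF r(1), of n] r r0 by simp
    qed
    show "\<exists>k0. \<forall>k\<ge>k0. \<forall>j\<in>{1..<Q}.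
      C * real (nu (Q * k * N1) x r) \<le> real (nu (Q * k * N1) (\<lambda>i. (1 - real j / real Q) * x i) r)"
    proof (intro exI[of _ "max 1 (max k1 k2)"] allI impI ballI)
      fix k j assume k: "max 1 (max k1 k2) \<le> k" and j: "j \<in> {1..<Q}"
      let ?a = "(Q - j) * k * N1" and ?b = "j * k * N1"
      have sum: "Q * k * N1 = ?a + ?b" using j by (simp flip: distrib_right)
      have ka: "1 \<le> Q * k" "1 \<le> (Q - j) * k" using k j by (auto simp: Suc_le_eq)
      have bk: "k2 \<le> ?b"
      proof -
        have "k2 \<le> 1 * k * 1" using k by simp
        also have "\<dots> \<le> ?b" using j N1 by (intro mult_le_mono) auto
        finally show ?thesis .
      qed
      \<comment> \<open>Of \<open>Q\<close> equal blocks, \<open>Q - j\<close> are filled near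
        \<open>x\<close> and \<open>j\<close> near the origin; the average is
        \<open>(1 - j / Q) x\<close>.\<close>
      have "nu ?a x r * nu ?b (\<lambda>_. 0) r \<le> nu (?a + ?b) (\<lambda>i. (1 - real j / real Q) * x i) r"
      proof (rule nu_super)
        show "1 \<le> ?a + ?b" using ka N1 by (simp add: sum[symmetric] Suc_le_eq)
        fix i
        have e1: "real (?a + ?b) = real Q * real k * real N1" by (simp only: sum[symmetric] of_nat_mult)
        have e2: "real ?a = (real Q - real j) * real k * real N1" using j by (simp add: of_nat_diff)
        show "real (?a + ?b) * ((1 - real j / real Q) * x i) = real ?a * x i + real ?b * 0"
          unfolding e1 e2 using Q by (simp add: field_simps)
      qed (use r in simp)
      then have "real (nu ?a x r) * real (nu ?b (\<lambda>_. 0) r) \<le> real (nu (Q * k * N1) (\<lambda>i. (1 - real j / real Q) * x i) r)"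
        unfolding sum by (metis of_nat_le_iff of_nat_mult)
      moreover have "real (nu ?a x r) * (real d ^ ?b / 2) \<le> real (nu ?a x r) * real (nu ?b (\<lambda>_. 0) r)"
        using half[OF bk] by (intro mult_left_mono) auto
      moreover have "2 * C * real (p (Q * k)) \<le> real (p ((Q - j) * k)) * real d ^ ?b"
      proof -
        have "ln (2 * C) \<le> f (Q * k) - f ((Q - j) * k)" using k1 k j by auto
        also have "\<dots> = real ?b * ln (real d) + ln (real (p ((Q - j) * k))) - ln (real (p (Q * k)))"
        proof -
          have "real (Q * k * N1) = real ?a + real ?b" by (simp only: sum of_nat_add)
          then show ?thesis by (simp add: f_def algebra_simps)
        qed
        finally have "ln (2 * C) + ln (real (p (Q * k))) \<le> ln (real (p ((Q - j) * k))) + ln (real d ^ ?b)"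
          using d by (simp add: ln_realpow)
        then have "ln (2 * C * real (p (Q * k))) \<le> ln (real (p ((Q - j) * k)) * real d ^ ?b)"
          using ppos[OF ka(1)] ppos[OF ka(2)] d C by (simp add: ln_mult)
        then show ?thesis using ppos[OF ka(1)] ppos[OF ka(2)] d C by (subst (asm) ln_le_cancel_iff) auto
      qed
      ultimately show "C * real (nu (Q * k * N1) x r) \<le> real (nu (Q * k * N1) (\<lambda>i. (1 - real j / real Q) * x i) r)"
        by (simp add: p_def)
    qed
  qed
qed

end

section \<open>Choice of the parameters and construction on a long chain\<close>

context spin
begin

lemma norm_le_of_sum_sq:
  fixes f :: "nat \<Rightarrow> real"
  assumes "(\<Sum>i<n. (f i)\<^sup>2) \<le> r\<^sup>2 * c\<^sup>2" "i < n" "0 \<le> r" "0 \<le> c"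
  shows "f i \<le> r * c"
proof -
  have "(f i)\<^sup>2 \<le> (\<Sum>i<n. (f i)\<^sup>2)" using assms(2) by (intro member_le_sum) auto
  then have "(f i)\<^sup>2 \<le> (r * c)\<^sup>2" using assms(1) by (simp add: power_mult_distrib)
  then show ?thesis by (rule power2_le_imp_le) (use assms in simp)
qed

definition hatop :: "real \<Rightarrow> nat \<Rightarrow> nat \<Rightarrow> int \<Rightarrow> nat list fvec \<Rightarrow> nat list fvec" where
  "hatop s N k b = onb_family.fop (wd d N) (pvec N k) (\<lambda>al. hat s b (xi N k al))"

lemma hatop_local:
  assumes k: "k < m" and s: "0 < s"
  shows "norm (dev (X N k) (s * of_int b) (hatop s N k b v)) \<le> s * norm (hatop s N k b v)"
proof (rule onb_family.norm_le_coordwise[OF basis[OF k, of N] dev_spn])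
  show hE: "hatop s N k b v \<in> spn (EE N)" unfolding hatop_def by (rule onb_family.fop_spn[OF basis[OF k]])
  show "hatop s N k b v \<in> spn (EE N)" by (rule hE)
  fix al assume al: "al \<in> wd d N"
  have "cip (pvec N k al) (dev (X N k) (s * of_int b) (hatop s N k b v)) =
      of_real (xi N k al - s * of_int b) * cip (pvec N k al) (hatop s N k b v)"
    by (simp add: dev_def cip_X[OF k al] left_diff_distrib)
  then have eq: "cmod (cip (pvec N k al) (dev (X N k) (s * of_int b) (hatop s N k b v))) =
      \<bar>xi N k al - s * of_int b\<bar> * cmod (cip (pvec N k al) (hatop s N k b v))"
    by (simp only: norm_mult norm_of_real)
  show "cmod (cip (pvec N k al) (dev (X N k) (s * of_int b) (hatop s N k b v)))
      \<le> s * cmod (cip (pvec N k al) (hatop s N k b v))"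
  proof (cases "hat s b (xi N k al) = 0")
    case True
    then have "cip (pvec N k al) (hatop s N k b v) = 0"
      unfolding hatop_def by (simp add: onb_family.cip_fop[OF basis[OF k] al])
    then show ?thesis by (simp add: eq)
  next
    case False
    then show ?thesis unfolding eq using hat_near[OF s] by (intro mult_right_mono) auto
  qed
qed (use s in simp)

text \<open>Everything except the length is chosen first: levels, tolerances, grid, then the number
  \<open>K0\<close> of sites that yields enough labels, and the block length \<open>Q * N1\<close>.
  Given a total length, the left-out sites absorb the remainder modulo \<open>Q * N1\<close>, so
  their number stays between \<open>K0\<close> and \<open>K1\<close>.\<close>

lemma core:
  assumes d2: "2 \<le> d" and eps: "0 < (\<epsilon>::real)"
  shows "\<exists>K1 N2. \<forall>N'\<ge>N2. \<exists>N K. N + K = N' \<and> K \<le> K1 \<and>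
    (\<exists>F q. ons F \<and> F \<subseteq> spn (copies (wd d K) (EE N)) \<and>
      (\<forall>i<m. \<forall>v\<in>spn (copies (wd d K) (EE N)). norm (ampl (wd d K) (X N i) v - diagop F (q i) v) \<le> \<epsilon> * norm v))"
proof -
  \<comment> \<open>Enough levels for \<open>1 / sqrt Q\<close>, the cost of the steps between
    levels, to be at most half of \<open>\<epsilon>\<close>.\<close>
  define Q where "Q = nat \<lceil>4 / \<epsilon>\<^sup>2\<rceil> + 1"
  have Q1: "1 \<le> Q" by (simp add: Q_def)
  have "4 / \<epsilon>\<^sup>2 \<le> real Q" unfolding Q_def by linarith
  then have "4 \<le> \<epsilon>\<^sup>2 * real Q" using eps by (simp add: field_simps)
  then have "2\<^sup>2 \<le> (\<epsilon> * sqrt Q)\<^sup>2" by (simp add: power_mult_distrib)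
  then have sqQ: "2 \<le> \<epsilon> * sqrt Q" by (rule power2_le_imp_le) (use eps in simp)
  \<comment> \<open>The coefficient of \<open>e\<close> in the bound of \<open>assembly\<close>; the
    choice of \<open>e\<close> gives this part the other half of \<open>\<epsilon>\<close>.\<close>
  define W where "W = 15 * sqrt Q + (2 * real Q + 1) * 5"
  have W: "0 < W" unfolding W_def by (intro add_nonneg_pos) auto
  define e where "e = min 1 (\<epsilon> / (2 * W))"
  have e: "0 < e" "e \<le> 1" "e * W \<le> \<epsilon> / 2"
  proof -
    have "e * W \<le> \<epsilon> / (2 * W) * W" unfolding e_def using W by (intro mult_right_mono) auto
    then show "e * W \<le> \<epsilon> / 2" using W by simp
  qed (use eps W in \<open>auto simp: e_def\<close>)
  have total: "(15 * e + 1 / real Q) * sqrt Q + (2 * real Q + 1) * (5 * e) \<le> \<epsilon>"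
  proof -
    have "1 / real Q * sqrt Q = sqrt Q / (sqrt Q * sqrt Q)" by simp
    also have "\<dots> = 1 / sqrt Q" using Q1 by (simp del: real_sqrt_mult_self)
    also have "\<dots> \<le> \<epsilon> / 2" using sqQ Q1 by (simp add: field_simps)
    finally have "1 / real Q * sqrt Q \<le> \<epsilon> / 2" .
    moreover have "(15 * e + 1 / real Q) * sqrt Q + (2 * real Q + 1) * (5 * e) = e * W + 1 / real Q * sqrt Q"
      by (simp add: W_def algebra_simps)
    ultimately show ?thesis using e(3) by linarith
  qed
  \<comment> \<open>The error of \<open>dilation\<close> has to stay below \<open>e\<close>:
    \<open>r0\<close> takes a quarter, the spacing \<open>s\<close> an eighth, and the commutators
    get a half. The tolerance \<open>r = r0 / 2\<close> is the largest that \<open>gain\<close>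
    admits.\<close>
  define r0 where "r0 = e / 4"
  define r where "r = r0 / 2"
  have r0: "0 < r0" "r0 \<le> 2" "r0 \<le> e" using e by (auto simp: r0_def)
  have r: "0 < r" "r \<le> r0 / 2" "r \<le> e" using r0 by (auto simp: r_def)
  define s where "s = e / (8 * (2 + sqrt m / r))"
  have den: "0 < 2 + sqrt m / r" using r by (intro add_pos_nonneg) auto
  have s: "0 < s" unfolding s_def using e den by simp
  have ssum: "2 * s + sqrt m * s / r = e / 8"
  proof -
    have "2 * s + sqrt m * s / r = s * (2 + sqrt m / r)" by (simp add: algebra_simps)
    moreover have "e / (8 * D) * D = e / 8" if "0 < D" for D using that by simp
    ultimately show ?thesis using den unfolding s_def by metis
  qed
  define kz where "kz = nat \<lceil>1 / s\<rceil> + 1"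
  have kz: "1 \<le> s * real kz"
  proof -
    have "1 / s \<le> real kz" unfolding kz_def by linarith
    then show ?thesis using s by (simp add: field_simps)
  qed
  define Z where "Z = {- int kz..int kz}"
  have fZ: "finite Z" by (simp add: Z_def)
  define A where "A = wds Z m"
  have fA: "finite A" by (simp add: A_def fZ)
  define Cg where "Cg = 2 * real m * sqrt (card Z) + 2 * real m * sqrt (card A) + sqrt m * real m * sqrt (card Z) / r"
  have Cg: "0 \<le> Cg" unfolding Cg_def using r by (intro add_nonneg_nonneg) auto
  obtain c where c: "0 \<le> c" "\<And>N i k (h :: real \<Rightarrow> real) L v. i < m \<Longrightarrow> k < m \<Longrightarrow> v \<in> spn (EE N) \<Longrightarrow>
    (\<And>x y. \<bar>h x - h y\<bar> \<le> L * \<bar>x - y\<bar>) \<Longrightarrow> 0 \<le> L \<Longrightarrow> 1 \<le> N \<Longrightarrow>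
    norm (X N i (onb_family.fop (wd d N) (pvec N k) (\<lambda>al. h (xi N k al)) v)
      - onb_family.fop (wd d N) (pvec N k) (\<lambda>al. h (xi N k al)) (X N i v)) \<le> c * L / real N * norm v"
    using commutator_bound by blast
  define outer where "outer bs \<longleftrightarrow> (\<exists>i<m. r0 < \<bar>pt s bs i\<bar>)" for bs
  \<comment> \<open>One label for every positive level and every outcome; \<open>K0\<close> sites
    provide \<open>d ^ K0 \<ge> K0\<close> labels because \<open>2 \<le> d\<close>.\<close>
  define K0 where "K0 = (Q - 1) * card (A \<times> (UNIV :: bool set))"
  have K0: "K0 \<le> d ^ K0"
  proof -
    have "K0 \<le> 2 ^ K0" using less_exp[of K0] by simp
    also have "\<dots> \<le> d ^ K0" using d2 by (intro power_mono) auto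
    finally show ?thesis .
  qed
  have "\<exists>N0\<ge>1. \<forall>N1\<ge>1. N0 dvd N1 \<longrightarrow> (\<forall>Q\<ge>1. \<forall>C>0. \<exists>k0. \<forall>k\<ge>k0. \<forall>j\<in>{1..<Q}.
    C * real (nu (Q * k * N1) (pt s bs) r) \<le> real (nu (Q * k * N1) (\<lambda>i. (1 - real j / real Q) * pt s bs i) r))"
    if ob: "outer bs" for bs
  proof -
    obtain i where "i < m" "r0 < \<bar>pt s bs i\<bar>" using ob by (auto simp: outer_def)
    then show ?thesis using r r0 by (intro gain[where x = "pt s bs" and i = i and ?r0.0 = r0]) auto
  qed
  then obtain N0 where N0: "\<And>bs. outer bs \<Longrightarrow> 1 \<le> N0 bs"
    "\<And>bs N1 Q C. outer bs \<Longrightarrow> 1 \<le> N1 \<Longrightarrow> N0 bs dvd N1 \<Longrightarrow> 1 \<le> Q \<Longrightarrow> 0 < (C::real) \<Longrightarrow> \<exists>k0. \<forall>k\<ge>k0. \<forall>j\<in>{1..<Q}.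
    C * real (nu (Q * k * N1) (pt s bs) r) \<le> real (nu (Q * k * N1) (\<lambda>i. (1 - real j / real Q) * pt s bs i) r)"
    by metis
  define Ao where "Ao = {bs\<in>A. outer bs}"
  have fAo: "finite Ao" using fA by (simp add: Ao_def)
  \<comment> \<open>A common multiple of the finitely many lengths supplied by \<open>gain\<close>,
    one for each grid point away from the origin.\<close>
  define N1 where "N1 = (\<Prod>bs\<in>Ao. N0 bs)"
  have N1: "1 \<le> N1" unfolding N1_def using N0(1) by (intro prod_ge_1) (auto simp: Ao_def)
  have N1d: "N0 bs dvd N1" if "bs \<in> Ao" for bs
    unfolding N1_def using fAo that by (rule dvd_prodI)
  define K1 where "K1 = K0 + Q * N1"
  \<comment> \<open>The largest possible number of labelled copies, all of which have to be
    compressed into one.\<close>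
  define C where "C = real (d ^ K1)"
  have C: "0 < C" using d by (simp add: C_def)
  have "\<exists>k0. \<forall>k\<ge>k0. \<forall>j\<in>{1..<Q}. C * real (nu (Q * k * N1) (pt s bs) r)
      \<le> real (nu (Q * k * N1) (\<lambda>i. (1 - real j / real Q) * pt s bs i) r)" if "bs \<in> Ao" for bs
    using N0(2)[OF _ N1 N1d[OF that] Q1 C] that by (simp add: Ao_def)
  then obtain k0 where k0: "\<And>bs k j. bs \<in> Ao \<Longrightarrow> k0 bs \<le> k \<Longrightarrow> j \<in> {1..<Q} \<Longrightarrow>
      C * real (nu (Q * k * N1) (pt s bs) r) \<le> real (nu (Q * k * N1) (\<lambda>i. (1 - real j / real Q) * pt s bs i) r)"
    by metis
  define km where "km = (\<Sum>bs\<in>Ao. k0 bs)"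
  have km: "k0 bs \<le> km" if "bs \<in> Ao" for bs
    unfolding km_def using that fAo by (intro member_le_sum) auto
  \<comment> \<open>The threshold is such that even \<open>C + 1\<close> times the number of bad
    vectors does not exceed the dimension: the complement of one copy of them then has room for all
    labelled copies.\<close>
  have "\<forall>\<^sub>F n in sequentially. exp (- (real n * r0\<^sup>2 / 4)) < 1 / ((C + 1) * (2 * real m + 1))"
    using exp_decay[OF r0(1)] C by (intro order_tendstoD(2)) auto
  then obtain n3 where n3: "\<And>n. n3 \<le> n \<Longrightarrow> exp (- (real n * r0\<^sup>2 / 4)) < 1 / ((C + 1) * (2 * real m + 1))"
    by (auto simp: eventually_sequentially)
  define n4 where "n4 = nat \<lceil>4 * c * Cg / (s * e)\<rceil>"
  have n4: "4 * c * Cg / (s * e) \<le> real n4" unfolding n4_def by linarith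
  define kk where "kk = 1 + km + n3 + n4"
  have main: "\<exists>F q. ons F \<and> F \<subseteq> spn (copies (wd d K) (EE N)) \<and>
      (\<forall>i<m. \<forall>v\<in>spn (copies (wd d K) (EE N)). norm (ampl (wd d K) (X N i) v - diagop F (q i) v) \<le> \<epsilon> * norm v)"
    if kkk: "kk \<le> k" and N: "N = Q * k * N1" and K: "K0 \<le> K" "K \<le> K1" for k N K
  proof -
    have "kk \<le> 1 * k * 1" using kkk by simp
    also have "\<dots> \<le> Q * k * N1" using Q1 N1 by (intro mult_le_mono) auto
    finally have Nkk: "kk \<le> N" by (simp only: N)
    have Npos: "1 \<le> N" using Nkk by (simp add: kk_def)
    have LC: "real (d ^ K) \<le> C"
      unfolding C_def using K d by (simp add: power_increasing)
    have cbad: "real (d ^ K) * real (card (badvecs N r0)) + real (card (badvecs N r0)) \<le> real d ^ N"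
    proof -
      have "real (card (badvecs N r0)) \<le> real m * (2 * real d ^ N * exp (- (real N * r0\<^sup>2 / 4)))"
        by (rule card_badvecs_le[OF r0(1,2)])
      also have "\<dots> \<le> real m * (2 * real d ^ N * (1 / ((C + 1) * (2 * real m + 1))))"
        using n3[of N] Nkk by (intro mult_left_mono) (auto simp: kk_def)
      also have "\<dots> = (2 * real m / (2 * real m + 1)) * (real d ^ N / (C + 1))"
        using C by (simp add: field_simps)
      also have "\<dots> \<le> 1 * (real d ^ N / (C + 1))"
        using C by (intro mult_right_mono) auto
      finally have "real (card (badvecs N r0)) * (C + 1) \<le> real d ^ N" using C by (simp add: field_simps)
      moreover have "real (card (badvecs N r0)) * (real (d ^ K) + 1) \<le> real (card (badvecs N r0)) * (C + 1)"
        using LC by (intro mult_left_mono) auto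
      ultimately show ?thesis by (simp add: algebra_simps)
    qed
    \<comment> \<open>The bound of \<open>commutator_bound\<close> with the Lipschitz constant
      \<open>2 / s\<close> of the bumps.\<close>
    define \<gamma> where "\<gamma> = c * (2 / s) / real N"
    have g0: "0 \<le> \<gamma>" using c s by (simp add: \<gamma>_def)
    have gC: "\<gamma> * Cg \<le> e / 2"
    proof -
      have "4 * c * Cg / (s * e) \<le> real N" using n4 Nkk by (simp add: kk_def)
      then have "4 * c * Cg \<le> real N * (s * e)" using s e by (simp add: field_simps)
      then show ?thesis using s Npos by (simp add: \<gamma>_def field_simps)
    qed
    define H where "H = hatop s N"
    have H1: "clin (H k b)" if "k < m" for k b
      unfolding H_def hatop_def by (rule onb_family.clin_fop[OF basis[OF that]])
    have H2: "H k b v \<in> spn (EE N)" if "k < m" for k b v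
      unfolding H_def hatop_def by (rule onb_family.fop_spn[OF basis[OF that]])
    have H3: "(\<Sum>b\<in>Z. cip (H k b u) (H k b v)) = cip u v" if "k < m" "v \<in> spn (EE N)" for k u v
      unfolding H_def hatop_def Z_def
      by (rule onb_family.fop_partition[OF basis[OF that(1)] _ hat_sum_sq[OF s kz abs_xi_le[OF that(1)]] that(2)]) auto
    have H4: "norm (X N i (H k b v) - H k b (X N i v)) \<le> \<gamma> * norm v"
      if "i < m" "k < m" "v \<in> spn (EE N)" for i k b v
      unfolding H_def hatop_def \<gamma>_def
      by (rule c(2)[OF that hat_lipschitz[OF s] _ Npos]) (use s in simp)
    have H5: "norm (dev (X N k) (s * of_int b) (H k b v)) \<le> s * norm (H k b v)" if "k < m" for k b v
      unfolding H_def by (rule hatop_local[OF that s])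
    define good where "good bs R \<longleftrightarrow> ons R \<and> R \<subseteq> spn (EE N) \<and>
        (\<forall>v\<in>spn R. (\<Sum>i<m. (norm (dev (X N i) (pt s bs i) v))\<^sup>2) \<le> r\<^sup>2 * (norm v)\<^sup>2) \<and>
        (\<forall>w\<in>spn (EE N). r\<^sup>2 * (norm (w - proj R w))\<^sup>2 \<le> (\<Sum>i<m. (norm (dev (X N i) (pt s bs i) w))\<^sup>2))"
      for bs R
    have "\<forall>bs. \<exists>R. good bs R"
      unfolding good_def
      by (intro allI spectral_subspace[OF clin_X csym_X ons_EE X_spn less_imp_le[OF r(1)]])
    from choice[OF this] obtain R' where "\<forall>bs. good bs (R' bs)" by blast
    then have R': "\<And>bs. ons (R' bs)" "\<And>bs. R' bs \<subseteq> spn (EE N)"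
      "\<And>bs v. v \<in> spn (R' bs) \<Longrightarrow> (\<Sum>i<m. (norm (dev (X N i) (pt s bs i) v))\<^sup>2) \<le> r\<^sup>2 * (norm v)\<^sup>2"
      "\<And>bs w. w \<in> spn (EE N) \<Longrightarrow> r\<^sup>2 * (norm (w - proj (R' bs) w))\<^sup>2 \<le> (\<Sum>i<m. (norm (dev (X N i) (pt s bs i) w))\<^sup>2)"
      unfolding good_def by blast+
    define R where "R bs = (if outer bs then R' bs else {})" for bs
    have Rons: "ons (R bs)" and RE: "R bs \<subseteq> spn (EE N)" for bs using R' by (auto simp: R_def)
    have R3: "(\<forall>w\<in>spn (EE N). r\<^sup>2 * (norm (w - proj (R bs) w))\<^sup>2 \<le> (\<Sum>i<m. (norm (dev (X N i) (pt s bs i) w))\<^sup>2)) \<or>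
        (R bs = {} \<and> (\<forall>i<m. \<bar>pt s bs i\<bar> \<le> r0))" for bs
      using R'(4) by (auto simp: R_def outer_def)
    note dil = dilation[where X = "X N" and E = "EE N" and H = H and Z = Z and s = s and \<gamma> = \<gamma> and R = R
      and m = m and r = r and ?r0.0 = r0, OF clin_X norm_X_le ons_EE X_spn fZ H1 H2 H3 H4 H5
      less_imp_le[OF s] g0 r(1) less_imp_le[OF r0(1)] Rons RE R3]
    define G where "G = dG H R"
    define y where "y = dy s"
    let ?A = "A \<times> (UNIV :: bool set)"
    have Gerr: "(\<Sum>c\<in>?A. (norm (csc (of_real (y c i)) (G c v) - G c (X N i v)))\<^sup>2) \<le> e\<^sup>2 * (norm v)\<^sup>2"
      if i: "i < m" and v: "v \<in> spn (EE N)" for i v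
    proof -
      let ?w = "s + real m * \<gamma> * sqrt (card Z)"
      let ?t = "2 * ?w + 2 * (real m * \<gamma> * sqrt (card A)) + sqrt m * ?w / r + r0"
      have "(\<Sum>c\<in>?A. (norm (csc (of_real (y c i)) (G c v) - G c (X N i v)))\<^sup>2) \<le> ?t\<^sup>2 * (norm v)\<^sup>2"
        unfolding G_def y_def A_def by (rule dil(4)) (auto simp: i v)
      also have "?t = (2 * s + sqrt m * s / r) + \<gamma> * Cg + r0"
        unfolding Cg_def using r by (simp add: field_simps)
      also have "((2 * s + sqrt m * s / r) + \<gamma> * Cg + r0)\<^sup>2 * (norm v)\<^sup>2 \<le> e\<^sup>2 * (norm v)\<^sup>2"
      proof (intro mult_right_mono power_mono)
        show "(2 * s + sqrt m * s / r) + \<gamma> * Cg + r0 \<le> e"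
          unfolding ssum using gC e by (simp add: r0_def)
        show "0 \<le> (2 * s + sqrt m * s / r) + \<gamma> * Cg + r0"
          unfolding ssum using g0 Cg r0 e by simp
      qed simp
      finally show ?thesis .
    qed
    define t where "t j = 1 - real j / real Q" for j
    define pgood where "pgood j c B \<longleftrightarrow> ons B \<and> B \<subseteq> spn (EE N) \<and>
        (\<forall>i<m. \<forall>v\<in>spn B. norm (dev (X N i) (t j * y c i) v) \<le> e * norm v) \<and>
        (card (wd d K) * card (badvecs N r0) \<le> card B \<or>
          (\<exists>R. ons R \<and> (\<forall>v\<in>spn (EE N). G c v \<in> spn R) \<and> card (wd d K) * card R \<le> card B))"
      for j c B
    have Pex: "\<exists>B. pgood j c B"
      if j: "j \<in> {1..<Q}" and c: "c \<in> ?A" for j c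
    proof -
      obtain bs q where cc: "c = (bs, q)" "bs \<in> A" using c by auto
      \<comment> \<open>Remainders go to the origin, where the complement of the bad vectors is
        large enough; inner grid points keep nothing, so the empty target does; the kept pieces of
        outer points rely on the gain in dimension.\<close>
      consider (zero) "\<not> q" | (inner) q "\<not> outer bs" | (out) q "outer bs" by blast
      then show ?thesis
      proof cases
        case zero
        obtain B where B: "ons B" "B \<subseteq> spn (EE N)" "\<forall>b\<in>spn B. \<forall>q\<in>badvecs N r0. cip q b = 0"
            "card (EE N) \<le> card B + card (badvecs N r0)"
          using onb_perp[OF ons_EE finite_badvecs] by blast
        have "norm (dev (X N i) (t j * y c i) v) \<le> e * norm v" if i: "i < m" and v: "v \<in> spn B" for i v
        proof -
          have "v \<in> spn (EE N)" using v spn_subset[OF csub_spn B(2)] by auto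
          then have "norm (X N i v) \<le> r0 * norm v"
            using B(3) v r0 i by (intro norm_X_perp_bad[OF i]) (auto simp: badvecs_def)
          also have "\<dots> \<le> e * norm v" using r0 by (intro mult_right_mono) auto
          finally show ?thesis using zero by (simp add: dev_def y_def dy_def cc)
        qed
        moreover have "d ^ K * card (badvecs N r0) \<le> card B"
        proof -
          have "real (d ^ N) \<le> real (card B) + real (card (badvecs N r0))"
            using B(4) by (metis card_EE of_nat_add of_nat_le_iff)
          then have "real (d ^ K * card (badvecs N r0)) \<le> real (card B)" using cbad by simp
          then show ?thesis by (simp only: of_nat_le_iff)
        qed
        ultimately show ?thesis using B unfolding pgood_def by (intro exI[of _ B]) (simp add: card_wd)
      next
        case inner
        have G0: "G c v \<in> spn {}" for v using inner by (simp add: G_def dG_def cc R_def spn_def proj_def)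
        have dv: "norm (dev (X N i) (t j * y c i) v) \<le> e * norm v" if "v \<in> spn {}" for i v
          using that clin_0[OF clin_dev[OF clin_X]] by (simp add: spn_def proj_def)
        show ?thesis
          unfolding pgood_def by (intro exI[of _ "{} :: nat list fvec set"] conjI disjI2) (simp_all add: G0 dv)
      next
        case out
        have eR: "eigsp N (pt s bs) r (R bs)"
          unfolding eigsp_def
        proof (intro conjI Rons RE allI impI ballI)
          fix i v assume "i < m" "v \<in> spn (R bs)"
          then show "norm (dev (X N i) (pt s bs i) v) \<le> r * norm v"
            using norm_le_of_sum_sq[where n = m and f = "\<lambda>i. norm (dev (X N i) (pt s bs i) v)"]
              R'(3)[of v bs] r out by (simp add: R_def)
        qed
        obtain B where B: "eigsp N (\<lambda>i. t j * pt s bs i) r B" "card B = nu N (\<lambda>i. t j * pt s bs i) r"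
          by (rule nu_witness)
        have "real (card (wd d K)) * real (card (R bs)) \<le> C * real (nu N (pt s bs) r)"
          using LC nu_ge[OF eR] C by (intro mult_mono) (auto simp: card_wd)
        also have "\<dots> \<le> real (nu N (\<lambda>i. t j * pt s bs i) r)"
        proof -
          have "bs \<in> Ao" using cc out by (simp add: Ao_def)
          then have "k0 bs \<le> k" using km[of bs] kkk by (simp add: kk_def)
          then show ?thesis using k0[OF \<open>bs \<in> Ao\<close> _ j] by (simp add: N t_def)
        qed
        finally have "card (wd d K) * card (R bs) \<le> card B"
          unfolding B(2) by (metis of_nat_le_iff of_nat_mult)
        moreover have "G c v \<in> spn (R bs)" for v
          using out proj_spn[OF Rons] by (simp add: G_def dG_def cc)
        moreover have "norm (dev (X N i) (t j * y c i) v) \<le> e * norm v" if "i < m" "v \<in> spn B" for i v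
        proof -
          have "norm (dev (X N i) (t j * pt s bs i) v) \<le> r * norm v" using B(1) that by (simp add: eigsp_def)
          also have "\<dots> \<le> e * norm v" using r by (intro mult_right_mono) auto
          finally show ?thesis using out by (simp add: y_def dy_def cc)
        qed
        moreover have "ons B" "B \<subseteq> spn (EE N)" using B(1) by (auto simp: eigsp_def)
        ultimately show ?thesis unfolding pgood_def using Rons by blast
      qed
    qed
    define P where "P j c = (SOME B. pgood j c B)" for j c
    have P: "pgood j c (P j c)" if "j \<in> {1..<Q}" "c \<in> ?A" for j c
      unfolding P_def using Pex[OF that] by (rule someI_ex)
    have "\<exists>F q. ons F \<and> F \<subseteq> spn (copies (wd d K) (EE N)) \<and> (\<forall>i<m. \<forall>v\<in>spn (copies (wd d K) (EE N)).
      norm (ampl (wd d K) (X N i) v - diagop F (q i) v)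
        \<le> ((15 * e + 1 / real Q) * sqrt Q + (2 * real Q + 1) * (5 * e)) * norm v)"
    proof (rule assembly[where A = ?A and G = G and y = y and P = P and Q = "badvecs N r0" and t = t and J = Q])
      show "(Q - 1) * card ?A \<le> card (wd d K)"
      proof -
        have "K0 \<le> d ^ K" using K0 power_increasing[OF K(1) d] by linarith
        then show ?thesis by (simp add: card_wd K0_def)
      qed
      show "clin (G c)" if "c \<in> ?A" for c
        unfolding G_def A_def by (rule dil(1)) (use that in \<open>auto simp: A_def\<close>)
      show "G c v \<in> spn (EE N)" if "c \<in> ?A" "v \<in> spn (EE N)" for c v
        unfolding G_def A_def by (rule dil(2)) (use that in \<open>auto simp: A_def\<close>)
      show "(\<Sum>c\<in>?A. cip (G c u) (G c v)) = cip u v" if "u \<in> spn (EE N)" "v \<in> spn (EE N)" for u v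
        unfolding G_def A_def by (rule dil(3)) (use that in \<open>auto simp: A_def\<close>)
      show "norm (X N i v) \<le> e * norm v" if "i < m" "v \<in> spn (EE N)" "\<forall>q\<in>badvecs N r0. cip q v = 0" for i v
      proof -
        have "norm (X N i v) \<le> r0 * norm v"
          using that r0 by (intro norm_X_perp_bad) (auto simp: badvecs_def)
        also have "\<dots> \<le> e * norm v" using r0 by (intro mult_right_mono) auto
        finally show ?thesis .
      qed
      show "\<bar>t j - t (Suc j)\<bar> \<le> 1 / real Q" for j
        by (simp add: t_def add_divide_distrib)
      show "\<bar>t j\<bar> \<le> 1" if "j < Q" for j using that by (simp add: t_def)
      show "ons (P j c)" "P j c \<subseteq> spn (EE N)" if "1 \<le> j" "j < Q" "c \<in> ?A" for j c
        using P[of j c] that by (auto simp: pgood_def)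
      show "norm (dev (X N i) (t j * y c i) v) \<le> e * norm v"
        if "1 \<le> j" "j < Q" "c \<in> ?A" "i < m" "v \<in> spn (P j c)" for j c i v
        using P[of j c] that unfolding pgood_def by simp
      show "card (wd d K) * card (badvecs N r0) \<le> card (P j c) \<or>
          (\<exists>R. ons R \<and> (\<forall>v\<in>spn (EE N). G c v \<in> spn R) \<and> card (wd d K) * card R \<le> card (P j c))"
        if "1 \<le> j" "j < Q" "c \<in> ?A" for j c
        using P[of j c] that unfolding pgood_def by simp
    qed (use Q1 e Gerr clin_X csym_X norm_X_le ons_EE X_spn fA in \<open>auto simp: t_def\<close>)
    then obtain F q where F: "ons F" "F \<subseteq> spn (copies (wd d K) (EE N))"
      "\<And>i v. i < m \<Longrightarrow> v \<in> spn (copies (wd d K) (EE N)) \<Longrightarrow> norm (ampl (wd d K) (X N i) v - diagop F (q i) v)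
        \<le> ((15 * e + 1 / real Q) * sqrt Q + (2 * real Q + 1) * (5 * e)) * norm v" by blast
    have "norm (ampl (wd d K) (X N i) v - diagop F (q i) v) \<le> \<epsilon> * norm v"
      if "i < m" "v \<in> spn (copies (wd d K) (EE N))" for i v
      using F(3)[OF that] mult_right_mono[OF total norm_ge_zero] by (rule order_trans)
    then show ?thesis using F(1,2) by blast
  qed
  show ?thesis
  proof (rule exI[of _ K1], rule exI[of _ "K0 + Q * N1 * kk"], intro allI impI)
    fix N' assume N': "K0 + Q * N1 * kk \<le> N'"
    define k where "k = (N' - K0) div (Q * N1)"
    have QN: "0 < Q * N1" using Q1 N1 by simp
    have kkk: "kk \<le> k"
    proof -
      have "kk = (Q * N1 * kk) div (Q * N1)" using QN by simp
      also have "\<dots> \<le> k" unfolding k_def using N' by (intro div_le_mono) simp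
      finally show ?thesis .
    qed
    have dm: "Q * k * N1 + (N' - K0) mod (Q * N1) = N' - K0"
      unfolding k_def using div_mult_mod_eq[of "N' - K0" "Q * N1"] by (simp add: mult_ac)
    \<comment> \<open>The remainder of the division joins the \<open>K0\<close> label sites, which
      leaves a chain whose length is a multiple of \<open>Q * N1\<close>.\<close>
    define K where "K = K0 + (N' - K0) mod (Q * N1)"
    have "Q * k * N1 + K = N'" using dm N' by (simp add: K_def)
    moreover have "K0 \<le> K" "K \<le> K1" unfolding K_def K1_def using QN by (auto simp: less_imp_le)
    ultimately show "\<exists>N K. N + K = N' \<and> K \<le> K1 \<and>
      (\<exists>F q. ons F \<and> F \<subseteq> spn (copies (wd d K) (EE N)) \<and>
      (\<forall>i<m. \<forall>v\<in>spn (copies (wd d K) (EE N)). norm (ampl (wd d K) (X N i) v - diagop F (q i) v) \<le> \<epsilon> * norm v))"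
      using main[OF kkk refl] by blast
  qed
qed

end

section \<open>Transport to configurations\<close>

definition cword :: "nat \<Rightarrow> config \<Rightarrow> nat list" where
  "cword n \<sigma> = map \<sigma> [- int n..int n]"

lemma length_cword: "length (cword n \<sigma>) = 2 * n + 1"
  by (simp add: cword_def nat_add_distrib)

lemma cword_in: "\<sigma> \<in> configs d n \<Longrightarrow> cword n \<sigma> \<in> wd d (2 * n + 1)"
  using length_cword[of n \<sigma>] by (auto simp: wds_def cword_def configs_def abs_le_iff)

lemma cword_bij: "bij_betw (cword n) (configs d n) (wd d (2 * n + 1))"
proof (rule bij_betwI')
  fix \<sigma> \<tau> assume s: "\<sigma> \<in> configs d n" "\<tau> \<in> configs d n"
  show "cword n \<sigma> = cword n \<tau> \<longleftrightarrow> \<sigma> = \<tau>"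
  proof
    assume eq: "cword n \<sigma> = cword n \<tau>"
    show "\<sigma> = \<tau>"
    proof
      fix k show "\<sigma> k = \<tau> k"
      proof (cases "\<bar>k\<bar> \<le> int n")
        case True
        then have "k \<in> set [- int n..int n]" by auto
        then show ?thesis using eq by (simp add: cword_def)
      next
        case False
        then show ?thesis using s by (simp add: configs_def)
      qed
    qed
  qed simp
next
  fix \<sigma> assume "\<sigma> \<in> configs d n" then show "cword n \<sigma> \<in> wd d (2 * n + 1)" by (rule cword_in)
next
  fix x assume x: "x \<in> wd d (2 * n + 1)"
  define \<sigma> where "\<sigma> k = (if \<bar>k\<bar> \<le> int n then x ! nat (k + int n) else 0)" for k
  have "\<sigma> \<in> configs d n"
  proof -
    have "x ! nat (k + int n) < d" if "\<bar>k\<bar> \<le> int n" for k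
    proof -
      have "nat (k + int n) < length x" using x that by (auto simp: wds_def)
      then have "x ! nat (k + int n) \<in> set x" by simp
      then show ?thesis using x by (auto simp: wds_def)
    qed
    then show ?thesis by (auto simp: configs_def \<sigma>_def)
  qed
  moreover have "x = cword n \<sigma>"
  proof (rule nth_equalityI)
    show "length x = length (cword n \<sigma>)" using x length_cword[of n \<sigma>] by (simp add: wds_def)
    fix k assume "k < length x"
    then show "x ! k = cword n \<sigma> ! k"
      using x by (simp add: cword_def \<sigma>_def wds_def)
  qed
  ultimately show "\<exists>\<sigma>\<in>configs d n. x = cword n \<sigma>" by blast
qed

lemma finite_configs [simp]: "finite (configs d n)"
  using bij_betw_finite[OF cword_bij[of n d]] by simp

text \<open>Splitting off one site reproduces the recursion of \<open>sm\<close>: the term acting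
  there requires agreement at all others, and each of the others requires agreement there.\<close>

lemma sum_sites:
  assumes "distinct js"
  shows "(\<Sum>j\<in>set js. if \<forall>k\<in>set js. k \<noteq> j \<longrightarrow> \<sigma> k = \<tau> k then A (\<sigma> j) (\<tau> j) else 0) = sm A (map \<sigma> js) (map \<tau> js)"
  using assms
proof (induction js)
  case (Cons j js)
  have "(\<Sum>i\<in>set (j # js). if \<forall>k\<in>set (j # js). k \<noteq> i \<longrightarrow> \<sigma> k = \<tau> k then A (\<sigma> i) (\<tau> i) else 0) =
      (if \<forall>k\<in>set (j # js). k \<noteq> j \<longrightarrow> \<sigma> k = \<tau> k then A (\<sigma> j) (\<tau> j) else 0) +
      (\<Sum>i\<in>set js. if \<forall>k\<in>set (j # js). k \<noteq> i \<longrightarrow> \<sigma> k = \<tau> k then A (\<sigma> i) (\<tau> i) else 0)"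
    using Cons.prems by simp
  also have "(\<forall>k\<in>set (j # js). k \<noteq> j \<longrightarrow> \<sigma> k = \<tau> k) \<longleftrightarrow> map \<sigma> js = map \<tau> js"
    using Cons.prems by auto
  also have "(\<Sum>i\<in>set js. if \<forall>k\<in>set (j # js). k \<noteq> i \<longrightarrow> \<sigma> k = \<tau> k then A (\<sigma> i) (\<tau> i) else 0) =
      (if \<sigma> j = \<tau> j then sm A (map \<sigma> js) (map \<tau> js) else 0)"
  proof (cases "\<sigma> j = \<tau> j")
    case True
    then have "(\<Sum>i\<in>set js. if \<forall>k\<in>set (j # js). k \<noteq> i \<longrightarrow> \<sigma> k = \<tau> k then A (\<sigma> i) (\<tau> i) else 0) =
        (\<Sum>i\<in>set js. if \<forall>k\<in>set js. k \<noteq> i \<longrightarrow> \<sigma> k = \<tau> k then A (\<sigma> i) (\<tau> i) else 0)"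
      by (intro sum.cong refl) auto
    then show ?thesis using True Cons by simp
  next
    case False
    then have "(\<Sum>i\<in>set js. if \<forall>k\<in>set (j # js). k \<noteq> i \<longrightarrow> \<sigma> k = \<tau> k then A (\<sigma> i) (\<tau> i) else 0) = 0"
      using Cons.prems by (intro sum.neutral) auto
    then show ?thesis using False by simp
  qed
  finally show ?case by simp
qed simp

lemma mean_op_sm:
  assumes "\<sigma> \<in> configs d n" "\<tau> \<in> configs d n"
  shows "mean_op d n A \<sigma> \<tau> = sm A (cword n \<sigma>) (cword n \<tau>) / of_nat (2 * n + 1)"
proof -
  have "(\<forall>k. k \<noteq> j \<longrightarrow> \<sigma> k = \<tau> k) \<longleftrightarrow> (\<forall>k\<in>set [- int n..int n]. k \<noteq> j \<longrightarrow> \<sigma> k = \<tau> k)" for j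
  proof -
    have "\<sigma> k = \<tau> k" if "k \<notin> set [- int n..int n]" for k
    proof -
      have "int n < \<bar>k\<bar>" using that by auto
      then show ?thesis using assms by (simp add: configs_def)
    qed
    then show ?thesis by blast
  qed
  then have "(\<Sum>j\<in>{- int n..int n}. site_op d n j A \<sigma> \<tau>) =
      (\<Sum>j\<in>set [- int n..int n]. if \<forall>k\<in>set [- int n..int n]. k \<noteq> j \<longrightarrow> \<sigma> k = \<tau> k then A (\<sigma> j) (\<tau> j) else 0)"
    using assms by (simp add: site_op_def)
  also have "\<dots> = sm A (cword n \<sigma>) (cword n \<tau>)"
    unfolding cword_def by (rule sum_sites) simp
  finally show ?thesis by (simp add: mean_op_def)
qed

lemma mean_op_outside: "\<sigma> \<notin> configs d n \<or> \<tau> \<notin> configs d n \<Longrightarrow> mean_op d n A \<sigma> \<tau> = 0"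
  by (auto simp: mean_op_def site_op_def)

text \<open>A multiple of the identity at one site contributes once per site, hence the factor
  \<open>length xs\<close>.\<close>

lemma sm_affine:
  "length xs = length ys \<Longrightarrow> sm (\<lambda>a b. c * B a b + (if a = b then \<tau> else 0)) xs ys =
    c * sm B xs ys + (if xs = ys then of_nat (length xs) * \<tau> else 0)"
  by (induction xs ys rule: list_induct2) (auto simp: algebra_simps)

text \<open>The error is an inequality for every vector instead of a supremum, so estimates compose
  without separate boundedness arguments.\<close>

definition commuting_approx :: "nat \<Rightarrow> nat \<Rightarrow> (nat \<Rightarrow> nat \<Rightarrow> nat \<Rightarrow> complex) \<Rightarrow> nat \<Rightarrow> real \<Rightarrow> (nat \<Rightarrow> op) \<Rightarrow> bool" where
  "commuting_approx d m A n \<epsilon> Y \<longleftrightarrow>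
     (\<forall>i<m. in_local_alg d n (Y i) \<and> op_selfadjoint (Y i)) \<and>
     (\<forall>i<m. \<forall>j<m. op_mult d n (Y i) (Y j) = op_mult d n (Y j) (Y i)) \<and>
     (\<forall>i<m. \<forall>v. vec_norm d n (op_apply d n (\<lambda>\<sigma> \<tau>. mean_op d n (A i) \<sigma> \<tau> - Y i \<sigma> \<tau>) v) \<le> \<epsilon> * vec_norm d n v)"

context spin
begin

lemma spn_copies_EE: "v \<in> spn (copies (wd d K) (EE N)) \<longleftrightarrow> csupp v \<subseteq> wd d N \<times> wd d K"
proof -
  have "copies (wd d K) (EE N) = del ` (wd d N \<times> wd d K)"
  proof -
    have "emb l (del a) = del (a, l)" for l :: "nat list" and a :: "nat list"
      by (rule fvec_eqI) (auto simp: coord_del)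
    then show ?thesis unfolding copies_def EE_def image_image by auto
  qed
  then show ?thesis by (simp add: spn_del)
qed

text \<open>The mean over all \<open>2 * n + 1\<close> sites is the length-weighted average of the
  means over the first \<open>N\<close> and the last \<open>K\<close>. Both are contractions, so
  keeping only the first, at full weight, costs at most twice the weight of the second. The
  \<open>Y i\<close> commute because all of them are diagonal in \<open>F\<close> and vanish on its
  complement.\<close>

lemma commuting_approx_from_basis:
  assumes NK: "N + K = 2 * n + 1"
    and F: "ons F" "F \<subseteq> spn (copies (wd d K) (EE N))"
      "\<And>i v. i < m \<Longrightarrow> v \<in> spn (copies (wd d K) (EE N)) \<Longrightarrow>
        norm (ampl (wd d K) (X N i) v - diagop F (q i) v) \<le> \<epsilon> * norm v"
  shows "\<exists>Y. commuting_approx d m A n (\<epsilon> + 2 * real K / real (2 * n + 1)) Y"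
proof -
  let ?C = "configs d n"
  let ?S = "wd d N \<times> wd d K"
  define pr where "pr \<sigma> = (take N (cword n \<sigma>), drop N (cword n \<sigma>))" for \<sigma>
  have split_bij: "bij_betw (\<lambda>x. (take N x, drop N x)) (wd d (2 * n + 1)) ?S"
  proof (rule bij_betwI[where g = "\<lambda>(a, b). a @ b"])
    show "(\<lambda>x. (take N x, drop N x)) \<in> wd d (2 * n + 1) \<rightarrow> ?S"
      using NK by (auto simp: wds_def dest: in_set_takeD in_set_dropD)
    show "(\<lambda>(a, b). a @ b) \<in> ?S \<rightarrow> wd d (2 * n + 1)"
      using append_in_wds[of _ "{..<d}" N _ K] NK by auto
  qed (auto simp: wds_def)
  have prb: "bij_betw pr ?C ?S"
    using bij_betw_trans[OF cword_bij split_bij] unfolding pr_def comp_def .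
  have prS: "pr \<sigma> \<in> ?S" if "\<sigma> \<in> ?C" for \<sigma> using prb that by (auto simp: bij_betw_def)
  have reindex: "(\<Sum>\<sigma>\<in>?C. g (pr \<sigma>)) = (\<Sum>x\<in>?S. g x)" for g :: "_ \<Rightarrow> 'z::comm_monoid_add"
    by (rule sum.reindex_bij_betw[OF prb])
  define Y where "Y i \<sigma> \<tau> = (if \<sigma> \<in> ?C \<and> \<tau> \<in> ?C
    then \<Sum>f\<in>F. of_real (q i f) * coord f (pr \<sigma>) * cnj (coord f (pr \<tau>)) else 0)" for i \<sigma> \<tau>
  have suppF: "csupp f \<subseteq> ?S" if "f \<in> F" for f using F(2) that spn_copies_EE by blast
  have orthF: "(\<Sum>\<rho>\<in>?C. cnj (coord f (pr \<rho>)) * coord g (pr \<rho>)) = (if f = g then 1 else 0)"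
    if "f \<in> F" "g \<in> F" for f g
    using onsD[OF F(1) that] cip_coords[OF _ suppF[OF that(1)], of g]
      reindex[of "\<lambda>x. cnj (coord f x) * coord g x"] by simp
  have mult: "op_mult d n (Y i) (Y j) = (\<lambda>\<sigma> \<tau>. if \<sigma> \<in> ?C \<and> \<tau> \<in> ?C
      then \<Sum>f\<in>F. of_real (q i f * q j f) * (coord f (pr \<sigma>) * cnj (coord f (pr \<tau>))) else 0)" for i j
  proof (intro ext)
    fix \<sigma> \<tau>
    show "op_mult d n (Y i) (Y j) \<sigma> \<tau> = (if \<sigma> \<in> ?C \<and> \<tau> \<in> ?C
      then \<Sum>f\<in>F. of_real (q i f * q j f) * (coord f (pr \<sigma>) * cnj (coord f (pr \<tau>))) else 0)"
    proof (cases "\<sigma> \<in> ?C \<and> \<tau> \<in> ?C")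
      case True
      have "op_mult d n (Y i) (Y j) \<sigma> \<tau> = (\<Sum>\<rho>\<in>?C. \<Sum>f\<in>F. \<Sum>g\<in>F.
          (of_real (q i f) * of_real (q j g) * coord f (pr \<sigma>) * cnj (coord g (pr \<tau>))) * (cnj (coord f (pr \<rho>)) * coord g (pr \<rho>)))"
        unfolding op_mult_def Y_def using True
        by (intro sum.cong refl) (simp add: sum_product, intro sum.cong refl, simp add: mult_ac)
      also have "\<dots> = (\<Sum>f\<in>F. \<Sum>g\<in>F. \<Sum>\<rho>\<in>?C.
          (of_real (q i f) * of_real (q j g) * coord f (pr \<sigma>) * cnj (coord g (pr \<tau>))) * (cnj (coord f (pr \<rho>)) * coord g (pr \<rho>)))"
        by (subst sum.swap) (intro sum.cong refl sum.swap)
      also have "\<dots> = (\<Sum>f\<in>F. \<Sum>g\<in>F. if f = g then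
          of_real (q i f) * of_real (q j g) * coord f (pr \<sigma>) * cnj (coord g (pr \<tau>)) else 0)"
        using orthF by (intro sum.cong refl) (simp flip: sum_distrib_left)
      also have "\<dots> = (\<Sum>f\<in>F. of_real (q i f * q j f) * (coord f (pr \<sigma>) * cnj (coord f (pr \<tau>))))"
        using ons_finite[OF F(1)] by (intro sum.cong refl) (simp add: mult_ac)
      finally show ?thesis using True by simp
    next
      case False
      then show ?thesis by (auto simp: op_mult_def Y_def intro!: sum.neutral)
    qed
  qed
  have comm: "op_mult d n (Y i) (Y j) = op_mult d n (Y j) (Y i)" for i j
    unfolding mult by (simp only: mult.commute[of "q i _"])
  have loc: "in_local_alg d n (Y i)" for i by (auto simp: in_local_alg_def Y_def)
  have sa: "op_selfadjoint (Y i)" for i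
    by (auto simp: op_selfadjoint_def op_adjoint_def Y_def fun_eq_iff mult_ac)
  have "vec_norm d n (op_apply d n (\<lambda>\<sigma> \<tau>. mean_op d n (A i) \<sigma> \<tau> - Y i \<sigma> \<tau>) v)
      \<le> (\<epsilon> + 2 * real K / real (2 * n + 1)) * vec_norm d n v" if i: "i < m" for i v
  proof -
    define M where "M = 2 * n + 1"
    \<comment> \<open>The vector \<open>v\<close> moved to pairs of words. Its values outside
      \<open>configs\<close> are dropped, as they are by \<open>op_apply\<close> and
      \<open>vec_norm\<close>.\<close>
    define u where "u = mkv ?S (\<lambda>x. v (the_inv_into ?C pr x))"
    have fS: "finite ?S" by simp
    have uv: "coord u (pr \<sigma>) = v \<sigma>" if "\<sigma> \<in> ?C" for \<sigma>
      using that prS[OF that] the_inv_into_f_f[of pr ?C \<sigma>] prb by (simp add: u_def coord_mkv bij_betw_def)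
    have uS: "csupp u \<subseteq> ?S" by (simp add: u_def csupp_mkv)
    then have uspn: "u \<in> spn (copies (wd d K) (EE N))" by (simp add: spn_copies_EE)
    have vn: "vec_norm d n g = norm w" if "csupp w \<subseteq> ?S" "\<And>\<sigma>. \<sigma> \<in> ?C \<Longrightarrow> g \<sigma> = coord w (pr \<sigma>)" for g w
    proof -
      have "(norm w)\<^sup>2 = (\<Sum>\<sigma>\<in>?C. (cmod (coord w (pr \<sigma>)))\<^sup>2)"
        using norm_coords[OF fS that(1)] reindex[of "\<lambda>x. (cmod (coord w x))\<^sup>2"] by simp
      also have "\<dots> = (\<Sum>\<sigma>\<in>?C. (cmod (g \<sigma>))\<^sup>2)" using that(2) by simp
      finally show ?thesis unfolding vec_norm_def by (metis norm_ge_zero real_sqrt_unique)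
    qed
    have nu: "vec_norm d n v = norm u" using uS uv by (intro vn) auto
    define T where "T = ampl (wd d K) (X N i) u"
    \<comment> \<open>\<open>s2 a\<close> is the slice of \<open>u\<close> with first part
      \<open>a\<close>; \<open>Rv\<close> is the mean over the last \<open>K\<close> sites, tensored
      with the identity, applied to \<open>u\<close>, just as \<open>T\<close> is for the first
      \<open>N\<close>.\<close>
    define s2 where "s2 a = mkv (wd d K) (\<lambda>b. coord u (a, b))" for a
    define Rv where "Rv = mkv ?S (\<lambda>(a, b). coord (X K i (s2 a)) b)"
    have Tn: "norm T \<le> 1 * norm u"
      unfolding T_def using norm_X_le[OF i] by (intro norm_ampl_le) auto
    have Rn: "norm Rv \<le> norm u"
    proof -
      have "(norm Rv)\<^sup>2 = (\<Sum>x\<in>?S. (cmod (coord Rv x))\<^sup>2)"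
        by (rule norm_coords[OF fS]) (simp add: Rv_def csupp_mkv)
      also have "\<dots> = (\<Sum>a\<in>wd d N. \<Sum>b\<in>wd d K. (cmod (coord (X K i (s2 a)) b))\<^sup>2)"
        unfolding sum.cartesian_product by (intro sum.cong refl) (auto simp: Rv_def coord_mkv[OF fS])
      also have "\<dots> = (\<Sum>a\<in>wd d N. (norm (X K i (s2 a)))\<^sup>2)" by (simp add: norm_EE[OF X_spn])
      also have "\<dots> \<le> (\<Sum>a\<in>wd d N. (norm (s2 a))\<^sup>2)" using norm_X_le[OF i] by (intro sum_mono power_mono) auto
      also have "\<dots> = (\<Sum>a\<in>wd d N. \<Sum>b\<in>wd d K. (cmod (coord u (a, b)))\<^sup>2)"
      proof (rule sum.cong[OF refl])
        fix a
        have "s2 a \<in> spn (EE K)" by (simp add: s2_def spn_EE csupp_mkv)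
        from norm_EE[OF this] show "(norm (s2 a))\<^sup>2 = (\<Sum>b\<in>wd d K. (cmod (coord u (a, b)))\<^sup>2)"
          by (simp add: s2_def coord_mkv)
      qed
      also have "\<dots> = (norm u)\<^sup>2"
        using norm_coords[OF fS uS] by (simp add: sum.cartesian_product case_prod_beta)
      finally show ?thesis by (rule power2_le_imp_le) simp
    qed
    define w where "w = csc (of_real (real N / real M)) T + csc (of_real (real K / real M)) Rv - diagop F (q i) u"
    have Tsupp: "csupp T \<subseteq> ?S"
      using ampl_in_spn[OF ons_EE, of "wd d K" "X N i" u N] X_spn by (simp add: T_def flip: spn_copies_EE)
    have Dsupp: "csupp (diagop F (q i) u) \<subseteq> ?S"
      unfolding spn_copies_EE[symmetric] diagop_def using F(2) by (intro csub_sum[OF csub_spn] csub_csc[OF csub_spn]) auto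
    have Rsupp: "csupp Rv \<subseteq> ?S" by (simp add: Rv_def csupp_mkv)
    have wsupp: "csupp w \<subseteq> ?S"
      using Tsupp Dsupp Rsupp
      unfolding spn_copies_EE[symmetric] w_def
      by (intro csub_diff[OF csub_spn] csub_add[OF csub_spn] csub_csc[OF csub_spn])
    have wv: "op_apply d n (\<lambda>\<sigma> \<tau>. mean_op d n (A i) \<sigma> \<tau> - Y i \<sigma> \<tau>) v \<sigma> = coord w (pr \<sigma>)" if s: "\<sigma> \<in> ?C" for \<sigma>
    proof -
      obtain a b where ab: "pr \<sigma> = (a, b)" by fastforce
      have abS: "a \<in> wd d N" "b \<in> wd d K" using prS[OF s] ab by auto
      have cw: "cword n \<tau> = fst (pr \<tau>) @ snd (pr \<tau>)" for \<tau> by (simp add: pr_def)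
      have sX: "(\<Sum>y\<in>wd d n. sm (A i) c y * g y) = of_nat n * (\<Sum>y\<in>wd d n. sm (A i) c y / of_nat n * g y)"
        if "c \<in> wd d n" for n c and g :: "nat list \<Rightarrow> complex"
        using that by (cases "n = 0") (auto simp: sum_distrib_left)
      have "(\<Sum>\<tau>\<in>?C. mean_op d n (A i) \<sigma> \<tau> * v \<tau>) = (\<Sum>\<tau>\<in>?C. sm (A i) (a @ b) (fst (pr \<tau>) @ snd (pr \<tau>)) * coord u (pr \<tau>) / of_nat M)"
      proof (rule sum.cong[OF refl])
        fix \<tau> assume t: "\<tau> \<in> ?C"
        have "cword n \<sigma> = a @ b" using cw[of \<sigma>] ab by simp
        then show "mean_op d n (A i) \<sigma> \<tau> * v \<tau> = sm (A i) (a @ b) (fst (pr \<tau>) @ snd (pr \<tau>)) * coord u (pr \<tau>) / of_nat M"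
          by (simp add: mean_op_sm[OF s t] uv[OF t] M_def flip: cw)
      qed
      also have "\<dots> = (\<Sum>(a', b')\<in>?S. sm (A i) (a @ b) (a' @ b') * coord u (a', b') / of_nat M)"
        using reindex[of "\<lambda>x. sm (A i) (a @ b) (fst x @ snd x) * coord u x / of_nat M"] by (simp add: case_prod_beta)
      also have "\<dots> = (\<Sum>a'\<in>wd d N. \<Sum>b'\<in>wd d K. (if b = b' then sm (A i) a a' * coord u (a', b) else 0)
          + (if a = a' then sm (A i) b b' * coord u (a, b') else 0)) / of_nat M"
        unfolding sum.cartesian_product[symmetric] sum_divide_distrib
      proof (intro sum.cong refl)
        fix a' b' assume "a' \<in> wd d N" "b' \<in> wd d K"
        then have "length a = length a'" using abS by (simp add: wds_def)
        then show "sm (A i) (a @ b) (a' @ b') * coord u (a', b') / of_nat M =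
            ((if b = b' then sm (A i) a a' * coord u (a', b) else 0)
          + (if a = a' then sm (A i) b b' * coord u (a, b') else 0)) / of_nat M"
          by (simp add: sm_append distrib_right)
      qed
      also have "\<dots> = ((\<Sum>a'\<in>wd d N. sm (A i) a a' * coord u (a', b)) + (\<Sum>b'\<in>wd d K. sm (A i) b b' * coord u (a, b'))) / of_nat M"
      proof -
        have "(\<Sum>a'\<in>wd d N. \<Sum>b'\<in>wd d K. if a = a' then sm (A i) b b' * coord u (a, b') else 0) =
            (\<Sum>b'\<in>wd d K. sm (A i) b b' * coord u (a, b'))"
          by (subst sum.swap) (simp add: abS)
        then show ?thesis by (simp add: sum.distrib abS)
      qed
      also have "(\<Sum>a'\<in>wd d N. sm (A i) a a' * coord u (a', b)) = of_nat N * coord T (a, b)"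
      proof -
        have "coord T (a, b) = coord (slice b T) a" by simp
        also have "slice b T = X N i (slice b u)" using abS by (simp add: T_def slice_ampl)
        finally show ?thesis unfolding sX[OF abS(1)] using abS by (simp add: X_def coord_mop)
      qed
      also have "(\<Sum>b'\<in>wd d K. sm (A i) b b' * coord u (a, b')) = of_nat K * coord Rv (a, b)"
        unfolding sX[OF abS(2)] using abS by (simp add: Rv_def coord_mkv[OF fS] X_def coord_mop s2_def coord_mkv)
      finally have mean: "(\<Sum>\<tau>\<in>?C. mean_op d n (A i) \<sigma> \<tau> * v \<tau>) = (of_nat N * coord T (a, b) + of_nat K * coord Rv (a, b)) / of_nat M" .
      have "(\<Sum>\<tau>\<in>?C. Y i \<sigma> \<tau> * v \<tau>) = (\<Sum>\<tau>\<in>?C. \<Sum>f\<in>F. of_real (q i f) * coord f (a, b) * (cnj (coord f (pr \<tau>)) * coord u (pr \<tau>)))"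
        using s uv by (intro sum.cong refl) (simp add: Y_def sum_distrib_left sum_distrib_right mult_ac ab)
      also have "\<dots> = (\<Sum>f\<in>F. of_real (q i f) * coord f (a, b) * (\<Sum>\<tau>\<in>?C. cnj (coord f (pr \<tau>)) * coord u (pr \<tau>)))"
        by (subst sum.swap) (simp add: sum_distrib_left)
      also have "\<dots> = (\<Sum>f\<in>F. of_real (q i f) * coord f (a, b) * cip f u)"
        using cip_coords[OF fS suppF] reindex[of "\<lambda>x. cnj (coord _ x) * coord u x"] by (intro sum.cong refl) simp
      also have "\<dots> = coord (diagop F (q i) u) (a, b)" by (simp add: diagop_def mult_ac)
      finally have Yv: "(\<Sum>\<tau>\<in>?C. Y i \<sigma> \<tau> * v \<tau>) = coord (diagop F (q i) u) (a, b)" .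
      have "op_apply d n (\<lambda>\<sigma> \<tau>. mean_op d n (A i) \<sigma> \<tau> - Y i \<sigma> \<tau>) v \<sigma> =
          (\<Sum>\<tau>\<in>?C. mean_op d n (A i) \<sigma> \<tau> * v \<tau>) - (\<Sum>\<tau>\<in>?C. Y i \<sigma> \<tau> * v \<tau>)"
        by (simp add: op_apply_def left_diff_distrib sum_subtractf)
      then show ?thesis unfolding mean Yv ab by (simp add: w_def add_divide_distrib)
    qed
    have "vec_norm d n (op_apply d n (\<lambda>\<sigma> \<tau>. mean_op d n (A i) \<sigma> \<tau> - Y i \<sigma> \<tau>) v) = norm w"
      using wsupp wv by (rule vn)
    also have "w = (T - diagop F (q i) u) + (csc (of_real (real K / real M)) Rv - csc (of_real (real K / real M)) T)"
    proof -
      have "real N / real M = 1 - real K / real M" using NK by (simp add: M_def field_simps)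
      then have "csc (of_real (real N / real M)) T = T - csc (of_real (real K / real M)) T"
        by (simp only: of_real_diff csc_diff_left) simp
      then show ?thesis by (simp add: w_def)
    qed
    also have "norm \<dots> \<le> \<epsilon> * norm u + (real K / real M * norm u + real K / real M * norm u)"
    proof (rule norm_triangle_mono)
      show "norm (T - diagop F (q i) u) \<le> \<epsilon> * norm u" unfolding T_def by (rule F(3)[OF i uspn])
      have "norm (csc (of_real (real K / real M)) Rv) \<le> real K / real M * norm u"
        unfolding norm_csc norm_of_real using Rn by (simp add: divide_right_mono mult_left_mono)
      moreover have "norm (csc (of_real (real K / real M)) T) \<le> real K / real M * norm u"
        unfolding norm_csc norm_of_real using Tn by (simp add: divide_right_mono mult_left_mono)
      ultimately show "norm (csc (of_real (real K / real M)) Rv - csc (of_real (real K / real M)) T)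
          \<le> real K / real M * norm u + real K / real M * norm u"
        by (rule order_trans[OF norm_triangle_ineq4 add_mono])
    qed
    also have "\<dots> = (\<epsilon> + 2 * real K / real (2 * n + 1)) * vec_norm d n v"
      unfolding nu M_def by (simp add: algebra_simps)
    finally show ?thesis .
  qed
  then show ?thesis unfolding commuting_approx_def using loc sa comm by blast
qed

lemma commuting_approx_eventually:
  assumes d2: "2 \<le> d" and eps: "0 < \<epsilon>"
  shows "\<exists>n0. \<forall>n\<ge>n0. \<exists>Y. commuting_approx d m A n \<epsilon> Y"
proof -
  obtain K1 N2 where core: "\<And>N'. N2 \<le> N' \<Longrightarrow> \<exists>N K. N + K = N' \<and> K \<le> K1 \<and>
    (\<exists>F q. ons F \<and> F \<subseteq> spn (copies (wd d K) (EE N)) \<and>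
      (\<forall>i<m. \<forall>v\<in>spn (copies (wd d K) (EE N)). norm (ampl (wd d K) (X N i) v - diagop F (q i) v) \<le> \<epsilon> / 2 * norm v))"
    using core[OF d2, of "\<epsilon> / 2"] eps by auto
  \<comment> \<open>Since \<open>K \<le> K1\<close> does not grow with the chain, the cost of the
    left-out sites falls below \<open>\<epsilon> / 2\<close>.\<close>
  define n1 where "n1 = nat \<lceil>4 * real K1 / \<epsilon>\<rceil>"
  have n1: "4 * real K1 / \<epsilon> \<le> real n1" unfolding n1_def by linarith
  have "\<exists>Y. commuting_approx d m A n \<epsilon> Y" if n: "N2 + n1 \<le> n" for n
  proof -
    have "N2 \<le> 2 * n + 1" using n by simp
    from core[OF this] obtain N K F q where *: "N + K = 2 * n + 1" "K \<le> K1" "ons F"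
      "F \<subseteq> spn (copies (wd d K) (EE N))"
      "\<forall>i<m. \<forall>v\<in>spn (copies (wd d K) (EE N)). norm (ampl (wd d K) (X N i) v - diagop F (q i) v) \<le> \<epsilon> / 2 * norm v"
      by blast
    obtain Y where Y: "commuting_approx d m A n (\<epsilon> / 2 + 2 * real K / real (2 * n + 1)) Y"
      using commuting_approx_from_basis[OF *(1,3,4), of q "\<epsilon> / 2"] *(5) by blast
    have "4 * real K1 / \<epsilon> \<le> real (2 * n + 1)" using n1 n by linarith
    then have "4 * real K1 \<le> \<epsilon> * real (2 * n + 1)" using eps by (simp add: field_simps)
    moreover have "real K \<le> real K1" using *(2) by simp
    ultimately have "4 * real K \<le> \<epsilon> * real (2 * n + 1)" by linarith
    then have le: "\<epsilon> / 2 + 2 * real K / real (2 * n + 1) \<le> \<epsilon>" by (simp add: field_simps)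
    have nn: "0 \<le> vec_norm d n v" for v by (simp add: vec_norm_def sum_nonneg)
    have "commuting_approx d m A n \<epsilon> Y"
      using Y mult_right_mono[OF le nn] unfolding commuting_approx_def by (meson order_trans)
    then show ?thesis by blast
  qed
  then show ?thesis by blast
qed

end

section \<open>Reduction to matrices of trace zero with eigenvalues in the unit interval around
  0\<close>

lemma vec_norm_nonneg: "0 \<le> vec_norm d n v"
  by (simp add: vec_norm_def sum_nonneg)

lemma vec_norm_scale: "vec_norm d n (\<lambda>\<sigma>. c * g \<sigma>) = cmod c * vec_norm d n g"
  unfolding vec_norm_def
  by (simp add: norm_mult power_mult_distrib real_sqrt_mult flip: sum_distrib_left)

text \<open>Adding a scalar matrix adds the same scalar to the mean and does not affect commutation;
  scaling by \<open>c\<close> scales the error.\<close>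

lemma commuting_approx_affine:
  assumes Y: "commuting_approx d m B n \<epsilon> Y"
    and A: "\<And>i a b. i < m \<Longrightarrow> A i a b = of_real c * B i a b + (if a = b then of_real (\<tau> i) else 0)"
    and c: "0 < c"
  shows "\<exists>Y. commuting_approx d m A n (c * \<epsilon>) Y"
proof -
  let ?C = "configs d n"
  define W where "W i \<sigma> \<rho> = of_real c * Y i \<sigma> \<rho> + (if \<sigma> = \<rho> \<and> \<sigma> \<in> ?C then of_real (\<tau> i) else 0)" for i \<sigma> \<rho>
  have loc: "in_local_alg d n (W i)" if "i < m" for i
    using Y that by (auto simp: commuting_approx_def in_local_alg_def W_def)
  have sa: "op_selfadjoint (W i)" if "i < m" for i
  proof -
    have "op_adjoint (Y i) = Y i" using Y that by (simp add: commuting_approx_def op_selfadjoint_def)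
    then have "cnj (Y i \<rho> \<sigma>) = Y i \<sigma> \<rho>" for \<sigma> \<rho>
      unfolding op_adjoint_def by (rule fun_cong[OF fun_cong])
    then show ?thesis unfolding op_selfadjoint_def op_adjoint_def W_def by (intro ext) auto
  qed
  have mult: "op_mult d n (W i) (W j) \<sigma> \<rho> = (of_real c)\<^sup>2 * op_mult d n (Y i) (Y j) \<sigma> \<rho> +
      (of_real c * of_real (\<tau> j) * Y i \<sigma> \<rho> + of_real c * of_real (\<tau> i) * Y j \<sigma> \<rho>)
      + (if \<sigma> = \<rho> \<and> \<sigma> \<in> ?C then of_real (\<tau> i) * of_real (\<tau> j) else 0)" if ij: "i < m" "j < m" for i j \<sigma> \<rho>
  proof -
    have Y0: "Y k \<sigma> \<rho> = 0" if "k < m" "\<sigma> \<notin> ?C \<or> \<rho> \<notin> ?C" for k \<sigma> \<rho>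
      using Y that by (auto simp: commuting_approx_def in_local_alg_def)
    have "W i \<sigma> \<kappa> * W j \<kappa> \<rho> = (of_real c)\<^sup>2 * (Y i \<sigma> \<kappa> * Y j \<kappa> \<rho>)
        + ((if \<kappa> = \<rho> then (if \<rho> \<in> ?C then of_real c * of_real (\<tau> j) * Y i \<sigma> \<rho> else 0) else 0)
        + (if \<kappa> = \<sigma> then (if \<sigma> \<in> ?C then of_real c * of_real (\<tau> i) * Y j \<sigma> \<rho> else 0) else 0))
        + (if \<kappa> = \<sigma> then (if \<sigma> = \<rho> \<and> \<sigma> \<in> ?C then of_real (\<tau> i) * of_real (\<tau> j) else 0) else 0)" for \<kappa>
      by (auto simp: W_def power2_eq_square algebra_simps)
    then have "op_mult d n (W i) (W j) \<sigma> \<rho> = (of_real c)\<^sup>2 * op_mult d n (Y i) (Y j) \<sigma> \<rho>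
        + ((if \<rho> \<in> ?C then of_real c * of_real (\<tau> j) * Y i \<sigma> \<rho> else 0)
        + (if \<sigma> \<in> ?C then of_real c * of_real (\<tau> i) * Y j \<sigma> \<rho> else 0))
        + (if \<sigma> = \<rho> \<and> \<sigma> \<in> ?C then of_real (\<tau> i) * of_real (\<tau> j) else 0)"
      by (simp add: op_mult_def sum.distrib sum_distrib_left) auto
    then show ?thesis using Y0[OF ij(1)] Y0[OF ij(2)] by simp
  qed
  have comm: "op_mult d n (W i) (W j) = op_mult d n (W j) (W i)" if ij: "i < m" "j < m" for i j
  proof (intro ext)
    fix \<sigma> \<rho>
    have "op_mult d n (Y i) (Y j) = op_mult d n (Y j) (Y i)" using Y ij by (simp add: commuting_approx_def)
    then show "op_mult d n (W i) (W j) \<sigma> \<rho> = op_mult d n (W j) (W i) \<sigma> \<rho>"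
      unfolding mult[OF ij] mult[OF ij(2,1)] by (auto simp: mult.commute)
  qed
  have "vec_norm d n (op_apply d n (\<lambda>\<sigma> \<rho>. mean_op d n (A i) \<sigma> \<rho> - W i \<sigma> \<rho>) v) \<le> c * \<epsilon> * vec_norm d n v"
    if i: "i < m" for i v
  proof -
    have "mean_op d n (A i) \<sigma> \<rho> - W i \<sigma> \<rho> = of_real c * (mean_op d n (B i) \<sigma> \<rho> - Y i \<sigma> \<rho>)"
      if s: "\<sigma> \<in> ?C" "\<rho> \<in> ?C" for \<sigma> \<rho>
    proof -
      have Ai: "A i = (\<lambda>a b. of_real c * B i a b + (if a = b then of_real (\<tau> i) else 0))"
        using A[OF i] by (intro ext)
      have "cword n \<sigma> = cword n \<rho> \<longleftrightarrow> \<sigma> = \<rho>"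
        using cword_bij[of n d] s by (auto simp: bij_betw_def inj_on_def)
      then have "sm (A i) (cword n \<sigma>) (cword n \<rho>) = of_real c * sm (B i) (cword n \<sigma>) (cword n \<rho>) +
          (if \<sigma> = \<rho> then of_nat (2 * n + 1) * of_real (\<tau> i) else 0)"
        unfolding Ai by (subst sm_affine) (simp_all add: length_cword del: of_nat_Suc)
      then show ?thesis
        using s by (simp add: mean_op_sm W_def add_divide_distrib right_diff_distrib del: of_nat_add of_nat_mult of_nat_Suc)
    qed
    then have "op_apply d n (\<lambda>\<sigma> \<rho>. mean_op d n (A i) \<sigma> \<rho> - W i \<sigma> \<rho>) v \<sigma> =
        of_real c * op_apply d n (\<lambda>\<sigma> \<rho>. mean_op d n (B i) \<sigma> \<rho> - Y i \<sigma> \<rho>) v \<sigma>" if "\<sigma> \<in> ?C" for \<sigma>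
      unfolding op_apply_def sum_distrib_left using that by (intro sum.cong refl) simp
    then have "vec_norm d n (op_apply d n (\<lambda>\<sigma> \<rho>. mean_op d n (A i) \<sigma> \<rho> - W i \<sigma> \<rho>) v) =
        vec_norm d n (\<lambda>\<sigma>. of_real c * op_apply d n (\<lambda>\<sigma> \<rho>. mean_op d n (B i) \<sigma> \<rho> - Y i \<sigma> \<rho>) v \<sigma>)"
      unfolding vec_norm_def by (intro arg_cong[where f = sqrt] sum.cong refl) simp
    also have "\<dots> = c * vec_norm d n (op_apply d n (\<lambda>\<sigma> \<rho>. mean_op d n (B i) \<sigma> \<rho> - Y i \<sigma> \<rho>) v)"
      using c by (simp add: vec_norm_scale)
    also have "\<dots> \<le> c * (\<epsilon> * vec_norm d n v)"
      using Y i c unfolding commuting_approx_def by (intro mult_left_mono) auto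
    finally show ?thesis by simp
  qed
  then show ?thesis unfolding commuting_approx_def using loc sa comm by blast
qed

text \<open>For \<open>d = 1\<close> left-out sites give no additional labels, but all operators are
  scalars and the means themselves commute. Otherwise the matrices are normalised to fit the locale
  \<open>spin\<close>.\<close>

lemma commuting_approx_exists:
  assumes d: "1 \<le> d" and A: "\<And>i. i < m \<Longrightarrow> mat_selfadjoint d (A i)" and eps: "0 < \<epsilon>"
  shows "\<exists>n0. \<forall>n\<ge>n0. \<exists>Y. commuting_approx d m A n \<epsilon> Y"
proof (cases "d = 1")
  case True
  have C1: "configs d n = {\<lambda>_. 0}" for n
  proof -
    have "\<sigma> k = 0" if "\<sigma> \<in> configs d n" for \<sigma> k
      using that True by (cases "\<bar>k\<bar> \<le> int n") (simp_all add: configs_def)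
    then have "\<sigma> = (\<lambda>_. 0)" if "\<sigma> \<in> configs d n" for \<sigma>
      using that by (intro ext)
    moreover have "(\<lambda>_. 0) \<in> configs d n" using True by (simp add: configs_def)
    ultimately show ?thesis by blast
  qed
  have "commuting_approx d m A n \<epsilon> (\<lambda>i. mean_op d n (A i))" for n
    unfolding commuting_approx_def
  proof (intro conjI allI impI)
    fix i assume i: "i < m"
    show "in_local_alg d n (mean_op d n (A i))" using mean_op_outside by (auto simp: in_local_alg_def)
    have "A i 0 0 = cnj (A i 0 0)" using A[OF i] True by (auto simp: mat_selfadjoint_def)
    then have "cnj (site_op d n j (A i) \<tau> \<sigma>) = site_op d n j (A i) \<sigma> \<tau>" for j \<sigma> \<tau>
      by (auto simp: site_op_def C1)
    then show "op_selfadjoint (mean_op d n (A i))"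
      by (auto simp: op_selfadjoint_def op_adjoint_def mean_op_def)
    show "vec_norm d n (op_apply d n (\<lambda>\<sigma> \<tau>. mean_op d n (A i) \<sigma> \<tau> - mean_op d n (A i) \<sigma> \<tau>) v) \<le> \<epsilon> * vec_norm d n v" for v
      using eps vec_norm_nonneg[of d n v] by (simp add: op_apply_def vec_norm_def)
  next
    fix i j
    have "mean_op d n (A i) \<sigma> \<tau> = 0" if "\<sigma> \<noteq> (\<lambda>_. 0) \<or> \<tau> \<noteq> (\<lambda>_. 0)" for i \<sigma> \<tau>
      using mean_op_outside[of \<sigma> d n \<tau> "A i"] that C1 by auto
    then have "mean_op d n (A i) \<sigma> (\<lambda>_. 0) * mean_op d n (A j) (\<lambda>_. 0) \<tau> =
        mean_op d n (A j) \<sigma> (\<lambda>_. 0) * mean_op d n (A i) (\<lambda>_. 0) \<tau>" for \<sigma> \<tau>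
      by (cases "\<sigma> = (\<lambda>_. 0) \<and> \<tau> = (\<lambda>_. 0)") auto
    then show "op_mult d n (mean_op d n (A i)) (mean_op d n (A j)) = op_mult d n (mean_op d n (A j)) (mean_op d n (A i))"
      by (simp add: op_mult_def C1)
  qed
  then show ?thesis by blast
next
  case False
  then have d2: "2 \<le> d" using d by simp
  define good where "good i p \<longleftrightarrow> (\<forall>a<d. \<forall>b<d. (\<Sum>s<d. cnj (fst p s a) * fst p s b) = (if a = b then 1 else 0)) \<and>
    (\<forall>s<d. \<forall>t<d. (\<Sum>a<d. fst p s a * cnj (fst p t a)) = (if s = t then 1 else 0)) \<and>
    (\<forall>s<d. \<forall>a<d. (\<Sum>t<d. A i s t * fst p t a) = complex_of_real (snd p a) * fst p s a)"
    for i and p :: "(nat \<Rightarrow> nat \<Rightarrow> complex) \<times> (nat \<Rightarrow> real)"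
  define ch where "ch i = (SOME p. good i p)" for i
  have ch: "good i (ch i)" if i: "i < m" for i
  proof -
    obtain U l where "good i (U, l)"
      unfolding good_def fst_conv snd_conv using matrix_eigenbasis[OF A[OF i]] by auto
    then have "\<exists>p. good i p" by blast
    then show ?thesis unfolding ch_def by (rule someI_ex)
  qed
  define U where "U i = fst (ch i)" for i
  define l where "l i = snd (ch i)" for i
  \<comment> \<open>The normalised trace, that is, the average of the eigenvalues.\<close>
  define \<tau> where "\<tau> i = (\<Sum>a<d. l i a) / real d" for i
  \<comment> \<open>A common bound for all shifted eigenvalues; the summand 1 keeps it positive even
    if every matrix is scalar.\<close>
  define c where "c = 1 + (\<Sum>i<m. \<Sum>a<d. \<bar>l i a - \<tau> i\<bar>)"
  have c: "0 < c" unfolding c_def by (intro add_pos_nonneg sum_nonneg) auto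
  define B where "B i a b = (A i a b - (if a = b then of_real (\<tau> i) else 0)) / of_real c" for i a b
  interpret spin d m B U "\<lambda>i a. (l i a - \<tau> i) / c"
  proof
    fix i assume i: "i < m"
    note ch' = ch[OF i, unfolded good_def, folded U_def l_def]
    show "B i a b = cnj (B i b a)" if "a < d" "b < d" for a b
    proof -
      have "A i a b = cnj (A i b a)" using A[OF i] that unfolding mat_selfadjoint_def by blast
      then show ?thesis by (simp add: B_def)
    qed
    show "(\<Sum>s<d. cnj (U i s a) * U i s b) = (if a = b then 1 else 0)" if "a < d" "b < d" for a b
      using ch' that by blast
    show "(\<Sum>a<d. U i s a * cnj (U i t a)) = (if s = t then 1 else 0)" if "s < d" "t < d" for s t
      using ch' that by blast
    show "(\<Sum>t<d. B i s t * U i t a) = of_real ((l i a - \<tau> i) / c) * U i s a" if "s < d" "a < d" for s a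
    proof -
      have "(\<Sum>t<d. B i s t * U i t a) = ((\<Sum>t<d. A i s t * U i t a) - (\<Sum>t<d. if s = t then of_real (\<tau> i) * U i t a else 0)) / of_real c"
        unfolding sum_subtractf[symmetric] sum_divide_distrib
        by (intro sum.cong refl) (simp add: B_def left_diff_distrib)
      also have "(\<Sum>t<d. A i s t * U i t a) = complex_of_real (l i a) * U i s a" using ch' that by blast
      finally show ?thesis using that by (simp add: left_diff_distrib)
    qed
    show "\<bar>(l i a - \<tau> i) / c\<bar> \<le> 1" if "a < d" for a
    proof -
      have "\<bar>l i a - \<tau> i\<bar> \<le> (\<Sum>a<d. \<bar>l i a - \<tau> i\<bar>)" using that by (intro member_le_sum) auto
      also have "\<dots> \<le> (\<Sum>i<m. \<Sum>a<d. \<bar>l i a - \<tau> i\<bar>)"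
        using i by (intro member_le_sum[of i]) (auto intro!: sum_nonneg)
      finally show ?thesis using c by (simp add: c_def)
    qed
    show "(\<Sum>a<d. (l i a - \<tau> i) / c) = 0"
    proof -
      have "(\<Sum>a<d. (l i a - \<tau> i) / c) = ((\<Sum>a<d. l i a) - real d * \<tau> i) / c"
        by (simp add: sum_subtractf flip: sum_divide_distrib)
      then show ?thesis using d by (simp add: \<tau>_def)
    qed
  qed (rule d)
  obtain n0 where n0: "\<And>n. n0 \<le> n \<Longrightarrow> \<exists>Y. commuting_approx d m B n (\<epsilon> / c) Y"
    using commuting_approx_eventually[OF d2, of "\<epsilon> / c"] eps c by auto
  have "\<exists>Y. commuting_approx d m A n \<epsilon> Y" if n: "n0 \<le> n" for n
  proof -
    obtain Y where "commuting_approx d m B n (\<epsilon> / c) Y" using n0[OF n] by blast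
    then have "\<exists>Y. commuting_approx d m A n (c * (\<epsilon> / c)) Y"
      by (rule commuting_approx_affine[where \<tau> = \<tau>]) (use c in \<open>auto simp: B_def\<close>)
    then show ?thesis using c by simp
  qed
  then show ?thesis by blast
qed

section \<open>From vectorwise bounds to the operator norm, and the diagonal choice of
  approximations\<close>

lemma op_norm_bounds:
  assumes "\<And>v. vec_norm d n (op_apply d n X v) \<le> \<epsilon> * vec_norm d n v" "0 \<le> \<epsilon>"
  shows "0 \<le> op_norm d n X" "op_norm d n X \<le> \<epsilon>"
proof -
  let ?S = "{vec_norm d n (op_apply d n X v) | v. vec_norm d n v \<le> 1}"
  have b: "x \<le> \<epsilon>" if x: "x \<in> ?S" for x
  proof -
    obtain v where v: "x = vec_norm d n (op_apply d n X v)" "vec_norm d n v \<le> 1" using x by blast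
    have "\<epsilon> * vec_norm d n v \<le> \<epsilon> * 1" using v assms(2) by (intro mult_left_mono) auto
    then show ?thesis using assms(1)[of v] v by simp
  qed
  \<comment> \<open>The zero vector makes the set nonempty, without which its supremum could not be
    estimated.\<close>
  have "vec_norm d n (\<lambda>_. 0) \<le> 1" by (simp add: vec_norm_def)
  then have z: "vec_norm d n (op_apply d n X (\<lambda>_. 0)) \<in> ?S" by blast
  show "op_norm d n X \<le> \<epsilon>" unfolding op_norm_def using z b by (intro cSup_least) auto
  have "vec_norm d n (op_apply d n X (\<lambda>_. 0)) \<le> op_norm d n X"
    unfolding op_norm_def using b z by (intro cSup_upper) (auto intro!: bdd_aboveI)
  then show "0 \<le> op_norm d n X" using vec_norm_nonneg order_trans by blast
qed

theorem theorem1p1: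
  fixes d m :: nat and A :: "nat \<Rightarrow> nat \<Rightarrow> nat \<Rightarrow> complex"
  assumes "d \<ge> 1" and "m \<ge> 1"
    and "\<forall>i\<in>{1..m}. mat_selfadjoint d (A i)"
  shows "\<exists>Y :: nat \<Rightarrow> nat \<Rightarrow> op.
     (\<forall>i\<in>{1..m}. \<forall>n. in_local_alg d n (Y i n) \<and> op_selfadjoint (Y i n)) \<and>
     (\<forall>i\<in>{1..m}. (\<lambda>n. op_norm d n (\<lambda>\<sigma> \<tau>. mean_op d n (A i) \<sigma> \<tau> - Y i n \<sigma> \<tau>))
                     \<longlonglongrightarrow> 0) \<and>
     (\<forall>i\<in>{1..m}. \<forall>j\<in>{1..m}. \<forall>n. op_mult d n (Y i n) (Y j n) = op_mult d n (Y j n) (Y i n))"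
proof -
  \<comment> \<open>Matrices are numbered from 1 in the theorem and from 0 in the
    construction.\<close>
  let ?A = "\<lambda>i. A (Suc i)"
  let ?P = "\<lambda>n k Y. commuting_approx d m ?A n (1 / real (Suc k)) Y"
  \<comment> \<open>The approximation used at \<open>n\<close> has the best quality
    \<open>1 / (k + 1)\<close> available with \<open>k \<le> n\<close>. The cutoff makes
    \<open>S n\<close> finite, so a maximum exists, and every \<open>k\<close> belongs to
    \<open>S n\<close> for all large \<open>n\<close>.\<close>
  define S where "S n = {k. k \<le> n \<and> (\<exists>Y. ?P n k Y)}" for n
  have fS: "finite (S n)" for n by (rule finite_subset[of _ "{..n}"]) (auto simp: S_def)
  \<comment> \<open>For the \<open>n\<close> at which nothing is available yet, zero operators are
    self-adjoint and commute, as is demanded for every \<open>n\<close>; the limit does not see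
    them.\<close>
  define Y where "Y n = (if S n = {} then (\<lambda>_ _ _. 0) else (SOME Y. ?P n (Max (S n)) Y))" for n
  have YP: "?P n (Max (S n)) (Y n)" if "S n \<noteq> {}" for n
  proof -
    have "\<exists>Y. ?P n (Max (S n)) Y" using Max_in[OF fS that] by (auto simp: S_def)
    then show ?thesis using that unfolding Y_def by (simp add: someI_ex)
  qed
  have alg: "in_local_alg d n (Y n i) \<and> op_selfadjoint (Y n i)" if "i < m" for n i
  proof (cases "S n = {}")
    case True
    then show ?thesis by (simp add: Y_def in_local_alg_def op_selfadjoint_def op_adjoint_def)
  next
    case False
    then show ?thesis using YP[OF False] that by (simp add: commuting_approx_def)
  qed
  have comm: "op_mult d n (Y n i) (Y n j) = op_mult d n (Y n j) (Y n i)" if "i < m" "j < m" for n i j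
  proof (cases "S n = {}")
    case True
    then show ?thesis by (simp add: Y_def)
  next
    case False
    then show ?thesis using YP[OF False] that by (simp add: commuting_approx_def)
  qed
  have lim: "(\<lambda>n. op_norm d n (\<lambda>\<sigma> \<tau>. mean_op d n (?A i) \<sigma> \<tau> - Y n i \<sigma> \<tau>)) \<longlonglongrightarrow> 0" if i: "i < m" for i
  proof (rule LIMSEQ_I)
    fix \<epsilon> :: real assume "0 < \<epsilon>"
    then obtain k where k: "1 / real (Suc k) < \<epsilon>" using nat_approx_posE by blast
    obtain n0 where n0: "\<And>n. n0 \<le> n \<Longrightarrow> \<exists>Y. ?P n k Y"
      using commuting_approx_exists[of d m ?A "1 / real (Suc k)"] assms by auto
    have "norm (op_norm d n (\<lambda>\<sigma> \<tau>. mean_op d n (?A i) \<sigma> \<tau> - Y n i \<sigma> \<tau>) - 0) < \<epsilon>" if n: "n0 + k \<le> n" for n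
    proof -
      have kS: "k \<in> S n" using n0[of n] n by (simp add: S_def)
      then have "?P n (Max (S n)) (Y n)" by (intro YP) auto
      then have "vec_norm d n (op_apply d n (\<lambda>\<sigma> \<tau>. mean_op d n (?A i) \<sigma> \<tau> - Y n i \<sigma> \<tau>) v)
          \<le> 1 / real (Suc (Max (S n))) * vec_norm d n v" for v
        using i unfolding commuting_approx_def by blast
      note bnd = op_norm_bounds[OF this]
      have "1 / real (Suc (Max (S n))) \<le> 1 / real (Suc k)"
        using Max_ge[OF fS kS] by (intro divide_left_mono) auto
      then show ?thesis using bnd k by simp
    qed
    then show "\<exists>no. \<forall>n\<ge>no. norm (op_norm d n (\<lambda>\<sigma> \<tau>. mean_op d n (?A i) \<sigma> \<tau> - Y n i \<sigma> \<tau>) - 0) < \<epsilon>" by blast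
  qed
  show ?thesis
  proof (intro exI[of _ "\<lambda>i n. Y n (i - 1)"] conjI ballI allI)
    fix i n assume i: "i \<in> {1..m}"
    then have "i - 1 < m" by auto
    then show "in_local_alg d n (Y n (i - 1))" "op_selfadjoint (Y n (i - 1))" using alg by auto
  next
    fix i assume "i \<in> {1..m}"
    then have "i - 1 < m" "Suc (i - 1) = i" by auto
    then show "(\<lambda>n. op_norm d n (\<lambda>\<sigma> \<tau>. mean_op d n (A i) \<sigma> \<tau> - Y n (i - 1) \<sigma> \<tau>)) \<longlonglongrightarrow> 0"
      using lim[of "i - 1"] by simp
  next
    fix i j n assume "i \<in> {1..m}" "j \<in> {1..m}"
    then have "i - 1 < m" "j - 1 < m" by auto
    then show "op_mult d n (Y n (i - 1)) (Y n (j - 1)) = op_mult d n (Y n (j - 1)) (Y n (i - 1))"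
      by (rule comm)
  qed
qed

end
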